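(* Let $\{S_j\}_{j=1,\dots,n}$ be an orthonormal basis of $\mathfrak h$. Then the map $\pi:\widehat{\mathfrak g}(\sigma)\to\mathrm{End}(V)$ defined (coefficientwise in $z$) by $$\widetilde X_\alpha(z)\mapsto\Gamma_\alpha(z)\ (\alpha\in\Delta),\qquad H(z)\mapsto\frac1{\sqrt2}\sum_{j=1}^n(H|S_j)\,a^{(j)}(z)\ (H\in\mathfrak h),$$ $$K\mapsto 1\ (\text{the identity operator}),\qquad d\mapsto-L_0:=-\sum_{j=1}^n\sum_{r\in\mathbf N_{\rm odd}}r\,x^{(j)}_r\frac{\partial}{\partial x^{(j)}_r}$$ is a representation of the Lie algebra $\widehat{\mathfrak g}(\sigma)$.
   Context: $\mathbf N_{\rm odd}$ is the set of positive odd integers and $\mathbf Z_{\rm odd}$ the set of odd integers. $\mathfrak g$ is a finite-dimensional complex simple Lie algebra of rank $n$ with symmetric Cartan matrix, $\mathfrak h$ a Cartan subalgebra, $\Delta$ the set of roots, $Q$ the root lattice, $(\,\cdot\,|\,\cdot\,)$ the invariant bilinear form normalized by $(\alpha|\alpha)=2$ for $\alpha\in\Delta$; $\mathfrak h$ and $\mathfrak h^*$ are identified via this form, and $H_\alpha\in\mathfrak h$ corresponds to $\alpha$. Let $\nu:Q\times Q\to\{\pm1\}$ be an asymmetry function: bimultiplicative with $\nu(\alpha,\alpha)=(-1)^{\frac12(\alpha|\alpha)}$, $\nu(\alpha,\beta)=(-1)^{(\alpha|\beta)}\nu(\beta,\alpha)$. Root vectors $X_\alpha$ ($\alpha\in\Delta$)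 are chosen such that $[X_\alpha,X_\beta]=\nu(\alpha,\beta)X_{\alpha+\beta}$ if $\alpha+\beta\in\Delta$ and $[X_\alpha,X_{-\alpha}]=-H_\alpha$ (so $(X_\alpha|X_{-\alpha})=-1$). Let $\sigma$ be the automorphism of $\mathfrak g$ with $\sigma(H)=-H$ ($H\in\mathfrak h$) and $\sigma(X_\alpha)=X_{-\alpha}$ ($\alpha\in\Delta$), and let $\mathfrak g_{\bar0},\mathfrak g_{\bar1}$ be its $+1$ and $-1$ eigenspaces. $\widehat{\mathfrak g}(\sigma)=\big(\bigoplus_{j\in\mathbf Z}\mathfrak g_{\bar j\bmod 2}\otimes t^j\big)\oplus\mathbf CK\oplus\mathbf Cd$ has the bracket $[X\otimes t^j,Y\otimes t^k]=[X,Y]\otimes t^{j+k}+\frac j2(X|Y)\delta_{j+k,0}K$, $[d,X\otimes t^j]=jX\otimes t^j$, $K$ central. Writing $X_{(j)}=X\otimes t^j$, put $$\widetilde X_\alpha(z)=\sum_{j\in\mathbf Z}(X_\alpha+(-1)^jX_{-\alpha})_{(j)}z^{-j},\qquad H(z)=\sum_{j\in\mathbf Z_{\rm odd}}H_{(j)}z^{-j-1}.$$ $\mathbf C\{Q/2Q\}$ is the commutative group algebra of $Q/2Q$ with basis $e^\gamma$ and $e^\alpha e^\beta=e^{\alpha+\beta}$; $V=\mathbf C\{Q/2Q\}\otimes\mathbf C[x^{(j)}_r;1\le j\le n,\ r\in\mathbf N_{\rm odd}]$. For $\lambda\in\mathbf C^n$, $$U_\lambda(z)=\exp\Big(\sum_{j}\sum_{r\in\mathbf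 N_{\rm odd}}\lambda_jx^{(j)}_rz^r\Big)\exp\Big(-\sum_j\sum_{r\in\mathbf N_{\rm odd}}\lambda_j\frac{z^{-r}}r\frac{\partial}{\partial x^{(j)}_r}\Big),$$ and $\Gamma_\alpha(z)(e^\gamma\otimes f)=\frac12\nu(\alpha,\gamma)e^{\alpha+\gamma}\otimes U_{(\sqrt2(\alpha|S_1),\dots,\sqrt2(\alpha|S_n))}(z)f$. For $r\in\mathbf N_{\rm odd}$: $a^{(j)}_r=\partial/\partial x^{(j)}_r$, $a^{(j)}_{-r}=r\,x^{(j)}_r$, and $a^{(j)}(z)=\sum_{r\in\mathbf Z_{\rm odd}}a^{(j)}_rz^{-r-1}$, acting on the polynomial factor of $V$. *)

theory Defs
  imports "HOL-Analysis.Analysis" "HOL-Library.Poly_Mapping" "HOL-Library.FuncSet"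
begin

alias lookup = Poly_Mapping.lookup
alias keys = Poly_Mapping.keys
alias single = Poly_Mapping.single

section \<open>Complex Lie algebras\<close>

class complex_lie_algebra = ab_group_add +
  fixes cscale :: "complex \<Rightarrow> 'a \<Rightarrow> 'a"  (infixr \<open>*\<^sub>C\<close> 75)
    and lie :: "'a \<Rightarrow> 'a \<Rightarrow> 'a"
  assumes cscale_add_right: "c *\<^sub>C (x + y) = c *\<^sub>C x + c *\<^sub>C y"
    and cscale_add_left: "(c + d) *\<^sub>C x = c *\<^sub>C x + d *\<^sub>C x"
    and cscale_cscale: "c *\<^sub>C (d *\<^sub>C x) = (c * d) *\<^sub>C x"
    and cscale_one: "1 *\<^sub>C x = x"
    and lie_add_left: "lie (x + y) z = lie x z + lie y z"
    and lie_add_right: "lie x (y + z) = lie x y + lie x z"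
    and lie_cscale_left: "lie (c *\<^sub>C x) y = c *\<^sub>C lie x y"
    and lie_cscale_right: "lie x (c *\<^sub>C y) = c *\<^sub>C lie x y"
    and lie_self: "lie x x = 0"
    and jacobi: "lie x (lie y z) + lie y (lie z x) + lie z (lie x y) = 0"

interpretation cvs: vector_space "cscale :: complex \<Rightarrow> 'a::complex_lie_algebra \<Rightarrow> 'a"
  by unfold_locales (simp_all add: cscale_add_right cscale_add_left cscale_cscale cscale_one)

definition lie_ideal :: "'a::complex_lie_algebra set \<Rightarrow> bool" where
  "lie_ideal I \<longleftrightarrow> cvs.subspace I \<and> (\<forall>x. \<forall>y\<in>I. lie x y \<in> I)"

definition simple_fd_lie_algebra :: "'a::complex_lie_algebra itself \<Rightarrow> bool" where
  "simple_fd_lie_algebra _ \<longleftrightarrow>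
     (\<exists>A::'a set. finite A \<and> cvs.span A = UNIV) \<and>
     (\<exists>x y::'a. lie x y \<noteq> 0) \<and>
     (\<forall>I::'a set. lie_ideal I \<longrightarrow> I = {0} \<or> I = UNIV)"

text \<open>The definition of a Cartan subalgebra of a semisimple complex Lie algebra used here is:
  a commutative subalgebra, all of whose elements are ad-diagonalizable, that is equal to its own
  centralizer (Kirillov, \<^emph>\<open>An Introduction to Lie Groups and Lie Algebras\<close>, Definition 6.32).\<close>

definition cartan_subalgebra :: "'a::complex_lie_algebra set \<Rightarrow> bool" where
  "cartan_subalgebra \<hh> \<longleftrightarrow>
     cvs.subspace \<hh> \<and>
     (\<forall>H\<in>\<hh>. \<forall>H'\<in>\<hh>. lie H H' = 0) \<and>
     (\<forall>H\<in>\<hh>. cvs.span {x. \<exists>c. lie H x = c *\<^sub>C x} = UNIV) \<and>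
     {x. \<forall>H\<in>\<hh>. lie H x = 0} = \<hh>"

definition invariant_form :: "('a::complex_lie_algebra \<Rightarrow> 'a \<Rightarrow> complex) \<Rightarrow> bool" where
  "invariant_form B \<longleftrightarrow>
     (\<forall>x y z. B (x + y) z = B x z + B y z) \<and>
     (\<forall>c x y. B (c *\<^sub>C x) y = c * B x y) \<and>
     (\<forall>x y. B x y = B y x) \<and>
     (\<forall>x y z. B (lie x y) z = B x (lie y z))"

lemma invariant_form_nondegenerate:
  fixes B :: "'a::complex_lie_algebra \<Rightarrow> 'a \<Rightarrow> complex"
  assumes "simple_fd_lie_algebra TYPE('a)" "invariant_form B" "B u v \<noteq> 0"
    and x: "\<forall>y. B x y = 0"
  shows "x = 0"
proof -
  let ?I = "{x. \<forall>y. B x y = 0}"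
  note form = assms(2)[unfolded invariant_form_def]
  note add = form[THEN conjunct1, rule_format]
    and sc = form[THEN conjunct2, THEN conjunct1, rule_format]
    and sym = form[THEN conjunct2, THEN conjunct2, THEN conjunct1, rule_format]
    and inv = form[THEN conjunct2, THEN conjunct2, THEN conjunct2, rule_format]
  have "B 0 y = 0" for y using add[of 0 0 y] by simp
  moreover have "B (lie x y) z = 0" if "\<forall>z. B y z = 0" for x y z
    using that inv[of z x y] sym[of "lie x y" z] sym[of "lie z x" y] by simp
  ultimately have "lie_ideal ?I"
    unfolding lie_ideal_def cvs.subspace_def by (auto simp: add sc)
  then have "?I = {0} \<or> ?I = UNIV" using assms(1) unfolding simple_fd_lie_algebra_def by blast
  then show ?thesis using assms(3) x by auto
qed


section \<open>Roots\<close>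

text \<open>The dual of \<open>\<hh>\<close> is identified with \<open>\<hh>\<close> by means of the form \<open>B\<close>: a root \<open>\<alpha>\<close> is
  an element of \<open>\<hh>\<close>, the linear functional it stands for is \<open>H \<mapsto> B \<alpha> H\<close>, and the element
  \<open>H\<^sub>\<alpha>\<close> is \<open>\<alpha>\<close> itself.\<close>

definition root_space ::
  "'a::complex_lie_algebra set \<Rightarrow> ('a \<Rightarrow> 'a \<Rightarrow> complex) \<Rightarrow> 'a \<Rightarrow> 'a set" where
  "root_space \<hh> B \<alpha> = {x. \<forall>H\<in>\<hh>. lie H x = B \<alpha> H *\<^sub>C x}"

definition roots :: "'a::complex_lie_algebra set \<Rightarrow> ('a \<Rightarrow> 'a \<Rightarrow> complex) \<Rightarrow> 'a set" where
  "roots \<hh> B = {\<alpha>\<in>\<hh>. \<alpha> \<noteq> 0 \<and> root_space \<hh> B \<alpha> \<noteq> {0}}"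

inductive_set root_lattice ::
  "'a::complex_lie_algebra set \<Rightarrow> ('a \<Rightarrow> 'a \<Rightarrow> complex) \<Rightarrow> 'a set"
  for \<hh> :: "'a set" and B :: "'a \<Rightarrow> 'a \<Rightarrow> complex" where
  zero: "0 \<in> root_lattice \<hh> B"
| add: "\<beta> \<in> root_lattice \<hh> B \<Longrightarrow> \<alpha> \<in> roots \<hh> B \<Longrightarrow> \<beta> + \<alpha> \<in> root_lattice \<hh> B"
| diff: "\<beta> \<in> root_lattice \<hh> B \<Longrightarrow> \<alpha> \<in> roots \<hh> B \<Longrightarrow> \<beta> - \<alpha> \<in> root_lattice \<hh> B"

lemma root_in_lattice: "\<alpha> \<in> roots \<hh> B \<Longrightarrow> \<alpha> \<in> root_lattice \<hh> B"
  using root_lattice.add[OF root_lattice.zero] by force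

lemma root_lattice_add:
  assumes "\<beta> \<in> root_lattice \<hh> B" "\<gamma> \<in> root_lattice \<hh> B"
  shows "\<beta> + \<gamma> \<in> root_lattice \<hh> B"
  using assms(2)
proof induction
  case zero
  then show ?case using assms(1) by simp
next
  case (add \<gamma> \<alpha>)
  then show ?case using root_lattice.add[of "\<beta> + \<gamma>" \<hh> B \<alpha>] by (simp add: algebra_simps)
next
  case (diff \<gamma> \<alpha>)
  then show ?case using root_lattice.diff[of "\<beta> + \<gamma>" \<hh> B \<alpha>] by (simp add: algebra_simps)
qed

lemma root_lattice_minus:
  assumes "\<beta> \<in> root_lattice \<hh> B"
  shows "- \<beta> \<in> root_lattice \<hh> B"
  using assms
proof induction
  case zero
  then show ?case using root_lattice.zero by simp
next
  case (add \<gamma> \<alpha>)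
  then show ?case using root_lattice.diff[of "- \<gamma>" \<hh> B \<alpha>] by simp
next
  case (diff \<gamma> \<alpha>)
  then show ?case using root_lattice.add[of "- \<gamma>" \<hh> B \<alpha>] by simp
qed

text \<open>The condition on root lengths says in particular that the Cartan matrix, with entries
  \<open>2 (\<alpha>|\<beta>) / (\<alpha>|\<alpha>)\<close> for simple roots \<open>\<alpha>\<close>, \<open>\<beta>\<close>, is symmetric.\<close>

definition normalized_invariant_form ::
  "'a::complex_lie_algebra set \<Rightarrow> ('a \<Rightarrow> 'a \<Rightarrow> complex) \<Rightarrow> bool" where
  "normalized_invariant_form \<hh> B \<longleftrightarrow>
     invariant_form B \<and> (\<forall>\<alpha>\<in>roots \<hh> B. B \<alpha> \<alpha> = 2)"

lemma cartan_matrix_symmetric: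
  assumes "normalized_invariant_form \<hh> B" "\<alpha> \<in> roots \<hh> B" "\<beta> \<in> roots \<hh> B"
  shows "2 * B \<alpha> \<beta> / B \<alpha> \<alpha> = 2 * B \<beta> \<alpha> / B \<beta> \<beta>"
  using assms unfolding normalized_invariant_form_def invariant_form_def by simp

text \<open>The exponents below are integers, for which the principal branch \<open>(-1) powr w\<close> is the
  usual power.\<close>

definition asymmetry_function ::
  "'a::ab_group_add set \<Rightarrow> ('a \<Rightarrow> 'a \<Rightarrow> complex) \<Rightarrow> ('a \<Rightarrow> 'a \<Rightarrow> complex) \<Rightarrow> bool" where
  "asymmetry_function Q B \<nu> \<longleftrightarrow>
     (\<forall>\<alpha>\<in>Q. \<forall>\<beta>\<in>Q. \<nu> \<alpha> \<beta> \<in> {1, -1}) \<and>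
     (\<forall>\<alpha>\<in>Q. \<forall>\<beta>\<in>Q. \<forall>\<gamma>\<in>Q. \<nu> (\<alpha> + \<beta>) \<gamma> = \<nu> \<alpha> \<gamma> * \<nu> \<beta> \<gamma>) \<and>
     (\<forall>\<alpha>\<in>Q. \<forall>\<beta>\<in>Q. \<forall>\<gamma>\<in>Q. \<nu> \<alpha> (\<beta> + \<gamma>) = \<nu> \<alpha> \<beta> * \<nu> \<alpha> \<gamma>) \<and>
     (\<forall>\<alpha>\<in>Q. \<nu> \<alpha> \<alpha> = (-1) powr (B \<alpha> \<alpha> / 2)) \<and>
     (\<forall>\<alpha>\<in>Q. \<forall>\<beta>\<in>Q. \<nu> \<alpha> \<beta> = (-1) powr (B \<alpha> \<beta>) * \<nu> \<beta> \<alpha>)"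

definition root_vectors ::
  "'a::complex_lie_algebra set \<Rightarrow> ('a \<Rightarrow> 'a \<Rightarrow> complex) \<Rightarrow> ('a \<Rightarrow> 'a \<Rightarrow> complex) \<Rightarrow>
   ('a \<Rightarrow> 'a) \<Rightarrow> bool" where
  "root_vectors \<hh> B \<nu> X \<longleftrightarrow>
     (\<forall>\<alpha>\<in>roots \<hh> B. X \<alpha> \<in> root_space \<hh> B \<alpha> - {0}) \<and>
     (\<forall>\<alpha>\<in>roots \<hh> B. \<forall>\<beta>\<in>roots \<hh> B. \<alpha> + \<beta> \<in> roots \<hh> B \<longrightarrow>
        lie (X \<alpha>) (X \<beta>) = \<nu> \<alpha> \<beta> *\<^sub>C X (\<alpha> + \<beta>)) \<and>
     (\<forall>\<alpha>\<in>roots \<hh> B. lie (X \<alpha>) (X (- \<alpha>)) = - \<alpha>)"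

definition lie_automorphism :: "('a::complex_lie_algebra \<Rightarrow> 'a) \<Rightarrow> bool" where
  "lie_automorphism \<sigma> \<longleftrightarrow>
     bij \<sigma> \<and> (\<forall>x y. \<sigma> (x + y) = \<sigma> x + \<sigma> y) \<and> (\<forall>c x. \<sigma> (c *\<^sub>C x) = c *\<^sub>C \<sigma> x) \<and>
     (\<forall>x y. \<sigma> (lie x y) = lie (\<sigma> x) (\<sigma> y))"

definition orthonormal_basis ::
  "'a::complex_lie_algebra set \<Rightarrow> ('a \<Rightarrow> 'a \<Rightarrow> complex) \<Rightarrow> ('n::finite \<Rightarrow> 'a) \<Rightarrow> bool" where
  "orthonormal_basis \<hh> B S \<longleftrightarrow>
     (\<forall>i j. B (S i) (S j) = (if i = j then 1 else 0)) \<and>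
     cvs.independent (range S) \<and> cvs.span (range S) = \<hh>"


section \<open>The twisted affine Lie algebra\<close>

text \<open>A triple \<open>(u, a, b)\<close> stands for \<open>(\<Sum>j. u\<^sub>j \<otimes> t\<^sup>j) + a K + b d\<close>.\<close>

type_synonym 'a affine = "(int \<Rightarrow>\<^sub>0 'a) \<times> complex \<times> complex"

definition eigenspace_parity :: "('a::complex_lie_algebra \<Rightarrow> 'a) \<Rightarrow> int \<Rightarrow> 'a set" where
  "eigenspace_parity \<sigma> j = (if even j then {x. \<sigma> x = x} else {x. \<sigma> x = - x})"

definition twisted_affine :: "('a::complex_lie_algebra \<Rightarrow> 'a) \<Rightarrow> 'a affine set" where
  "twisted_affine \<sigma> = {(u, a, b). \<forall>j. lookup u j \<in> eigenspace_parity \<sigma> j}"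

definition affine_scale :: "complex \<Rightarrow> 'a::complex_lie_algebra affine \<Rightarrow> 'a affine" where
  "affine_scale c = (\<lambda>(u, a, b). (Poly_Mapping.map (cscale c) u, c * a, c * b))"

definition affine_bracket ::
  "('a::complex_lie_algebra \<Rightarrow> 'a \<Rightarrow> complex) \<Rightarrow> 'a affine \<Rightarrow> 'a affine \<Rightarrow> 'a affine" where
  "affine_bracket B = (\<lambda>(u, a, b) (v, a', b').
     ((\<Sum>j\<in>keys u. \<Sum>k\<in>keys v. single (j + k) (lie (lookup u j) (lookup v k)))
        + (\<Sum>k\<in>keys v. single k ((b * of_int k) *\<^sub>C lookup v k))
        - (\<Sum>j\<in>keys u. single j ((b' * of_int j) *\<^sub>C lookup u j)),
      (\<Sum>j\<in>keys u. \<Sum>k\<in>keys v.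
         (of_int j / 2 * B (lookup u j) (lookup v k) when j + k = 0)),
      0))"

lemma affine_bracket_closed:
  assumes \<sigma>: "lie_automorphism \<sigma>"
    and x: "x \<in> twisted_affine \<sigma>" and y: "y \<in> twisted_affine \<sigma>"
  shows "affine_bracket B x y \<in> twisted_affine \<sigma>"
proof -
  have add: "\<sigma> (u + v) = \<sigma> u + \<sigma> v" and scale: "\<sigma> (c *\<^sub>C u) = c *\<^sub>C \<sigma> u"
    and hom: "\<sigma> (lie u v) = lie (\<sigma> u) (\<sigma> v)" for u v c
    using \<sigma> by (simp_all add: lie_automorphism_def)
  have zero: "\<sigma> 0 = 0" using add[of 0 0] by simp
  have minus: "\<sigma> (- u) = - \<sigma> u" for u
    using add[of u "- u"] zero by (simp add: eq_neg_iff_add_eq_0 add.commute)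
  have E0: "0 \<in> eigenspace_parity \<sigma> j"
    and Ea: "u \<in> eigenspace_parity \<sigma> j \<Longrightarrow> v \<in> eigenspace_parity \<sigma> j \<Longrightarrow> u + v \<in> eigenspace_parity \<sigma> j"
    and Em: "u \<in> eigenspace_parity \<sigma> j \<Longrightarrow> - u \<in> eigenspace_parity \<sigma> j"
    and Es: "u \<in> eigenspace_parity \<sigma> j \<Longrightarrow> c *\<^sub>C u \<in> eigenspace_parity \<sigma> j" for u v c j
    by (auto simp: eigenspace_parity_def zero add minus scale cvs.scale_minus_right split: if_splits)
  have lm: "lie (- u) v = - lie u v" "lie u (- v) = - lie u v" for u v :: 'a
    using lie_cscale_left[of "-1" u v] lie_cscale_right[of u "-1" v] by simp_all
  have El: "lie u v \<in> eigenspace_parity \<sigma> (j + k)"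
    if "u \<in> eigenspace_parity \<sigma> j" "v \<in> eigenspace_parity \<sigma> k" for u v j k
    using that by (auto simp: eigenspace_parity_def hom lm split: if_splits)
  have Esum: "sum f A \<in> eigenspace_parity \<sigma> j" if "\<And>i. i \<in> A \<Longrightarrow> f i \<in> eigenspace_parity \<sigma> j"
    for f :: "int \<Rightarrow> 'a" and A j
    using that by (induction A rule: infinite_finite_induct) (auto simp: E0 Ea)
  have Ewhen: "(u when P) \<in> eigenspace_parity \<sigma> j" if "P \<Longrightarrow> u \<in> eigenspace_parity \<sigma> j" for u P j
    using that by (cases P) (simp_all add: E0)
  obtain u a b where X: "x = (u, a, b)" by (cases x) auto
  obtain v a' b' where Y: "y = (v, a', b')" by (cases y) auto
  have u: "lookup u j \<in> eigenspace_parity \<sigma> j" and v: "lookup v j \<in> eigenspace_parity \<sigma> j" for j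
    using x y X Y by (simp_all add: twisted_affine_def)
  have "lookup (\<Sum>j\<in>keys u. \<Sum>k\<in>keys v. single (j + k) (lie (lookup u j) (lookup v k))) m
      \<in> eigenspace_parity \<sigma> m" for m
    unfolding lookup_sum lookup_single using El[OF u v] by (auto intro!: Esum Ewhen)
  moreover have "lookup (\<Sum>k\<in>keys v. single k ((b * of_int k) *\<^sub>C lookup v k)) m \<in> eigenspace_parity \<sigma> m" for m
    unfolding lookup_sum lookup_single using Es v by (auto intro!: Esum Ewhen)
  moreover have "lookup (\<Sum>k\<in>keys u. single k ((b' * of_int k) *\<^sub>C lookup u k)) m \<in> eigenspace_parity \<sigma> m" for m
    unfolding lookup_sum lookup_single using Es u by (auto intro!: Esum Ewhen)
  ultimately show ?thesis
    by (auto simp: X Y affine_bracket_def twisted_affine_def lookup_add lookup_minus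
        diff_conv_add_uminus simp del: add_uminus_conv_diff intro!: Ea Em)
qed

definition mode :: "'a::complex_lie_algebra \<Rightarrow> int \<Rightarrow> 'a affine" where
  "mode x j = (single j x, 0, 0)"

definition central_K :: "'a::complex_lie_algebra affine" where
  "central_K = (0, 1, 0)"

definition derivation_d :: "'a::complex_lie_algebra affine" where
  "derivation_d = (0, 0, 1)"

text \<open>A formal series \<open>\<Sum>m. A\<^sub>m z\<^sup>m\<close> over all integers \<open>m\<close> is given by the map \<open>m \<mapsto> A\<^sub>m\<close>.\<close>

definition X_tilde :: "('a::complex_lie_algebra \<Rightarrow> 'a) \<Rightarrow> 'a \<Rightarrow> int \<Rightarrow> 'a affine" where
  "X_tilde X \<alpha> m = (let j = - m in mode (X \<alpha> + ((-1) powi j) *\<^sub>C X (- \<alpha>)) j)"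

definition H_series :: "'a::complex_lie_algebra \<Rightarrow> int \<Rightarrow> 'a affine" where
  "H_series H m = (let j = - m - 1 in if odd j then mode H j else 0)"


section \<open>The Fock space\<close>

text \<open>The odd positive integer \<open>r\<close> is encoded by \<open>r div 2\<close>, so that the indeterminate
  \<open>(j, k)\<close> stands for \<open>x\<^sub>r\<^sup>(\<^sup>j\<^sup>)\<close> with \<open>r = 2 * k + 1\<close>.\<close>

type_synonym 'n fock = "(('n \<times> nat) \<Rightarrow>\<^sub>0 nat) \<Rightarrow>\<^sub>0 complex"

definition fock_scale :: "complex \<Rightarrow> 'n fock \<Rightarrow> 'n fock" where
  "fock_scale c f = Poly_Mapping.map ((*) c) f"

definition xvar :: "'n \<Rightarrow> nat \<Rightarrow> 'n fock" where
  "xvar j r = single (single (j, r div 2) 1) 1"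

definition pd :: "'n \<Rightarrow> nat \<Rightarrow> 'n fock \<Rightarrow> 'n fock" where
  "pd j r f = (\<Sum>m\<in>keys f. single (m - single (j, r div 2) 1)
                              (of_nat (lookup m (j, r div 2)) * lookup f m))"

text \<open>An element \<open>S\<close> of \<open>End(fock)[[t]]\<close> is given by its coefficients \<open>S m\<close>. If \<open>S 0 = 0\<close>, only
  the powers \<open>S\<^sup>k\<close> with \<open>k \<le> m\<close> contribute to the coefficient of \<open>t\<^sup>m\<close> in \<open>exp S\<close>.\<close>

primrec op_series_power ::
  "(nat \<Rightarrow> 'n fock \<Rightarrow> 'n fock) \<Rightarrow> nat \<Rightarrow> nat \<Rightarrow> 'n fock \<Rightarrow> 'n fock" where
  "op_series_power S 0 m f = (f when m = 0)"
| "op_series_power S (Suc k) m f = (\<Sum>i\<le>m. S i (op_series_power S k (m - i) f))"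

definition op_series_exp :: "(nat \<Rightarrow> 'n fock \<Rightarrow> 'n fock) \<Rightarrow> nat \<Rightarrow> 'n fock \<Rightarrow> 'n fock" where
  "op_series_exp S m f = (\<Sum>k\<le>m. fock_scale (1 / fact k) (op_series_power S k m f))"

definition creation_series :: "('n::finite \<Rightarrow> complex) \<Rightarrow> nat \<Rightarrow> 'n fock \<Rightarrow> 'n fock" where
  "creation_series l r f = ((\<Sum>j\<in>UNIV. fock_scale (l j) (xvar j r * f)) when odd r)"

text \<open>The next series is one in \<open>z\<^sup>-\<^sup>1\<close>.\<close>

definition annihilation_series :: "('n::finite \<Rightarrow> complex) \<Rightarrow> nat \<Rightarrow> 'n fock \<Rightarrow> 'n fock" where
  "annihilation_series l r f = ((\<Sum>j\<in>UNIV. fock_scale (- (l j / of_nat r)) (pd j r f)) when odd r)"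

text \<open>The coefficient of \<open>z\<^sup>m\<close> in \<open>U\<^sub>\<lambda>(z)\<close>; for given \<open>f\<close> the sum over \<open>q\<close> has finitely many
  nonzero terms.\<close>

definition U_series :: "('n::finite \<Rightarrow> complex) \<Rightarrow> int \<Rightarrow> 'n fock \<Rightarrow> 'n fock" where
  "U_series l m f =
     Sum_any (\<lambda>q::nat. op_series_exp (creation_series l) (nat (m + int q))
                 (op_series_exp (annihilation_series l) q f) when m + int q \<ge> 0)"

lemma fock_scale_0 [simp]: "fock_scale c 0 = 0"
  unfolding fock_scale_def by (rule poly_mapping_eqI) (simp add: map.rep_eq when_def)

lemma op_series_exp_0:
  assumes "\<And>i. S i 0 = 0"
  shows "op_series_exp S m 0 = 0"
proof -
  have "op_series_power S k m 0 = 0" for k m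
    by (induction k arbitrary: m) (simp_all add: assms)
  then show ?thesis by (simp add: op_series_exp_def)
qed

lemma U_series_0 [simp]: "U_series l m 0 = 0"
proof -
  have "op_series_exp (annihilation_series l) m 0 = 0" for m
    by (rule op_series_exp_0) (simp add: annihilation_series_def pd_def)
  moreover have "op_series_exp (creation_series l) m 0 = 0" for m
    by (rule op_series_exp_0) (simp add: creation_series_def)
  ultimately show ?thesis by (simp add: U_series_def)
qed

lemma sum_nonzero: "sum f A \<noteq> 0 \<Longrightarrow> \<exists>a\<in>A. f a \<noteq> 0"
  by (rule ccontr) (simp add: sum.neutral)

definition fock_weight :: "('n \<times> nat \<Rightarrow>\<^sub>0 nat) \<Rightarrow> nat" where
  "fock_weight m = (\<Sum>p\<in>keys m. (2 * snd p + 1) * lookup m p)"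

lemma fock_weight_minus:
  assumes "lookup m p \<noteq> 0"
  shows "fock_weight m = fock_weight (m - single p 1) + (2 * snd p + 1)"
proof -
  have w: "fock_weight n = (\<Sum>q\<in>keys m. (2 * snd q + 1) * lookup n q)" if "keys n \<subseteq> keys m" for n
    unfolding fock_weight_def using that by (intro sum.mono_neutral_left) (auto simp: in_keys_iff)
  have p: "p \<in> keys m" using assms by (simp add: in_keys_iff)
  have k: "keys (m - single p 1) \<subseteq> keys m"
    by (auto simp: in_keys_iff lookup_minus)
  have "(\<Sum>q\<in>keys m - {p}. (2 * snd q + 1) * lookup (m - single p 1) q) = (\<Sum>q\<in>keys m - {p}. (2 * snd q + 1) * lookup m q)"
    by (intro sum.cong) (auto simp: lookup_minus lookup_single)
  moreover have "lookup m p = lookup (m - single p 1) p + 1"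
    using assms by (simp add: lookup_minus)
  then have "(2 * snd p + 1) * lookup m p = (2 * snd p + 1) * lookup (m - single p 1) p + (2 * snd p + 1)"
    by (simp only: distrib_left mult_1_right)
  ultimately show ?thesis
    unfolding w[OF k] w[OF order.refl] sum.remove[OF finite_keys p] by linarith
qed

lemma annihilation_weight:
  assumes f: "\<And>m. m \<in> keys f \<Longrightarrow> fock_weight m + q \<le> N" and m: "m \<in> keys (annihilation_series l r f)"
  shows "fock_weight m + q + r \<le> N"
proof -
  have odd: "odd r" using m by (auto simp: annihilation_series_def when_def split: if_splits)
  then have "lookup (annihilation_series l r f) m \<noteq> 0" 
      "annihilation_series l r f = (\<Sum>j\<in>UNIV. fock_scale (- (l j / of_nat r)) (pd j r f))"
    using m by (simp_all add: in_keys_iff annihilation_series_def)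
  then obtain j where "lookup (fock_scale (- (l j / of_nat r)) (pd j r f)) m \<noteq> 0"
    using sum_nonzero[of "\<lambda>j. lookup (fock_scale (- (l j / of_nat r)) (pd j r f)) m" UNIV]
    by (auto simp: lookup_sum)
  then have "lookup (pd j r f) m \<noteq> 0"
    by (auto simp: fock_scale_def map.rep_eq when_def)
  then obtain n where n: "n \<in> keys f" 
     "lookup (single (n - single (j, r div 2) 1) (of_nat (lookup n (j, r div 2)) * lookup f n)) m \<noteq> 0"
    using sum_nonzero[of "\<lambda>n. lookup (single (n - single (j, r div 2) 1)
      (of_nat (lookup n (j, r div 2)) * lookup f n)) m" "keys f"]
    unfolding pd_def lookup_sum by blast
  then have "m = n - single (j, r div 2) 1" "lookup n (j, r div 2) \<noteq> 0"
    by (auto simp: lookup_single when_def split: if_splits)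
  then show ?thesis using fock_weight_minus[of n "(j, r div 2)"] f[OF n(1)] odd by simp
qed

lemma U_series_finite:
  "finite {q. (op_series_exp (creation_series l) (nat (m + int q))
                 (op_series_exp (annihilation_series l) q f) when m + int q \<ge> 0) \<noteq> 0}"
proof -
  have c: "op_series_exp (creation_series l) m 0 = 0" for m
    by (rule op_series_exp_0) (simp add: creation_series_def)
  have P: "fock_weight n + q \<le> N" if "\<And>m. m \<in> keys f \<Longrightarrow> fock_weight m \<le> N"
    "n \<in> keys (op_series_power (annihilation_series l) k q f)" for k q n N
    using that(2)
  proof (induction k arbitrary: q n)
    case 0
    then show ?case using that(1) by (auto simp: when_def split: if_splits)
  next
    case (Suc k)
    have "(\<Sum>i\<le>q. lookup (annihilation_series l i (op_series_power (annihilation_series l) k (q - i) f)) n) \<noteq> 0"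
      using Suc.prems by (simp add: in_keys_iff lookup_sum)
    from sum_nonzero[OF this] obtain i where i: "i \<le> q"
      "n \<in> keys (annihilation_series l i (op_series_power (annihilation_series l) k (q - i) f))"
      by (auto simp: in_keys_iff)
    have "fock_weight n + (q - i) + i \<le> N"
      by (rule annihilation_weight[OF _ i(2)]) (rule Suc.IH)
    then show ?case using i(1) by simp
  qed
  define N where "N = (\<Sum>m\<in>keys f. fock_weight m)"
  have N: "fock_weight m \<le> N" if "m \<in> keys f" for m
    unfolding N_def using that by (intro member_le_sum) auto
  have "op_series_exp (annihilation_series l) q f = 0" if "q > N" for q
  proof -
    have "op_series_power (annihilation_series l) k q f = 0" for k
    proof -
      have False if "n \<in> keys (op_series_power (annihilation_series l) k q f)" for n
        using P[OF N that] \<open>q > N\<close> by simp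
      then have "keys (op_series_power (annihilation_series l) k q f) = {}" by blast
      then show ?thesis by simp
    qed
    then show ?thesis by (simp add: op_series_exp_def)
  qed
  then have "(op_series_exp (creation_series l) (nat (m + int q))
                 (op_series_exp (annihilation_series l) q f) when m + int q \<ge> 0) = 0" if "q > N" for q
    using that by (simp only: c when_def if_cancel)
  then show ?thesis
    by (intro finite_subset[OF _ finite_atMost[of N]]) (metis (mono_tags, lifting) atMost_iff mem_Collect_eq not_le subsetI)
qed

definition heisenberg :: "'n \<Rightarrow> int \<Rightarrow> 'n fock \<Rightarrow> 'n fock" where
  "heisenberg j r f = (if r > 0 then pd j (nat r) f
                       else fock_scale (of_int (- r)) (xvar j (nat (- r)) * f))"

definition heisenberg_series :: "'n \<Rightarrow> int \<Rightarrow> 'n fock \<Rightarrow> 'n fock" where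
  "heisenberg_series j m f = (let r = - m - 1 in heisenberg j r f when odd r)"

definition energy :: "'n::finite fock \<Rightarrow> 'n fock" where
  "energy f = (\<Sum>j\<in>UNIV. Sum_any (\<lambda>r::nat. fock_scale (of_nat r) (xvar j r * pd j r f) when odd r))"


section \<open>The space V and the vertex operators\<close>

text \<open>The tensor product of the group algebra of \<open>Q/2Q\<close> with the Fock space is represented by
  the Fock-space-valued functions on \<open>Q/2Q\<close>: the element \<open>e\<^sup>\<gamma> \<otimes> f\<close> is \<open>single (coset Q \<gamma>) f\<close>.\<close>

type_synonym ('a, 'n) vertex = "'a set \<Rightarrow>\<^sub>0 'n fock"

definition coset :: "'a::ab_group_add set \<Rightarrow> 'a \<Rightarrow> 'a set" where
  "coset Q \<gamma> = {\<gamma> + (\<beta> + \<beta>) |\<beta>. \<beta> \<in> Q}"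

definition V_space :: "'a::ab_group_add set \<Rightarrow> ('a, 'n) vertex set" where
  "V_space Q = {v. keys v \<subseteq> coset Q ` Q}"

definition V_scale :: "complex \<Rightarrow> ('a, 'n) vertex \<Rightarrow> ('a, 'n) vertex" where
  "V_scale c v = Poly_Mapping.map (fock_scale c) v"

definition on_fock :: "('n fock \<Rightarrow> 'n fock) \<Rightarrow> ('a, 'n) vertex \<Rightarrow> ('a, 'n) vertex" where
  "on_fock T v = (\<Sum>c\<in>keys v. single c (T (lookup v c)))"

text \<open>The coefficient of \<open>z\<^sup>m\<close> in \<open>\<Gamma>\<^sub>\<alpha>(z)\<close>. On \<open>Q/2Q\<close> the value of \<open>\<nu> \<alpha>\<close> is well defined.\<close>

definition \<nu>_coset :: "('a \<Rightarrow> 'a \<Rightarrow> complex) \<Rightarrow> 'a \<Rightarrow> 'a set \<Rightarrow> complex" where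
  "\<nu>_coset \<nu> \<alpha> c = (THE s. \<forall>\<gamma>\<in>c. \<nu> \<alpha> \<gamma> = s)"

definition \<Gamma>_series ::
  "('a::ab_group_add \<Rightarrow> 'a \<Rightarrow> complex) \<Rightarrow> ('a \<Rightarrow> 'a \<Rightarrow> complex) \<Rightarrow> ('n::finite \<Rightarrow> 'a) \<Rightarrow>
   'a \<Rightarrow> int \<Rightarrow> ('a, 'n) vertex \<Rightarrow> ('a, 'n) vertex" where
  "\<Gamma>_series B \<nu> S \<alpha> m v =
     (\<Sum>c\<in>keys v. single ((+) \<alpha> ` c)
        (fock_scale (1 / 2 * \<nu>_coset \<nu> \<alpha> c)
           (U_series (\<lambda>j. complex_of_real (sqrt 2) * B \<alpha> (S j)) m (lookup v c))))"

lemma \<Gamma>_series_single: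
  assumes \<nu>: "asymmetry_function (root_lattice \<hh> B) B \<nu>"
    and \<alpha>: "\<alpha> \<in> root_lattice \<hh> B" and \<gamma>: "\<gamma> \<in> root_lattice \<hh> B"
  shows "\<Gamma>_series B \<nu> S \<alpha> m (single (coset (root_lattice \<hh> B) \<gamma>) f) =
         single (coset (root_lattice \<hh> B) (\<alpha> + \<gamma>))
           (fock_scale (1 / 2 * \<nu> \<alpha> \<gamma>)
             (U_series (\<lambda>j. complex_of_real (sqrt 2) * B \<alpha> (S j)) m f))"
proof -
  let ?Q = "root_lattice \<hh> B"
  have "\<nu> \<alpha> (\<gamma> + (\<beta> + \<beta>)) = \<nu> \<alpha> \<gamma>" if "\<beta> \<in> ?Q" for \<beta>
  proof -
    have mult: "\<nu> \<alpha> (\<delta> + \<epsilon>) = \<nu> \<alpha> \<delta> * \<nu> \<alpha> \<epsilon>" if "\<delta> \<in> ?Q" "\<epsilon> \<in> ?Q" for \<delta> \<epsilon>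
      using \<nu>[unfolded asymmetry_function_def, THEN conjunct2, THEN conjunct2, THEN conjunct1] \<alpha> that
      by simp
    have "\<nu> \<alpha> \<beta> = 1 \<or> \<nu> \<alpha> \<beta> = -1"
      using \<nu>[unfolded asymmetry_function_def, THEN conjunct1] \<alpha> that by simp
    then have "\<nu> \<alpha> \<beta> * \<nu> \<alpha> \<beta> = 1" by auto
    then show ?thesis
      by (simp only: mult[OF \<gamma> root_lattice_add[OF that that]] mult[OF that that] mult_1_right)
  qed
  then have const: "\<nu> \<alpha> \<delta> = \<nu> \<alpha> \<gamma>" if "\<delta> \<in> coset ?Q \<gamma>" for \<delta>
    using that unfolding coset_def by blast
  have "\<gamma> + (0 + 0) \<in> coset ?Q \<gamma>"
    unfolding coset_def using root_lattice.zero[of \<hh> B] by blast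
  then have mem: "\<gamma> \<in> coset ?Q \<gamma>" by simp
  have val: "\<nu>_coset \<nu> \<alpha> (coset ?Q \<gamma>) = \<nu> \<alpha> \<gamma>"
    unfolding \<nu>_coset_def
  proof (rule the_equality)
    show "\<forall>\<delta>\<in>coset ?Q \<gamma>. \<nu> \<alpha> \<delta> = \<nu> \<alpha> \<gamma>" using const by blast
    show "s = \<nu> \<alpha> \<gamma>" if "\<forall>\<delta>\<in>coset ?Q \<gamma>. \<nu> \<alpha> \<delta> = s" for s
      using bspec[OF that mem] by simp
  qed
  have shift: "(+) \<alpha> ` coset ?Q \<gamma> = coset ?Q (\<alpha> + \<gamma>)"
    unfolding coset_def setcompr_eq_image image_image by (simp add: add.assoc)
  show ?thesis
    by (cases "f = 0") (simp_all add: \<Gamma>_series_def val shift)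
qed


section \<open>Representations\<close>

definition endomorphisms ::
  "'v::ab_group_add set \<Rightarrow> (complex \<Rightarrow> 'v \<Rightarrow> 'v) \<Rightarrow> ('v \<Rightarrow> 'v) set" where
  "endomorphisms V sV =
     {T \<in> V \<rightarrow>\<^sub>E V. (\<forall>v\<in>V. \<forall>w\<in>V. T (v + w) = T v + T w) \<and> (\<forall>c. \<forall>v\<in>V. T (sV c v) = sV c (T v))}"

definition linear_to_End ::
  "'l::ab_group_add set \<Rightarrow> (complex \<Rightarrow> 'l \<Rightarrow> 'l) \<Rightarrow> 'v::ab_group_add set \<Rightarrow> (complex \<Rightarrow> 'v \<Rightarrow> 'v) \<Rightarrow>
   ('l \<Rightarrow> 'v \<Rightarrow> 'v) \<Rightarrow> bool" where
  "linear_to_End L sL V sV \<pi> \<longleftrightarrow>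
     \<pi> \<in> L \<rightarrow>\<^sub>E endomorphisms V sV \<and>
     (\<forall>x\<in>L. \<forall>y\<in>L. \<forall>v\<in>V. \<pi> (x + y) v = \<pi> x v + \<pi> y v) \<and>
     (\<forall>c. \<forall>x\<in>L. \<forall>v\<in>V. \<pi> (sL c x) v = sV c (\<pi> x v))"

definition lie_representation ::
  "'l::ab_group_add set \<Rightarrow> (complex \<Rightarrow> 'l \<Rightarrow> 'l) \<Rightarrow> ('l \<Rightarrow> 'l \<Rightarrow> 'l) \<Rightarrow>
   'v::ab_group_add set \<Rightarrow> (complex \<Rightarrow> 'v \<Rightarrow> 'v) \<Rightarrow> ('l \<Rightarrow> 'v \<Rightarrow> 'v) \<Rightarrow> bool" where
  "lie_representation L sL brL V sV \<pi> \<longleftrightarrow>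
     linear_to_End L sL V sV \<pi> \<and>
     (\<forall>x\<in>L. \<forall>y\<in>L. \<forall>v\<in>V. \<pi> (brL x y) v = \<pi> x (\<pi> y v) - \<pi> y (\<pi> x v))"

definition vertex_map ::
  "'a::complex_lie_algebra set \<Rightarrow> ('a \<Rightarrow> 'a \<Rightarrow> complex) \<Rightarrow> ('a \<Rightarrow> 'a \<Rightarrow> complex) \<Rightarrow> ('a \<Rightarrow> 'a) \<Rightarrow>
   ('a \<Rightarrow> 'a) \<Rightarrow> ('n::finite \<Rightarrow> 'a) \<Rightarrow> ('a affine \<Rightarrow> ('a, 'n) vertex \<Rightarrow> ('a, 'n) vertex) \<Rightarrow> bool" where
  "vertex_map \<hh> B \<nu> X \<sigma> S \<pi> \<longleftrightarrow>
     linear_to_End (twisted_affine \<sigma>) affine_scale (V_space (root_lattice \<hh> B)) V_scale \<pi> \<and>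
     (\<forall>v\<in>V_space (root_lattice \<hh> B).
        (\<forall>\<alpha>\<in>roots \<hh> B. \<forall>m. \<pi> (X_tilde X \<alpha> m) v = \<Gamma>_series B \<nu> S \<alpha> m v) \<and>
        (\<forall>H\<in>\<hh>. \<forall>m. \<pi> (H_series H m) v =
           V_scale (1 / complex_of_real (sqrt 2))
             (\<Sum>j\<in>UNIV. V_scale (B H (S j)) (on_fock (heisenberg_series j m) v))) \<and>
        \<pi> central_K v = v \<and>
        \<pi> derivation_d v = - on_fock energy v)"

end

theory Submission
  imports Defs
begin

text \<open>The vertex operator \<open>U\<^sub>\<lambda>(z)\<close> on the Fock space is accessible through its commutators
  \<open>[a\<^sub>r\<^sup>(\<^sup>j\<^sup>), U\<^sub>\<lambda>(z)] = \<lambda>\<^sub>j z\<^sup>r U\<^sub>\<lambda>(z)\<close> for all odd \<open>r\<close>, positive and negative (\<open>heisenberg_U\<close>), and through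
  the polynomials in \<open>U\<^sub>\<lambda>(z) 1\<close>, a power series in \<open>z\<close> whose constant term is \<open>1\<close> and whose other
  coefficients have no constant term. The Fock space is an irreducible module of the Heisenberg
  algebra. An identity between operators therefore follows from the equality of vacuum
  expectations, if commutators with the Heisenberg operators lead to identities of the same family
  (\<open>heisenberg_family_eq_0\<close>).

  The vacuum expectation of a product \<open>U\<^sub>\<lambda>(z) U\<^sub>\<mu>(w)\<close> is \<open>((1 - t) / (1 + t))\<^sup>c\<close>, where \<open>t = w / z\<close> and
  \<open>2 c = \<lambda> \<cdot> \<mu>\<close>. Its coefficients are obtained from a recursion that expresses the action of the
  energy operator (\<open>two_point_recursion\<close>). For the parameters that belong to roots \<open>\<alpha>\<close> and \<open>\<beta>\<close> the
  exponent \<open>c\<close> is \<open>(\<alpha>|\<beta>)\<close>. The function is \<open>1\<close> for \<open>(\<alpha>|\<beta>) = 0\<close>, has a simple pole at \<open>t = 1\<close> for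
  \<open>(\<alpha>|\<beta>) = -1\<close>, and a double pole there for \<open>(\<alpha>|\<beta>) = -2\<close>. The difference of its expansions for
  \<open>|w| < |z|\<close> and for \<open>|z| < |w|\<close> is accordingly zero, a multiple of the delta function, or a multiple
  of its derivative. This gives \<open>U_commute\<close>, \<open>U_anticommutator\<close> and \<open>U_opposite_commutator\<close>; the
  asymmetry function \<open>\<nu>\<close> provides the signs that convert these into the commutators of the operators
  \<open>\<Gamma>\<^sub>\<alpha>(z)\<close>. Positive values of \<open>(\<alpha>|\<beta>)\<close> reduce to negative ones by \<open>\<Gamma>\<^sub>-\<^sub>\<alpha>(z) = \<Gamma>\<^sub>\<alpha>(-z)\<close> (\<open>\<Gamma>_uminus\<close>).

  On the side of the Lie algebra, all roots have norm \<open>2\<close>. A nonzero bracket \<open>[X\<^sub>\<alpha>, X\<^sub>\<beta>]\<close> with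
  \<open>\<alpha> + \<beta> \<noteq> 0\<close> therefore forces \<open>(\<alpha>|\<beta>) = -1\<close>, from which follow the possible values of \<open>(\<alpha>|\<beta>)\<close>
  (\<open>inner_roots_cases\<close>); the norm also excludes \<open>2\<alpha>\<close> as a root, which makes the root spaces
  one-dimensional. The commuting diagonalizable operators \<open>ad S\<^sub>j\<close> decompose the Lie
  algebra into the Cartan subalgebra and the lines spanned by the root vectors
  (\<open>root_decomposition\<close>). Consequently the generators in the theorem span the twisted affine algebra
  (\<open>affine_induct\<close>), so the map \<open>\<pi>\<close> is unique. It exists because coordinates with respect to the form
  give a formula for it; that formula respects the linear relations between the generators, since
  these come from \<open>\<alpha> \<mapsto> -\<alpha>\<close> and \<open>\<Gamma>\<^sub>-\<^sub>\<alpha>(z) = \<Gamma>\<^sub>\<alpha>(-z)\<close>. It is a representation because for every pair of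
  generators the commutator of their images is the image of their bracket.\<close>

section \<open>The Heisenberg action on the Fock space\<close>

lemma lookup_fock_scale [simp]: "lookup (fock_scale c f) m = c * lookup f m"
  by (simp add: fock_scale_def map.rep_eq when_def)

lemma fock_scale_conv_mult: "fock_scale c f = single 0 c * f"
  by (simp add: fock_scale_def mult_map_scale_conv_mult)

lemma fock_scale_add: "fock_scale c (f + g) = fock_scale c f + fock_scale c g"
  and fock_scale_add_left: "fock_scale (c + d) f = fock_scale c f + fock_scale d f"
  and fock_scale_diff: "fock_scale c (f - g) = fock_scale c f - fock_scale c g"
  and fock_scale_fock_scale [simp]: "fock_scale c (fock_scale d f) = fock_scale (c * d) f"
  and fock_scale_zero_left [simp]: "fock_scale 0 f = 0"
  and fock_scale_one [simp]: "fock_scale 1 f = f"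
  and fock_scale_sum: "fock_scale c (sum F A) = (\<Sum>i\<in>A. fock_scale c (F i))"
  by (auto intro!: poly_mapping_eqI simp: lookup_add lookup_minus lookup_sum sum_distrib_left algebra_simps)

lemma fock_scale_mult_right: "g * fock_scale c f = fock_scale c (g * f)"
  by (simp add: fock_scale_conv_mult mult.left_commute)

definition fock_linear :: "('n fock \<Rightarrow> 'n fock) \<Rightarrow> bool" where
  "fock_linear T \<longleftrightarrow> (\<forall>f g. T (f + g) = T f + T g) \<and> (\<forall>c f. T (fock_scale c f) = fock_scale c (T f))"

lemma fock_linear_add: "fock_linear T \<Longrightarrow> T (f + g) = T f + T g"
  and fock_linear_scale: "fock_linear T \<Longrightarrow> T (fock_scale c f) = fock_scale c (T f)"
  by (simp_all add: fock_linear_def)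

lemma fock_linear_zero: "fock_linear T \<Longrightarrow> T 0 = 0"
  using fock_linear_add[of T 0 0] by simp

lemma fock_linear_diff: "fock_linear T \<Longrightarrow> T (f - g) = T f - T g"
  using fock_linear_add[of T "f - g" g] by simp

lemma fock_linear_sum: "fock_linear T \<Longrightarrow> T (sum F A) = (\<Sum>i\<in>A. T (F i))"
  by (induction A rule: infinite_finite_induct) (simp_all add: fock_linear_zero fock_linear_add)

lemma poly_mapping_sum_single: "f = (\<Sum>k\<in>keys f. single k (lookup f k))"
  by (rule poly_mapping_eqI) (auto simp: lookup_sum lookup_single in_keys_iff when_def sum.delta')

text \<open>Differentiation sends the monomials \<open>n\<close> with \<open>n - e = m\<close> to \<open>m\<close>. Subtraction of exponents is
  truncated, so besides \<open>n = m + e\<close> the monomial \<open>n = m\<close> can occur as well; its factor is the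
  exponent \<open>0\<close>.\<close>

lemma lookup_pd:
  "lookup (pd j r f) m =
     of_nat (lookup m (j, r div 2) + 1) * lookup f (m + single (j, r div 2) 1)"
proof -
  let ?e = "single (j, r div 2) (1::nat)"
  have "lookup (single (n - ?e) (of_nat (lookup n (j, r div 2)) * lookup f n)) m =
      (of_nat (lookup m (j, r div 2) + 1) * lookup f (m + ?e) when n = m + ?e)"
    if "n \<in> keys f" for n
  proof (cases "lookup n (j, r div 2) = 0")
    case True
    then have "n \<noteq> m + ?e" by (auto simp: lookup_add)
    then show ?thesis using True by (simp add: lookup_single)
  next
    case False
    have "n - ?e = m \<longleftrightarrow> n = m + ?e"
    proof
      assume "n - ?e = m"
      moreover have "n = (n - ?e) + ?e"
        using False by (intro poly_mapping_eqI) (auto simp: lookup_add lookup_minus lookup_single when_def)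
      ultimately show "n = m + ?e" by simp
    qed simp
    then show ?thesis by (auto simp: lookup_single lookup_add when_def)
  qed
  then have "lookup (pd j r f) m =
      (\<Sum>n\<in>keys f. of_nat (lookup m (j, r div 2) + 1) * lookup f (m + ?e) when n = m + ?e)"
    unfolding pd_def lookup_sum by (rule sum.cong[OF refl])
  also have "\<dots> = of_nat (lookup m (j, r div 2) + 1) * lookup f (m + ?e)"
    by (auto simp: when_def sum.delta' in_keys_iff)
  finally show ?thesis .
qed

text \<open>Together with the formula for \<open>pd\<close> this reduces the commutation relations of the
  creation and annihilation operators to identities between complex numbers.\<close>

lemma lookup_xvar_mult:
  "lookup (xvar j r * f) m =
     (if lookup m (j, r div 2) = 0 then 0 else lookup f (m - single (j, r div 2) 1))"
proof -
  let ?e = "single (j, r div 2) (1::nat)"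
  have *: "?e + k = m \<longleftrightarrow> lookup m (j, r div 2) \<noteq> 0 \<and> k = m - ?e" for k
  proof safe
    assume "0 < lookup m (j, r div 2)"
    then show "?e + (m - ?e) = m"
      by (intro poly_mapping_eqI) (auto simp: lookup_add lookup_minus lookup_single when_def)
  qed (auto simp: lookup_add)
  have "lookup (xvar j r * f) m = (\<Sum>k\<in>keys f. lookup f k when ?e + k = m)"
    by (subst (1) poly_mapping_sum_single[of f])
      (simp add: xvar_def sum_distrib_left mult_single lookup_sum lookup_single)
  then show ?thesis
    unfolding * by (auto simp: when_def sum.delta' in_keys_iff)
qed

lemma fock_linear_pd: "fock_linear (pd j r)"
  unfolding fock_linear_def
  by (auto intro!: poly_mapping_eqI simp: lookup_pd lookup_add algebra_simps)

lemma fock_linear_xvar: "fock_linear (\<lambda>f. xvar j r * f)"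
  unfolding fock_linear_def by (simp add: distrib_left fock_scale_mult_right)

lemma pd_commute: "pd j r (pd i s f) = pd i s (pd j r f)"
  by (rule poly_mapping_eqI) (auto simp: lookup_pd lookup_add lookup_single when_def algebra_simps)

lemma pd_xvar_mult:
  assumes "odd r" "odd s"
  shows "pd j r (xvar i s * f) = xvar i s * pd j r f + (f when (i, s) = (j, r))"
proof (rule poly_mapping_eqI)
  fix m
  let ?e = "single (j, r div 2) (1::nat)" and ?d = "single (i, s div 2) (1::nat)"
  have inj: "(i, s) = (j, r) \<longleftrightarrow> (i, s div 2) = (j, r div 2)"
    using assms by (auto elim!: oddE)
  show "lookup (pd j r (xvar i s * f)) m = lookup (xvar i s * pd j r f + (f when (i, s) = (j, r))) m"
  proof (cases "(i, s div 2) = (j, r div 2)")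
    case True
    have "m - ?e + ?e = m" if "lookup m (j, r div 2) \<noteq> 0"
      using that by (intro poly_mapping_eqI) (auto simp: lookup_add lookup_minus lookup_single when_def)
    then show ?thesis unfolding inj using True
      by (auto simp: lookup_pd lookup_xvar_mult lookup_add lookup_minus distrib_right of_nat_diff)
  next
    case False
    have "m + ?e - ?d = m - ?d + ?e" if "lookup m (i, s div 2) \<noteq> 0"
      using that False
      by (intro poly_mapping_eqI) (auto simp: lookup_add lookup_minus lookup_single when_def)
    then show ?thesis unfolding inj using False
      by (auto simp: lookup_pd lookup_xvar_mult lookup_add lookup_minus lookup_single when_def)
  qed
qed

lemma fock_linear_heisenberg: "fock_linear (heisenberg j r)"
proof (cases "r > 0")
  case True
  then show ?thesis using fock_linear_pd[of j "nat r"] by (simp add: fock_linear_def heisenberg_def)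
next
  case False
  then show ?thesis
    using fock_linear_xvar[of j "nat (- r)"]
    by (simp add: fock_linear_def heisenberg_def fock_scale_add mult.commute)
qed

text \<open>The canonical commutation relations \<open>[a\<^sub>r\<^sup>(\<^sup>j\<^sup>), a\<^sub>s\<^sup>(\<^sup>i\<^sup>)] = r \<delta>\<^sub>i\<^sub>j \<delta>\<^sub>r\<^sub>+\<^sub>s\<^sub>,\<^sub>0\<close>, for
  creation and annihilation operators at once.\<close>

lemma heisenberg_commutator:
  assumes "odd r" "odd s"
  shows "heisenberg j r (heisenberg i s f) =
    heisenberg i s (heisenberg j r f) + (fock_scale (of_int r) f when i = j \<and> r + s = 0)"
proof -
  have odd: "odd (nat \<bar>r\<bar>)" "odd (nat \<bar>s\<bar>)" using assms by (simp_all add: even_nat_iff)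
  have [simp]: "r \<noteq> 0" "s \<noteq> 0" using assms by auto
  consider "r > 0" "s > 0" | "r > 0" "s < 0" | "r < 0" "s > 0" | "r < 0" "s < 0"
    using \<open>r \<noteq> 0\<close> \<open>s \<noteq> 0\<close> by linarith
  then show ?thesis
  proof cases
    case 1
    then show ?thesis by (simp add: heisenberg_def pd_commute)
  next
    case 2
    have "nat (- s) = nat r \<longleftrightarrow> r + s = 0" using 2 by linarith
    then show ?thesis
      using 2 odd pd_xvar_mult[of "nat r" "nat (- s)" j i f]
      by (auto simp: heisenberg_def fock_scale_add when_def fock_linear_scale[OF fock_linear_pd]
          add_eq_0_iff)
  next
    case 3
    have "nat (- r) = nat s \<longleftrightarrow> r + s = 0" using 3 by linarith
    then show ?thesis
      using 3 odd pd_xvar_mult[of "nat s" "nat (- r)" i j f]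
      by (auto simp: heisenberg_def fock_scale_add when_def fock_linear_scale[OF fock_linear_pd] intro!: poly_mapping_eqI simp: lookup_add)
  next
    case 4
    then show ?thesis
      by (simp add: heisenberg_def fock_scale_mult_right mult.left_commute mult.commute[of "complex_of_int s"])
  qed
qed

section \<open>Commutators of the vertex operators with the Heisenberg operators\<close>

lemma fock_linear_sum_fun:
  assumes "\<And>i. i \<in> A \<Longrightarrow> fock_linear (F i)"
  shows "fock_linear (\<lambda>f. \<Sum>i\<in>A. F i f)"
  using assms by (simp add: fock_linear_def sum.distrib fock_scale_sum)

lemma fock_linear_scale_fun: "fock_linear T \<Longrightarrow> fock_linear (\<lambda>f. fock_scale c (T f))"
  by (simp add: fock_linear_def fock_scale_add mult.commute)

lemma fock_linear_when: "fock_linear T \<Longrightarrow> fock_linear (\<lambda>f. T f when P)"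
  by (cases P) (simp_all add: fock_linear_def)

lemma fock_linear_compose: "fock_linear S \<Longrightarrow> fock_linear T \<Longrightarrow> fock_linear (\<lambda>f. S (T f))"
  by (simp add: fock_linear_def)

text \<open>Both exponents of \<open>U\<^sub>\<lambda>(z)\<close> are linear combinations of Heisenberg operators; hence a Heisenberg
  operator has a scalar commutator with either of them.\<close>

lemma creation_series_conv_heisenberg:
  "creation_series l s f =
     ((\<Sum>i\<in>UNIV. fock_scale (l i / of_nat s) (heisenberg i (- int s) f)) when odd s)"
  by (cases "s = 0") (auto simp: creation_series_def heisenberg_def when_def)

lemma annihilation_series_conv_heisenberg:
  "annihilation_series l s f =
     ((\<Sum>i\<in>UNIV. fock_scale (- (l i / of_nat s)) (heisenberg i (int s) f)) when odd s)"
  by (cases "s = 0") (auto simp: annihilation_series_def heisenberg_def when_def)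

lemma fock_linear_creation: "fock_linear (creation_series l s)"
  unfolding creation_series_conv_heisenberg
  by (intro fock_linear_when fock_linear_sum_fun fock_linear_scale_fun fock_linear_heisenberg)

lemma fock_linear_annihilation: "fock_linear (annihilation_series l s)"
  unfolding annihilation_series_conv_heisenberg
  by (intro fock_linear_when fock_linear_sum_fun fock_linear_scale_fun fock_linear_heisenberg)

lemma heisenberg_linear_combination:
  assumes "odd r" "odd s"
  shows "heisenberg j r (\<Sum>i\<in>UNIV. fock_scale (c i) (heisenberg (i::'n::finite) s f)) =
    (\<Sum>i\<in>UNIV. fock_scale (c i) (heisenberg i s (heisenberg j r f))) +
    (fock_scale (c j * of_int r) f when r + s = 0)"
proof -
  note lin = fock_linear_heisenberg[of j r]
  have "fock_scale (c i) (fock_scale (of_int r) f when i = j \<and> r + s = 0) =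
      (fock_scale (c j * of_int r) f when r + s = 0 when i = j)" for i
    by (auto simp: when_def)
  then show ?thesis
    by (simp add: fock_linear_sum[OF lin] fock_linear_scale[OF lin] heisenberg_commutator[OF assms]
        fock_scale_add sum.distrib) (simp add: when_def sum.delta)
qed

lemma heisenberg_creation:
  assumes "odd r"
  shows "heisenberg j r (creation_series l s f) =
     creation_series l s (heisenberg j r f) + (fock_scale (l j) f when int s = r)"
proof (cases "odd s")
  case True
  then have "s \<noteq> 0" by (cases "s = 0") auto
  then show ?thesis using heisenberg_linear_combination[of r "- int s" j "\<lambda>i. l i / of_nat s" f] assms True
    by (auto simp: creation_series_conv_heisenberg when_def)
next
  case False
  then have "int s \<noteq> r" using assms by auto
  then show ?thesis using False
    by (simp add: creation_series_def fock_linear_zero[OF fock_linear_heisenberg])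
qed

lemma heisenberg_annihilation:
  assumes "odd r"
  shows "heisenberg j r (annihilation_series l s f) =
     annihilation_series l s (heisenberg j r f) + (fock_scale (l j) f when int s = - r)"
proof (cases "odd s")
  case True
  then have "s \<noteq> 0" by (cases "s = 0") auto
  moreover have "r = - int s" if "int s = - r" using that by simp
  moreover have "- (l j * of_int r / of_nat s) = l j" if "int s = - r"
  proof -
    have "of_int r = - (of_nat s :: complex)" using that by (metis of_int_minus of_int_of_nat_eq minus_minus)
    then show ?thesis using \<open>s \<noteq> 0\<close> by simp
  qed
  ultimately show ?thesis
    using heisenberg_linear_combination[of r "int s" j "\<lambda>i. - (l i / of_nat s)" f] assms True
    by (auto simp: annihilation_series_conv_heisenberg when_def)
next
  case False
  then have "int s \<noteq> - r" using assms by (metis even_minus even_of_nat)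
  then show ?thesis using False
    by (simp add: annihilation_series_def fock_linear_zero[OF fock_linear_heisenberg])
qed

lemma creation_series_0: "creation_series l 0 f = 0"
  and annihilation_series_0: "annihilation_series l 0 f = 0"
  by (simp_all add: creation_series_def annihilation_series_def)

lemma fock_linear_op_series_power:
  assumes "\<And>i. fock_linear (S i)"
  shows "fock_linear (op_series_power S k m)"
proof (induction k arbitrary: m)
  case 0
  show ?case by (auto simp: fock_linear_def when_def)
next
  case (Suc k)
  show ?case
    unfolding op_series_power.simps by (rule fock_linear_sum_fun, rule fock_linear_compose[OF assms Suc])
qed

text \<open>If \<open>[T, S]\<close> is the scalar series \<open>c t\<^sup>r\<close>, then \<open>[T, S\<^sup>k] = k c t\<^sup>r S\<^sup>k\<^sup>-\<^sup>1\<close>.\<close>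

lemma op_series_power_commutator:
  assumes S: "\<And>i. fock_linear (S i)" and T: "fock_linear T"
    and comm: "\<And>i f. T (S i f) = S i (T f) + (fock_scale c f when i = r)"
  shows "T (op_series_power S k m f) = op_series_power S k m (T f) +
    (fock_scale (of_nat k * c) (op_series_power S (k - 1) (m - r) f) when r \<le> m)"
proof (induction k arbitrary: m)
  case 0
  show ?case by (simp add: when_def fock_linear_zero[OF T])
next
  case (Suc k)
  have "T (op_series_power S (Suc k) m f) =
      (\<Sum>i\<le>m. S i (op_series_power S k (m - i) (T f)))
      + (\<Sum>i\<le>m. S i (fock_scale (of_nat k * c) (op_series_power S (k - 1) (m - i - r) f) when r \<le> m - i))
      + (\<Sum>i\<le>m. fock_scale c (op_series_power S k (m - i) f) when i = r)"
    by (simp add: fock_linear_sum[OF T] comm Suc.IH fock_linear_add[OF S] sum.distrib)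
  moreover have "(\<Sum>i\<le>m. fock_scale c (op_series_power S k (m - i) f) when i = r) =
      (fock_scale c (op_series_power S k (m - r) f) when r \<le> m)"
    by (auto simp: when_def sum.delta)
  moreover have "(\<Sum>i\<le>m. S i (fock_scale (of_nat k * c) (op_series_power S (k - 1) (m - i - r) f) when r \<le> m - i))
      = (fock_scale (of_nat k * c) (op_series_power S k (m - r) f) when r \<le> m)"
  proof (cases "k = 0 \<or> m < r")
    case True
    then have "(S i (fock_scale (of_nat k * c) (op_series_power S (k - 1) (m - i - r) f) when r \<le> m - i)) = 0"
      for i by (auto simp: when_def fock_linear_zero[OF S])
    moreover have "(fock_scale (of_nat k * c) (op_series_power S k (m - r) f) when r \<le> m) = 0"
      using True by auto
    ultimately show ?thesis by (simp only: sum.neutral_const)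
  next
    case False
    then obtain k' where k: "k = Suc k'" "r \<le> m" by (cases k) auto
    have "(\<Sum>i\<le>m. S i (fock_scale (of_nat k * c) (op_series_power S (k - 1) (m - i - r) f) when r \<le> m - i)) =
        (\<Sum>i\<le>m - r. fock_scale (of_nat k * c) (S i (op_series_power S k' (m - r - i) f)))"
      using k by (intro sum.mono_neutral_cong_right)
        (auto simp: when_def fock_linear_zero[OF S] fock_linear_scale[OF S] add.commute)
    then show ?thesis using k by (simp add: fock_scale_sum)
  qed
  ultimately show ?case
    by (auto simp: when_def fock_scale_add_left distrib_right)
qed

text \<open>This makes the truncation \<open>k \<le> m\<close> in the definition of the exponential harmless when the index
  \<open>m\<close> is lowered to \<open>m - r\<close>.\<close>

lemma op_series_power_eq_0:
  assumes S: "\<And>i. fock_linear (S i)" and S0: "\<And>f. S 0 f = 0" and "m < k"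
  shows "op_series_power S k m f = 0"
  using \<open>m < k\<close>
proof (induction k arbitrary: m)
  case (Suc k)
  have "S i (op_series_power S k (m - i) f) = 0" if "i \<le> m" for i
    using Suc that by (cases "i = 0") (auto simp: S0 fock_linear_zero[OF S])
  then show ?case by simp
qed simp

lemma fock_linear_op_series_exp:
  "(\<And>i. fock_linear (S i)) \<Longrightarrow> fock_linear (op_series_exp S m)"
  unfolding op_series_exp_def
  by (intro fock_linear_sum_fun fock_linear_scale_fun fock_linear_op_series_power) auto

text \<open>The formal version of \<open>[T, exp S] = [T, S] exp S\<close> for a scalar series \<open>[T, S]\<close>: the formulas for the
  powers, divided by \<open>k!\<close>, add up to a shifted exponential series.\<close>

lemma op_series_exp_commutator:
  assumes S: "\<And>i. fock_linear (S i)" and T: "fock_linear T" and S0: "\<And>f. S 0 f = 0"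
    and r: "r > 0"
    and comm: "\<And>i f. T (S i f) = S i (T f) + (fock_scale c f when i = r)"
  shows "T (op_series_exp S m f) = op_series_exp S m (T f) +
    (fock_scale c (op_series_exp S (m - r) f) when r \<le> m)"
proof -
  have "(\<Sum>k\<le>m. fock_scale (1 / fact k * (of_nat k * c)) (op_series_power S (k - 1) (m - r) f)) =
      (\<Sum>k\<le>m - r. fock_scale (c / fact k) (op_series_power S k (m - r) f))" if le: "r \<le> m"
  proof -
    obtain m' where m: "m = Suc m'" "m - r \<le> m'"
      using r le by (cases m) auto
    have "(\<Sum>k\<le>m. fock_scale (1 / fact k * (of_nat k * c)) (op_series_power S (k - 1) (m - r) f)) =
        (\<Sum>k\<le>m'. fock_scale (c / fact k) (op_series_power S k (m - r) f))"
      unfolding m(1) sum.atMost_Suc_shift by (simp del: of_nat_Suc)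
    also have "\<dots> = (\<Sum>k\<le>m - r. fock_scale (c / fact k) (op_series_power S k (m - r) f))"
      using m(2) by (intro sum.mono_neutral_right) (auto simp: op_series_power_eq_0[of S, OF S S0])
    finally show ?thesis .
  qed
  then show ?thesis
    by (auto simp: op_series_exp_def fock_linear_sum[OF T] fock_linear_scale[OF T] when_def
        op_series_power_commutator[OF S T comm] fock_scale_add sum.distrib fock_scale_sum)
qed

text \<open>The coefficients of the two exponentials, extended by \<open>0\<close> to negative indices, so that index
  shifts are bijections of the integers and need no case distinction.\<close>

definition creation_exp :: "('n::finite \<Rightarrow> complex) \<Rightarrow> int \<Rightarrow> 'n fock \<Rightarrow> 'n fock" where
  "creation_exp l m f = (op_series_exp (creation_series l) (nat m) f when m \<ge> 0)"

definition annihilation_exp :: "('n::finite \<Rightarrow> complex) \<Rightarrow> int \<Rightarrow> 'n fock \<Rightarrow> 'n fock" where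
  "annihilation_exp l q f = (op_series_exp (annihilation_series l) (nat q) f when q \<ge> 0)"

lemma fock_linear_creation_exp: "fock_linear (creation_exp l m)"
  unfolding creation_exp_def
  by (intro fock_linear_when fock_linear_op_series_exp fock_linear_creation)

lemma fock_linear_annihilation_exp: "fock_linear (annihilation_exp l m)"
  unfolding annihilation_exp_def
  by (intro fock_linear_when fock_linear_op_series_exp fock_linear_annihilation)

text \<open>The positive modes \<open>a\<^sub>r\<close> see only the creation exponential, the negative ones only the
  annihilation exponential.\<close>

lemma heisenberg_creation_exp:
  assumes "odd r"
  shows "heisenberg j r (creation_exp l m f) = creation_exp l m (heisenberg j r f) +
    (fock_scale (l j) (creation_exp l (m - r) f) when r > 0)"
proof (cases "m \<ge> 0")
  case m: True
  show ?thesis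
  proof (cases "r > 0")
    case True
    have "heisenberg j r (creation_series l i f) =
        creation_series l i (heisenberg j r f) + (fock_scale (l j) f when i = nat r)" for i f
      using True by (subst heisenberg_creation[OF assms]) (auto simp: when_def)
    from op_series_exp_commutator[OF fock_linear_creation fock_linear_heisenberg _ _ this, of "nat m" f]
    have "heisenberg j r (op_series_exp (creation_series l) (nat m) f) =
      op_series_exp (creation_series l) (nat m) (heisenberg j r f) +
      (fock_scale (l j) (op_series_exp (creation_series l) (nat m - nat r) f) when nat r \<le> nat m)"
      using True by (simp add: creation_series_0)
    moreover have "nat m - nat r = nat (m - r)" using True m by simp
    ultimately show ?thesis using True m by (auto simp: creation_exp_def when_def)
  next
    case False
    \<comment> \<open>A vanishing commutator is presented as \<open>0 t\<^sup>1\<close>.\<close>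
    have "heisenberg j r (creation_series l i f) =
        creation_series l i (heisenberg j r f) + (fock_scale 0 f when i = 1)" for i f
    proof -
      have "int i \<noteq> r" using False assms by (cases "r = 0") auto
      then show ?thesis by (simp add: heisenberg_creation[OF assms])
    qed
    from op_series_exp_commutator[OF fock_linear_creation fock_linear_heisenberg _ _ this, of "nat m" f]
    show ?thesis using False m by (auto simp: creation_exp_def when_def creation_series_0)
  qed
qed (auto simp: creation_exp_def when_def fock_linear_zero[OF fock_linear_heisenberg])

lemma heisenberg_annihilation_exp:
  assumes "odd r"
  shows "heisenberg j r (annihilation_exp l m f) = annihilation_exp l m (heisenberg j r f) +
    (fock_scale (l j) (annihilation_exp l (m + r) f) when r < 0)"
proof (cases "m \<ge> 0")
  case m: True
  show ?thesis
  proof (cases "r < 0")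
    case True
    have "heisenberg j r (annihilation_series l i f) =
        annihilation_series l i (heisenberg j r f) + (fock_scale (l j) f when i = nat (- r))" for i f
      using True by (subst heisenberg_annihilation[OF assms]) (auto simp: when_def)
    from op_series_exp_commutator[OF fock_linear_annihilation fock_linear_heisenberg _ _ this, of "nat m" f]
    have "heisenberg j r (op_series_exp (annihilation_series l) (nat m) f) =
      op_series_exp (annihilation_series l) (nat m) (heisenberg j r f) +
      (fock_scale (l j) (op_series_exp (annihilation_series l) (nat m - nat (- r)) f) when nat (- r) \<le> nat m)"
      using True by (simp add: annihilation_series_0)
    moreover have "nat m - nat (- r) = nat (m + r)" using True m by simp
    ultimately show ?thesis using True m by (auto simp: annihilation_exp_def when_def)
  next
    case False
    have "heisenberg j r (annihilation_series l i f) =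
        annihilation_series l i (heisenberg j r f) + (fock_scale 0 f when i = 1)" for i f
    proof -
      have "int i \<noteq> - r" using False assms by (cases "r = 0") auto
      then show ?thesis by (simp add: heisenberg_annihilation[OF assms])
    qed
    from op_series_exp_commutator[OF fock_linear_annihilation fock_linear_heisenberg _ _ this, of "nat m" f]
    show ?thesis using False m by (auto simp: annihilation_exp_def when_def annihilation_series_0)
  qed
qed (auto simp: annihilation_exp_def when_def fock_linear_zero[OF fock_linear_heisenberg])

lemma U_series_finite_int: "finite {q. creation_exp l (m + q) (annihilation_exp l q f) \<noteq> 0}"
  (is "finite ?A")
proof -
  have "?A \<subseteq> int ` {q. (op_series_exp (creation_series l) (nat (m + int q))
                 (op_series_exp (annihilation_series l) q f) when m + int q \<ge> 0) \<noteq> 0}"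
  proof
    fix q assume "q \<in> ?A"
    moreover from this have "q \<ge> 0"
      by (auto simp: annihilation_exp_def when_def fock_linear_zero[OF fock_linear_creation_exp] split: if_splits)
    ultimately show "q \<in> int ` {q. (op_series_exp (creation_series l) (nat (m + int q))
                 (op_series_exp (annihilation_series l) q f) when m + int q \<ge> 0) \<noteq> 0}"
      by (intro image_eqI[of _ _ "nat q"]) (auto simp: creation_exp_def annihilation_exp_def)
  qed
  then show ?thesis by (rule finite_subset) (intro finite_imageI U_series_finite)
qed

lemma U_series_int:
  "U_series l m f = Sum_any (\<lambda>q. creation_exp l (m + q) (annihilation_exp l q f))"
proof -
  let ?g = "\<lambda>q. creation_exp l (m + q) (annihilation_exp l q f)"
  let ?h = "\<lambda>q. (op_series_exp (creation_series l) (nat (m + int q))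
                 (op_series_exp (annihilation_series l) q f) when m + int q \<ge> 0)"
  have h: "?h q = ?g (int q)" for q by (auto simp: creation_exp_def annihilation_exp_def when_def)
  have neg: "q \<in> range int" if "?g q \<noteq> 0" for q
    using that by (cases q rule: int_cases3)
      (auto simp: annihilation_exp_def when_def fock_linear_zero[OF fock_linear_creation_exp])
  have "{q. ?g q \<noteq> 0} = int ` {q. ?h q \<noteq> 0}" unfolding h using neg by auto
  then show ?thesis
    unfolding U_series_def Sum_any.expand_set
    by (simp add: sum.reindex h)
qed

lemma Sum_any_additive:
  fixes T :: "'b::ab_group_add \<Rightarrow> 'c::ab_group_add"
  assumes "\<And>f g. T (f + g) = T f + T g" and fin: "finite {a. g a \<noteq> 0}"
  shows "T (Sum_any g) = Sum_any (\<lambda>a. T (g a))"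
proof -
  have T0: "T 0 = 0" using assms(1)[of 0 0] by simp
  have "T (sum g A) = (\<Sum>a\<in>A. T (g a))" for A
    by (induction A rule: infinite_finite_induct) (simp_all add: T0 assms(1))
  moreover have "Sum_any (\<lambda>a. T (g a)) = (\<Sum>a\<in>{a. g a \<noteq> 0}. T (g a))"
    by (rule Sum_any.expand_superset[OF fin]) (auto simp: T0)
  ultimately show ?thesis unfolding Sum_any.expand_set[of g] by simp
qed

lemma fock_linear_U: "fock_linear (U_series l m)"
  unfolding fock_linear_def
proof safe
  note lin = fock_linear_compose[OF fock_linear_creation_exp fock_linear_annihilation_exp]
  show "U_series l m (f + g) = U_series l m f + U_series l m g" for f g
    unfolding U_series_int by (simp add: fock_linear_add[OF lin] Sum_any.distrib[OF U_series_finite_int U_series_finite_int])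
  show "U_series l m (fock_scale c f) = fock_scale c (U_series l m f)" for c f
    unfolding U_series_int
    by (subst Sum_any_additive[of "fock_scale c", OF _ U_series_finite_int])
      (simp_all add: fock_linear_scale[OF lin] fock_scale_add)
qed

text \<open>Coefficientwise \<open>[a\<^sub>r\<^sup>(\<^sup>j\<^sup>), U\<^sub>\<lambda>(z)] = \<lambda>\<^sub>j z\<^sup>r U\<^sub>\<lambda>(z)\<close> for every odd \<open>r\<close>. For \<open>r > 0\<close> the right-hand
  side comes from the creation exponential, for \<open>r < 0\<close> from the annihilation exponential after a
  shift of the summation index. The relations between vertex operators below rest on this
  formula and on the action on the constant polynomial \<open>1\<close>.\<close>

lemma heisenberg_U:
  assumes "odd r"
  shows "heisenberg j r (U_series l m f) =
    U_series l m (heisenberg j r f) + fock_scale (l j) (U_series l (m - r) f)"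
proof -
  let ?C = "creation_exp l" and ?A = "annihilation_exp l"
  have shift: "Sum_any (\<lambda>q. ?C (m + q) (?A (q + r) f)) = U_series l (m - r) f"
    unfolding U_series_int
    by (rule Sum_any.reindex_cong[where l = "\<lambda>q. q - r"])
      (auto simp: fun_eq_iff algebra_simps intro!: bij_betw_byWitness[where f' = "\<lambda>q. q + r"])
  have "{q. ?C (m + q) (?A (q + r) f) \<noteq> 0} \<subseteq> (\<lambda>q. q - r) ` {q. ?C (m - r + q) (?A q f) \<noteq> 0}"
    by (auto intro!: image_eqI[where x = "_ + r"])
  then have fin: "finite {q. ?C (m + q) (?A (q + r) f) \<noteq> 0}"
    by (rule finite_subset) (intro finite_imageI U_series_finite_int)
  have scale: "Sum_any (\<lambda>q. fock_scale (l j) (g q)) = fock_scale (l j) (Sum_any g)"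
    "finite {q. fock_scale (l j) (g q) \<noteq> 0}"
    if "finite {q. g q \<noteq> 0}" for g :: "int \<Rightarrow> _"
    using Sum_any_additive[of "fock_scale (l j)", OF _ that] that
    by (auto simp: fock_scale_add elim!: rev_finite_subset)
  have "heisenberg j r (U_series l m f) = Sum_any (\<lambda>q. heisenberg j r (?C (m + q) (?A q f)))"
    unfolding U_series_int
    by (rule Sum_any_additive[OF _ U_series_finite_int]) (simp add: fock_linear_add[OF fock_linear_heisenberg])
  also have "\<dots> = Sum_any (\<lambda>q. ?C (m + q) (?A q (heisenberg j r f)) +
      fock_scale (l j) (if r > 0 then ?C (m - r + q) (?A q f) else ?C (m + q) (?A (q + r) f)))"
    using assms by (intro Sum_any.cong)
      (auto simp: heisenberg_creation_exp heisenberg_annihilation_exp fock_linear_add[OF fock_linear_creation_exp]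
        fock_linear_scale[OF fock_linear_creation_exp] fock_linear_zero[OF fock_linear_creation_exp]
        algebra_simps when_def)
  also have "\<dots> = U_series l m (heisenberg j r f) + fock_scale (l j) (U_series l (m - r) f)"
  proof (cases "r > 0")
    case True
    then show ?thesis
      by (simp add: Sum_any.distrib[OF U_series_finite_int scale(2)[OF U_series_finite_int]]
          scale(1)[OF U_series_finite_int] flip: U_series_int)
  next
    case False
    then show ?thesis
      by (simp add: Sum_any.distrib[OF U_series_finite_int scale(2)[OF fin]] scale(1)[OF fin] shift
           flip: U_series_int)
  qed
  finally show ?thesis .
qed

lemma pd_one: "pd j r (1::'n fock) = 0"
proof (rule poly_mapping_eqI)
  fix m :: "'n \<times> nat \<Rightarrow>\<^sub>0 nat"
  have "lookup (m + single (j, r div 2) 1) (j, r div 2) \<noteq> 0"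
    by (simp only: lookup_add lookup_single_eq)
  then have "m + single (j, r div 2) 1 \<noteq> 0" by (metis lookup_zero)
  then show "lookup (pd j r 1) m = lookup 0 m" by (simp add: lookup_pd lookup_one)
qed

text \<open>On the constant polynomial the annihilation exponential acts as the identity.\<close>

lemma U_series_one: "U_series l m 1 = creation_exp l m 1"
proof -
  have ann: "annihilation_series l i 1 = 0" for i
    by (simp add: annihilation_series_def pd_one)
  have P: "op_series_power (annihilation_series l) (Suc k) q 1 = 0" for k q
  proof (induction k arbitrary: q)
    case 0
    show ?case by (auto simp: when_def ann fock_linear_zero[OF fock_linear_annihilation] intro!: sum.neutral)
  next
    case (Suc k)
    show ?case
      unfolding op_series_power.simps(2)[of _ "Suc k"] Suc
      by (simp add: fock_linear_zero[OF fock_linear_annihilation])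
  qed
  have "op_series_power (annihilation_series l) k q 1 = 0" if "q \<noteq> 0" for k q
    using that by (cases k) (auto simp: P simp del: op_series_power.simps(2))
  then have "annihilation_exp l q 1 = (1 when q = 0)" for q
    by (auto simp: annihilation_exp_def op_series_exp_def when_def)
  then have "creation_exp l (m + q) (annihilation_exp l q 1) = (creation_exp l m 1 when q = 0)" for q
    by (auto simp: when_def fock_linear_zero[OF fock_linear_creation_exp])
  then show ?thesis unfolding U_series_int by simp
qed

text \<open>The functional \<open>f \<mapsto> lookup f 0\<close> takes the constant term of a polynomial; its value on \<open>T 1\<close>
  is the vacuum expectation of the operator \<open>T\<close>.\<close>

lemma U_series_vacuum: "lookup (U_series l m 1) 0 = (1 when m = 0)"
proof -
  have "lookup (creation_series l i f) 0 = 0" for i f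
    by (simp add: creation_series_def when_def lookup_sum lookup_xvar_mult)
  then have "lookup (op_series_power (creation_series l) k q 1) 0 = (1 when k = 0 \<and> q = 0)" for k q
    by (cases k) (auto simp: lookup_sum when_def)
  then show ?thesis
    by (auto simp: U_series_one creation_exp_def op_series_exp_def lookup_sum when_def)
qed

section \<open>Families of operators determined by their Heisenberg commutators\<close>

lemma minus_single_add:
  fixes m :: "'b \<Rightarrow>\<^sub>0 nat"
  assumes "lookup m p \<noteq> 0"
  shows "m - single p 1 + single p 1 = m"
  using assms by (intro poly_mapping_eqI) (auto simp: lookup_add lookup_minus lookup_single when_def)

lemma monomial_induct [case_names zero add]:
  fixes m :: "'n \<times> nat \<Rightarrow>\<^sub>0 nat"
  assumes "P 0"
    and step: "\<And>m j k. P m \<Longrightarrow> P (m + single (j, k) 1)"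
  shows "P m"
proof (induction "fock_weight m" arbitrary: m rule: less_induct)
  case less
  show ?case
  proof (cases "m = 0")
    case False
    then obtain p where p: "lookup m p \<noteq> 0" by (metis lookup_zero poly_mapping_eqI)
    have "P (m - single p 1)" using fock_weight_minus[OF p] by (intro less) simp
    then have "P (m - single p 1 + single p 1)" using step[of _ "fst p" "snd p"] by simp
    then show ?thesis by (simp only: minus_single_add[OF p])
  qed (simp add: \<open>P 0\<close>)
qed

text \<open>A form of Schur's lemma for the irreducible Heisenberg module \<open>\<complex>[x]\<close>. Suppose that commuting a
  member of the family with a Heisenberg operator gives a combination of members. Then
  every derivative of \<open>D\<^sub>i 1\<close> is a combination of polynomials \<open>D\<^sub>k 1\<close>, since the derivatives kill
  \<open>1\<close>; so all Taylor coefficients of \<open>D\<^sub>i 1\<close> are combinations of vacuum expectations, and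
  \<open>D\<^sub>i 1 = 0\<close>. As every monomial arises from \<open>1\<close> by multiplications with variables, the commutators
  then propagate \<open>D\<^sub>i = 0\<close> to all polynomials. Two terms on the right-hand side suffice for
  products of two vertex operators.\<close>

lemma heisenberg_family_eq_0:
  fixes D :: "'i \<Rightarrow> 'n::finite fock \<Rightarrow> 'n fock"
  assumes lin: "\<And>i. fock_linear (D i)"
    and comm: "\<And>i j r. odd r \<Longrightarrow> \<exists>c1 i1 c2 i2. \<forall>f. heisenberg j r (D i f) =
                 D i (heisenberg j r f) + fock_scale c1 (D i1 f) + fock_scale c2 (D i2 f)"
    and vac: "\<And>i. lookup (D i 1) 0 = 0"
  shows "D i f = 0"
proof -
  have one: "lookup (D i 1) m = 0" for i m
  proof (induction m arbitrary: i rule: monomial_induct)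
    case zero
    show ?case by (rule vac)
  next
    case (add m j k)
    let ?r = "2 * int k + 1"
    obtain c1 i1 c2 i2 where c: "heisenberg j ?r (D i 1) =
        D i (heisenberg j ?r 1) + fock_scale c1 (D i1 1) + fock_scale c2 (D i2 1)"
      using comm[of ?r j i] by auto
    have [simp]: "nat ?r div 2 = k" by simp
    have "lookup (heisenberg j ?r (D i 1)) m = 0"
      unfolding c using add by (simp add: heisenberg_def pd_one fock_linear_zero[OF lin] lookup_add)
    then show ?case
      by (simp add: heisenberg_def lookup_pd del: of_nat_Suc)
  qed
  then have one: "D i 1 = 0" for i by (intro poly_mapping_eqI) simp
  have mono: "D i (single m c) = 0" for i m c
  proof (induction m arbitrary: i rule: monomial_induct)
    case zero
    have "single 0 c = fock_scale c (1 :: 'n fock)" by (simp add: fock_scale_conv_mult)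
    then show ?case by (simp add: fock_linear_scale[OF lin] one)
  next
    case (add m j k)
    let ?r = "- (2 * int k + 1)"
    obtain c1 i1 c2 i2 where "heisenberg j ?r (D i (single m c)) = D i (heisenberg j ?r (single m c))
        + fock_scale c1 (D i1 (single m c)) + fock_scale c2 (D i2 (single m c))"
      using comm[of ?r j i] by auto
    then have "D i (heisenberg j ?r (single m c)) = 0"
      by (simp add: add fock_linear_zero[OF fock_linear_heisenberg])
    moreover have "nat (1 + 2 * int k) div 2 = k" "1 + 2 * of_nat k \<noteq> (0::complex)"
      using of_nat_neq_0[of "2 * k", where ?'a = complex] by simp_all
    then have "single (m + single (j, k) 1) c =
        fock_scale (1 / of_int (- ?r)) (heisenberg j ?r (single m c))"
      by (simp add: heisenberg_def xvar_def mult_single add.commute)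
    ultimately show ?case by (simp only: fock_linear_scale[OF lin] fock_scale_0)
  qed
  show ?thesis
    by (subst poly_mapping_sum_single[of f]) (simp add: fock_linear_sum[OF lin] mono)
qed

lemma fock_linear_add_fun: "fock_linear S \<Longrightarrow> fock_linear T \<Longrightarrow> fock_linear (\<lambda>f. S f + T f)"
  and fock_linear_diff_fun: "fock_linear S \<Longrightarrow> fock_linear T \<Longrightarrow> fock_linear (\<lambda>f. S f - T f)"
  by (simp_all add: fock_linear_def fock_scale_add fock_scale_diff)

text \<open>The coefficientwise form of \<open>U\<^sub>-\<^sub>\<lambda>(z) = U\<^sub>\<lambda>(-z)\<close>, due to the absence of even powers of
  \<open>z\<close> in the exponents.\<close>

lemma U_uminus: "U_series (\<lambda>j. - l j) m f = fock_scale ((-1) powi m) (U_series l m f)"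
proof -
  define D where "D m f = U_series (\<lambda>j. - l j) m f - fock_scale ((-1) powi m) (U_series l m f)" for m f
  have "D m f = 0"
  proof (rule heisenberg_family_eq_0[of D])
    show "fock_linear (D i)" for i
      unfolding D_def by (intro fock_linear_diff_fun fock_linear_scale_fun fock_linear_U)
    show "lookup (D i 1) 0 = 0" for i
      by (simp add: D_def lookup_minus U_series_vacuum when_def)
    fix i j and r :: int assume r: "odd r"
    have "heisenberg j r (D i f) =
        D i (heisenberg j r f) + fock_scale (- l j) (D (i - r) f) + fock_scale 0 (D i f)" for f
    proof -
      have "(-1) powi (i - r) = - ((-1::complex) powi i)" using r by (simp add: power_int_diff)
      then show ?thesis
      by (auto simp: D_def heisenberg_U[OF r] fock_linear_diff[OF fock_linear_heisenberg]
          fock_linear_scale[OF fock_linear_heisenberg] lookup_add lookup_minus algebra_simps intro!: poly_mapping_eqI)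
    qed
    then show "\<exists>c1 i1 c2 i2. \<forall>f. heisenberg j r (D i f) =
                 D i (heisenberg j r f) + fock_scale c1 (D i1 f) + fock_scale c2 (D i2 f)" by blast
  qed
  then show ?thesis by (simp add: D_def)
qed

section \<open>The energy operator\<close>

text \<open>The bound \<open>N\<close> replaces the formally infinite sum over \<open>r\<close> by a finite one, to which linear
  maps can be applied termwise.\<close>

lemma energy_conv_heisenberg:
  assumes "\<And>j r. int r > N \<Longrightarrow> odd r \<Longrightarrow> heisenberg j (int r) f = 0"
  shows "energy f = (\<Sum>j\<in>UNIV. \<Sum>r\<in>{r. odd r \<and> int r \<le> N}. heisenberg j (- int r) (heisenberg j (int r) f))"
proof -
  have fin: "finite {r. odd r \<and> int r \<le> N}"
    by (rule finite_subset[of _ "{..nat N}"]) auto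
  have "Sum_any (\<lambda>r::nat. fock_scale (of_nat r) (xvar j r * pd j r f) when odd r) =
      (\<Sum>r\<in>{r. odd r \<and> int r \<le> N}. fock_scale (of_nat r) (xvar j r * pd j r f) when odd r)" for j
  proof (rule Sum_any.expand_superset[OF fin], rule subsetI, rule CollectI)
    fix r :: nat assume "r \<in> {r. (fock_scale (of_nat r) (xvar j r * pd j r f) when odd r) \<noteq> 0}"
    then have *: "(fock_scale (of_nat r) (xvar j r * pd j r f) when odd r) \<noteq> 0" by simp
    then have odd: "odd r" by (auto simp: when_def split: if_splits)
    moreover have "int r \<le> N"
    proof (rule ccontr)
      assume "\<not> int r \<le> N"
      then have "heisenberg j (int r) f = 0" using assms odd by simp
      then have "pd j r f = 0" using odd_pos[OF odd] by (simp add: heisenberg_def)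
      then show False using * by simp
    qed
    ultimately show "odd r \<and> int r \<le> N" ..
  qed
  moreover have "(fock_scale (of_nat r) (xvar j r * pd j r f) when odd r) =
      heisenberg j (- int r) (heisenberg j (int r) f)" if "r \<in> {r. odd r \<and> int r \<le> N}" for j r
    using that odd_pos[of r] by (auto simp: heisenberg_def)
  ultimately show ?thesis unfolding energy_def by simp
qed

lemma lookup_xvar_pd: "lookup (xvar j r * pd j r f) m = of_nat (lookup m (j, r div 2)) * lookup f m"
  using minus_single_add[of m "(j, r div 2)"]
  by (auto simp: lookup_xvar_mult lookup_pd lookup_minus of_nat_diff)

text \<open>The energy operator is diagonal on monomials: it is the Euler operator for the grading in which
  \<open>x\<^sub>r\<close> has degree \<open>r\<close>.\<close>

lemma lookup_energy:
  fixes f :: "'n::finite fock"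
  shows "lookup (energy f) m = of_nat (fock_weight m) * lookup f m"
proof -
  \<comment> \<open>Only variables that occur in \<open>f\<close> or in \<open>m\<close> matter.\<close>
  define K where "K = insert 0 (snd ` (keys m \<union> (\<Union>n\<in>keys f. keys n)))"
  define N where "N = Max K"
  have "finite K" unfolding K_def by simp
  then have N: "k \<le> N" if "k \<in> K" for k using that unfolding N_def by simp
  have pd0: "pd j r f = 0" if "r div 2 > N" for j r
  proof (rule poly_mapping_eqI)
    fix n
    have "lookup n (j, r div 2) = 0" if "n \<in> keys f" for n
    proof (rule ccontr)
      assume "lookup n (j, r div 2) \<noteq> 0"
      then have "r div 2 \<in> K" unfolding K_def using that
        by (auto intro!: image_eqI[of _ _ "(j, r div 2)"] simp: in_keys_iff)
      then show False using N[of "r div 2"] \<open>r div 2 > N\<close> by simp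
    qed
    then have "n + single (j, r div 2) 1 \<notin> keys f" by (metis add_is_0 lookup_add lookup_single_eq one_neq_zero)
    then show "lookup (pd j r f) n = lookup 0 n" by (simp add: lookup_pd in_keys_iff)
  qed
  have "Sum_any (\<lambda>r::nat. fock_scale (of_nat r) (xvar j r * pd j r f) when odd r) =
      (\<Sum>k\<le>N. fock_scale (of_nat (2 * k + 1)) (xvar j (2 * k + 1) * pd j (2 * k + 1) f))" for j
  proof -
    have "Sum_any (\<lambda>r::nat. fock_scale (of_nat r) (xvar j r * pd j r f) when odd r) =
       (\<Sum>r\<in>(\<lambda>k. 2 * k + 1) ` {..N}. fock_scale (of_nat r) (xvar j r * pd j r f) when odd r)"
    proof (rule Sum_any.expand_superset, simp, safe)
      fix r :: nat assume *: "(fock_scale (of_nat r) (xvar j r * pd j r f) when odd r) \<noteq> 0"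
      then have "odd r" "pd j r f \<noteq> 0" by (auto simp: when_def split: if_splits)
      then show "r \<in> (\<lambda>k. 2 * k + 1) ` {..N}" using pd0[of r j]
        by (intro image_eqI[of _ _ "r div 2"]) (auto simp: not_less[symmetric])
    qed
    also have "\<dots> = (\<Sum>k\<le>N. fock_scale (of_nat (2 * k + 1)) (xvar j (2 * k + 1) * pd j (2 * k + 1) f))"
      by (subst sum.reindex) (auto simp: inj_on_def)
    finally show ?thesis .
  qed
  then have "lookup (energy f) m =
      (\<Sum>j\<in>UNIV. \<Sum>k\<le>N. of_nat (2 * k + 1) * (of_nat (lookup m (j, k)) * lookup f m))"
    by (simp add: energy_def lookup_sum lookup_xvar_pd)
  also have "\<dots> = (\<Sum>(j, k)\<in>UNIV \<times> {..N}. of_nat ((2 * k + 1) * lookup m (j, k)) * lookup f m)"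
    by (simp add: sum.cartesian_product mult.assoc distrib_right)
  also have "\<dots> = of_nat (\<Sum>(j, k)\<in>UNIV \<times> {..N}. (2 * k + 1) * lookup m (j, k)) * lookup f m"
    by (simp only: of_nat_sum sum_distrib_right case_prod_unfold)
  also have "(\<Sum>(j, k)\<in>UNIV \<times> {..N}. (2 * k + 1) * lookup m (j, k)) = fock_weight m"
    unfolding fock_weight_def
  proof (rule sum.mono_neutral_cong_right)
    have "snd p \<in> K" if "p \<in> keys m" for p using that by (simp add: K_def)
    then show "keys m \<subseteq> UNIV \<times> {..N}" using N by fastforce
  qed (auto simp: in_keys_iff)
  finally show ?thesis .
qed

lemma fock_linear_energy: "fock_linear energy"
  unfolding fock_linear_def by (auto intro!: poly_mapping_eqI simp: lookup_energy lookup_add algebra_simps)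

lemma fock_weight_0 [simp]: "fock_weight 0 = 0"
  by (simp add: fock_weight_def)

lemma energy_one: "energy 1 = 0"
  by (rule poly_mapping_eqI) (auto simp: lookup_energy lookup_one when_def)

lemma energy_heisenberg:
  assumes "odd r"
  shows "energy (heisenberg j r f) = heisenberg j r (energy f) - fock_scale (of_int r) (heisenberg j r f)"
proof (rule poly_mapping_eqI)
  fix m
  let ?e = "single (j, nat \<bar>r\<bar> div 2) (1::nat)"
  have r2: "2 * (nat \<bar>r\<bar> div 2) + 1 = nat \<bar>r\<bar>" using assms by (simp add: even_nat_iff)
  show "lookup (energy (heisenberg j r f)) m =
    lookup (heisenberg j r (energy f) - fock_scale (of_int r) (heisenberg j r f)) m"
  proof (cases "r > 0")
    case True
    have "fock_weight (m + ?e) = fock_weight m + nat r"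
      using fock_weight_minus[of "m + ?e" "(j, nat \<bar>r\<bar> div 2)"] r2 True by (simp add: lookup_add)
    then show ?thesis using True
      by (simp add: heisenberg_def lookup_energy lookup_pd lookup_minus algebra_simps)
  next
    case False
    have "fock_weight m = fock_weight (m - ?e) + nat (- r)" if "lookup m (j, nat (- r) div 2) \<noteq> 0"
      using fock_weight_minus[of m "(j, nat \<bar>r\<bar> div 2)"] that r2 False by simp
    then show ?thesis using False
      by (auto simp: heisenberg_def lookup_energy lookup_xvar_mult lookup_minus ring_distribs)
  qed
qed

text \<open>The coefficient of \<open>z\<^sup>m\<close> in \<open>U\<^sub>\<lambda>(z)\<close> raises the degree by \<open>m\<close>.\<close>

lemma energy_U: "energy (U_series l m f) = U_series l m (energy f) + fock_scale (of_int m) (U_series l m f)"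
proof -
  define D where "D m f = energy (U_series l m f) - U_series l m (energy f) -
    fock_scale (of_int m) (U_series l m f)" for m f
  have "D m f = 0"
  proof (rule heisenberg_family_eq_0[of D])
    show "fock_linear (D i)" for i
      unfolding D_def by (intro fock_linear_diff_fun fock_linear_scale_fun fock_linear_U
          fock_linear_compose[OF fock_linear_U fock_linear_energy] fock_linear_compose[OF fock_linear_energy fock_linear_U])
    show "lookup (D i 1) 0 = 0" for i
      by (simp add: D_def lookup_minus lookup_energy energy_one fock_linear_zero[OF fock_linear_U] U_series_vacuum when_def)
    fix i j and r :: int assume r: "odd r"
    have "heisenberg j r (D i f) =
        D i (heisenberg j r f) + fock_scale (l j) (D (i - r) f) + fock_scale 0 (D i f)" for f
    proof -
      have e: "heisenberg j r (energy g) = energy (heisenberg j r g) + fock_scale (of_int r) (heisenberg j r g)" for g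
        using energy_heisenberg[OF r, of j g] by simp
      show ?thesis
        by (rule poly_mapping_eqI)
         (simp add: D_def heisenberg_U[OF r] e fock_linear_add[OF fock_linear_heisenberg] fock_linear_diff[OF fock_linear_heisenberg]
           fock_linear_scale[OF fock_linear_heisenberg] fock_linear_add[OF fock_linear_U]
           fock_linear_scale[OF fock_linear_U] fock_linear_add[OF fock_linear_energy]
           fock_linear_scale[OF fock_linear_energy] lookup_add lookup_minus algebra_simps)
    qed
    then show "\<exists>c1 i1 c2 i2. \<forall>f. heisenberg j r (D i f) =
                 D i (heisenberg j r f) + fock_scale c1 (D i1 f) + fock_scale c2 (D i2 f)" by blast
  qed
  then show ?thesis by (simp add: D_def algebra_simps)
qed

section \<open>Products of two vertex operators\<close>

lemma U_series_negative: "m < 0 \<Longrightarrow> U_series l m 1 = 0"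
  by (simp add: U_series_one creation_exp_def)

lemma U_series_constant: "U_series l 0 1 = 1"
  by (simp add: U_series_one creation_exp_def op_series_exp_def)

text \<open>The vacuum expectation of the product of the coefficient of \<open>z\<^sup>p\<close> in \<open>U\<^sub>l(z)\<close> and that of
  \<open>w\<^sup>q\<close> in \<open>U\<^sub>l\<^sub>'(w)\<close>.\<close>

definition two_point :: "('n::finite \<Rightarrow> complex) \<Rightarrow> ('n \<Rightarrow> complex) \<Rightarrow> int \<Rightarrow> int \<Rightarrow> complex" where
  "two_point l l' p q = lookup (U_series l p (U_series l' q 1)) 0"

text \<open>The product \<open>U\<^sub>l(z) U\<^sub>l\<^sub>'(w)\<close> changes the degree by \<open>p + q\<close>, so only \<open>p + q = 0\<close> contributes to the
  constant term; and \<open>U\<^sub>l\<^sub>'(w) 1\<close> has no negative powers of \<open>w\<close>.\<close>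

lemma two_point_eq_0:
  assumes "p + q \<noteq> 0 \<or> q < 0"
  shows "two_point l l' p q = 0"
proof -
  have "energy (U_series l p (U_series l' q 1)) = fock_scale (of_int (p + q)) (U_series l p (U_series l' q 1))"
    by (simp add: energy_U energy_one fock_linear_zero[OF fock_linear_U] fock_linear_scale[OF fock_linear_U]
        fock_scale_add_left add.commute)
  then have "of_int (p + q) * two_point l l' p q = 0"
    unfolding two_point_def by (metis lookup_fock_scale lookup_energy fock_weight_0 mult_zero_left of_nat_0)
  then have "two_point l l' p q = 0" if "p + q \<noteq> 0" using that by (metis mult_eq_0_iff of_int_eq_0_iff)
  then show ?thesis using assms
    by (auto simp: two_point_def U_series_negative fock_linear_zero[OF fock_linear_U])
qed

lemma lookup_heisenberg_negative: "r < 0 \<Longrightarrow> lookup (heisenberg j r f) 0 = 0"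
  by (simp add: heisenberg_def lookup_xvar_mult)

text \<open>The polynomial \<open>v\<close>, the coefficient of \<open>w\<^sup>n\<close> in \<open>U\<^sub>l\<^sub>'(w) 1\<close>, has energy \<open>n\<close>. Writing the energy
  operator as \<open>\<Sum> a\<^sub>-\<^sub>r a\<^sub>r\<close>, the factor \<open>a\<^sub>r\<close> lowers \<open>n\<close> by \<open>r\<close> in \<open>v\<close>, and \<open>a\<^sub>-\<^sub>r\<close> is moved to the left
  through \<open>U\<^sub>l(z)\<close>, where it contributes nothing to the constant term. This gives a recursion for
  the two-point function, in place of the normal ordering of exponentials.\<close>

lemma two_point_recursion:
  "of_nat n * two_point l l' (- int n) (int n) =
     - (\<Sum>j\<in>UNIV. l j * l' j) *
       (\<Sum>r\<le>n. two_point l l' (- int (n - r)) (int (n - r)) when odd r)"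
proof -
  let ?v = "U_series l' (int n) 1"
  have h: "heisenberg j (int r) ?v = fock_scale (l' j) (U_series l' (int n - int r) 1)" if "odd r" for j r
    using that odd_pos[OF that]
    by (simp add: heisenberg_U) (simp add: heisenberg_def pd_one fock_linear_zero[OF fock_linear_U])
  have v: "energy ?v = (\<Sum>j\<in>UNIV. \<Sum>r\<in>{r. odd r \<and> int r \<le> int n}.
      fock_scale (l' j) (heisenberg j (- int r) (U_series l' (int n - int r) 1)))"
    by (subst energy_conv_heisenberg[of "int n"])
      (simp_all add: h U_series_negative fock_linear_scale[OF fock_linear_heisenberg])
  have one: "lookup (U_series l (- int n) (heisenberg j (- int r) (U_series l' (int n - int r) 1))) 0 =
      - l j * two_point l l' (- int (n - r)) (int (n - r))" if "odd r" "r \<le> n" for j r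
  proof -
    have "heisenberg j (- int r) (U_series l (- int n) f) =
        U_series l (- int n) (heisenberg j (- int r) f) + fock_scale (l j) (U_series l (- int (n - r)) f)" for f
      using that heisenberg_U[of "- int r" j l "- int n" f] by (simp add: of_nat_diff algebra_simps)
    then have "lookup (U_series l (- int n) (heisenberg j (- int r) f)) 0 =
        lookup (heisenberg j (- int r) (U_series l (- int n) f)) 0 - l j * lookup (U_series l (- int (n - r)) f) 0" for f
      by (simp add: lookup_add)
    then show ?thesis
      using that odd_pos[of r] by (simp add: two_point_def of_nat_diff lookup_heisenberg_negative)
  qed
  have "of_nat n * two_point l l' (- int n) (int n) = lookup (U_series l (- int n) (energy ?v)) 0"
    by (simp add: energy_U energy_one two_point_def fock_linear_zero[OF fock_linear_U] fock_linear_scale[OF fock_linear_U])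
  also have "\<dots> = (\<Sum>j\<in>UNIV. \<Sum>r\<in>{r. odd r \<and> r \<le> n}.
      l' j * (- l j * two_point l l' (- int (n - r)) (int (n - r))))"
    unfolding v by (simp add: fock_linear_sum[OF fock_linear_U] fock_linear_scale[OF fock_linear_U] lookup_sum one)
  also have "\<dots> = - (\<Sum>j\<in>UNIV. l j * l' j) * (\<Sum>r\<in>{r. odd r \<and> r \<le> n}. two_point l l' (- int (n - r)) (int (n - r)))"
    by (simp add: sum_product sum_negf mult_ac)
  also have "(\<Sum>r\<in>{r. odd r \<and> r \<le> n}. two_point l l' (- int (n - r)) (int (n - r))) =
      (\<Sum>r\<le>n. two_point l l' (- int (n - r)) (int (n - r)) when odd r)"
    by (rule sum.mono_neutral_cong_left) auto
  finally show ?thesis .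
qed

text \<open>The hypothesis on \<open>g\<close> is the differential equation
  \<open>t g'(t) = - 2 c t / (1 - t\<^sup>2) \<sqdot> g(t)\<close> of \<open>((1 - t) / (1 + t))\<^sup>c\<close>.\<close>

lemma two_point_eqI:
  assumes l: "(\<Sum>j\<in>UNIV. l j * l' j) = 2 * c" and g0: "g 0 = 1"
    and g: "\<And>n. n > 0 \<Longrightarrow> of_nat n * g n = - 2 * c * (\<Sum>r\<le>n. g (n - r) when odd r)"
  shows "two_point l l' p q = (g (nat q) when p + q = 0 \<and> q \<ge> 0)"
proof -
  have "two_point l l' (- int n) (int n) = g n" for n
  proof (induction n rule: less_induct)
    case (less n)
    show ?case
    proof (cases "n = 0")
      case True
      then show ?thesis
        using U_series_vacuum[of l 0] by (simp add: two_point_def U_series_constant g0)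
    next
      case False
      have "(\<Sum>r\<le>n. two_point l l' (- int (n - r)) (int (n - r)) when odd r) = (\<Sum>r\<le>n. g (n - r) when odd r)"
      proof (rule sum.cong[OF refl])
        fix r show "(two_point l l' (- int (n - r)) (int (n - r)) when odd r) = (g (n - r) when odd r)"
          using less[of "n - r"] False odd_pos[of r] by (auto simp: when_def)
      qed
      then have "of_nat n * two_point l l' (- int n) (int n) = of_nat n * g n"
        using two_point_recursion[of n l l'] g[of n] False by (simp add: l)
      then show ?thesis using False by simp
    qed
  qed
  from this[of "nat q"] show ?thesis
    by (cases "p + q = 0 \<and> q \<ge> 0") (auto simp: two_point_eq_0 add_eq_0_iff2)
qed

text \<open>The sums \<open>\<Sum> g(n - r)\<close> over odd \<open>r\<close> for \<open>n\<close> and \<open>n + 2\<close> differ by the single term \<open>g(n + 1)\<close>.\<close>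

lemma odd_convolution_eqI:
  fixes g S :: "nat \<Rightarrow> complex"
  assumes "S 0 = 0" "S 1 = g 0" and step: "\<And>n. S (Suc (Suc n)) = g (Suc n) + S n"
  shows "(\<Sum>r\<le>n. g (n - r) when odd r) = S n"
proof (induction n rule: induct_nat_012)
  case (ge2 n)
  have "(\<Sum>r\<le>Suc (Suc n). g (Suc (Suc n) - r) when odd r) = g (Suc n) + (\<Sum>r\<le>n. g (n - r) when odd r)"
    unfolding sum.atMost_Suc_shift by (simp add: sum.atMost_Suc_shift)
  then show ?case by (simp only: ge2 step)
qed (use assms in simp_all)

lemma two_point_0:
  assumes "(\<Sum>j\<in>UNIV. l j * l' j) = 0"
  shows "two_point l l' p q = (1 when p = 0 \<and> q = 0)"
proof -
  have "two_point l l' p q = ((if nat q = 0 then 1 else 0) when p + q = 0 \<and> q \<ge> 0)"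
    by (rule two_point_eqI[where c = 0]) (simp_all add: assms)
  then show ?thesis by (auto simp: when_def)
qed

text \<open>The expansion of \<open>(1 + t) / (1 - t)\<close>.\<close>

lemma two_point_minus_1:
  assumes "(\<Sum>j\<in>UNIV. l j * l' j) = - 2"
  shows "two_point l l' p q = ((if q = 0 then 1 else 2) when p + q = 0 \<and> q \<ge> 0)"
proof -
  let ?g = "\<lambda>n. if n = 0 then 1 else 2 :: complex"
  \<comment> \<open>The recursion for \<open>c = -1\<close> reads \<open>n g(n) = 2 n\<close>.\<close>
  have "(\<Sum>r\<le>n. ?g (n - r) when odd r) = of_nat n" for n
    by (rule odd_convolution_eqI) simp_all
  then have "two_point l l' p q = (?g (nat q) when p + q = 0 \<and> q \<ge> 0)"
    by (intro two_point_eqI[where c = "- 1"]) (simp_all add: assms)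
  then show ?thesis by (auto simp: when_def)
qed

text \<open>The expansion of \<open>((1 + t) / (1 - t))\<^sup>2\<close>.\<close>

lemma two_point_minus_2:
  assumes "(\<Sum>j\<in>UNIV. l j * l' j) = - 4"
  shows "two_point l l' p q = ((if q = 0 then 1 else 4 * of_int q) when p + q = 0 \<and> q \<ge> 0)"
proof -
  let ?g = "\<lambda>n. if n = 0 then 1 else 4 * of_nat n :: complex"
  \<comment> \<open>The recursion for \<open>c = -2\<close> reads \<open>n g(n) = 4 n\<^sup>2\<close>.\<close>
  have "(\<Sum>r\<le>n. ?g (n - r) when odd r) = of_nat (n ^ 2)" for n
    by (rule odd_convolution_eqI) (simp_all add: power2_eq_square algebra_simps)
  then have "two_point l l' p q = (?g (nat q) when p + q = 0 \<and> q \<ge> 0)"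
    by (intro two_point_eqI[where c = "- 2"]) (simp_all add: assms power2_eq_square)
  then show ?thesis by (auto simp: when_def)
qed

lemma heisenberg_U_U:
  assumes "odd r"
  shows "heisenberg j r (U_series l p (U_series l' q f)) = U_series l p (U_series l' q (heisenberg j r f)) +
    fock_scale (l j) (U_series l (p - r) (U_series l' q f)) +
    fock_scale (l' j) (U_series l p (U_series l' (q - r) f))"
  by (simp add: heisenberg_U[OF assms] fock_linear_add[OF fock_linear_U] fock_linear_scale[OF fock_linear_U])

lemma fock_linear_U_U: "fock_linear (\<lambda>f. U_series l p (U_series l' q f))"
  by (rule fock_linear_compose[OF fock_linear_U fock_linear_U])

text \<open>For \<open>l \<cdot> l' = 0\<close> both products have the same, trivial two-point function.\<close>

lemma U_commute:
  assumes "(\<Sum>j\<in>UNIV. l j * l' j) = 0"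
  shows "U_series l p (U_series l' q f) = U_series l' q (U_series l p f)"
proof -
  define D where "D = (\<lambda>(p, q) f. U_series l p (U_series l' q f) - U_series l' q (U_series l p f))"
  have "D (p, q) f = 0"
  proof (rule heisenberg_family_eq_0[of D])
    show "fock_linear (D i)" for i
      unfolding D_def case_prod_unfold by (intro fock_linear_diff_fun fock_linear_U_U)
    show "lookup (D i 1) 0 = 0" for i
      using two_point_0[OF assms] two_point_0[of l' l] assms
      by (auto simp: D_def case_prod_unfold lookup_minus two_point_def mult.commute when_def)
    fix i :: "int \<times> int" and j and r :: int assume r: "odd r"
    obtain p q where [simp]: "i = (p, q)" by (cases i)
    have "heisenberg j r (D i f) = D i (heisenberg j r f) + fock_scale (l j) (D (p - r, q) f)
        + fock_scale (l' j) (D (p, q - r) f)" for f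
      by (simp add: D_def heisenberg_U_U[OF r] fock_linear_diff[OF fock_linear_heisenberg] fock_scale_diff algebra_simps)
    then show "\<exists>c1 i1 c2 i2. \<forall>f. heisenberg j r (D i f) =
                 D i (heisenberg j r f) + fock_scale c1 (D i1 f) + fock_scale c2 (D i2 f)" by blast
  qed
  then show ?thesis by (simp add: D_def)
qed

text \<open>For \<open>l \<cdot> l' = -2\<close> the two-point functions of the two products are the expansions of
  \<open>(1 + t) / (1 - t)\<close> and of its negative in opposite domains; the sum of the two-point functions is
  \<open>2 \<delta>(t)\<close>, which is also the vacuum expectation of the right-hand side.\<close>

lemma U_anticommutator:
  assumes "(\<Sum>j\<in>UNIV. l j * l' j) = - 2"
  shows "U_series l p (U_series l' q f) + U_series l' q (U_series l p f) =
    fock_scale 2 (U_series (\<lambda>j. l j + l' j) (p + q) f)"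
proof -
  define D where "D = (\<lambda>(p, q) f. U_series l p (U_series l' q f) + U_series l' q (U_series l p f) -
    fock_scale 2 (U_series (\<lambda>j. l j + l' j) (p + q) f))"
  have "D (p, q) f = 0"
  proof (rule heisenberg_family_eq_0[of D])
    show "fock_linear (D i)" for i
      unfolding D_def case_prod_unfold
      by (intro fock_linear_diff_fun fock_linear_add_fun fock_linear_U_U fock_linear_scale_fun fock_linear_U)
    show "lookup (D i 1) 0 = 0" for i
      using two_point_minus_1[OF assms] two_point_minus_1[of l' l] assms
      by (auto simp: D_def case_prod_unfold lookup_minus lookup_add two_point_def U_series_vacuum mult.commute when_def)
    fix i :: "int \<times> int" and j and r :: int assume r: "odd r"
    obtain p q where [simp]: "i = (p, q)" by (cases i)
    have "heisenberg j r (D i f) = D i (heisenberg j r f) + fock_scale (l j) (D (p - r, q) f)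
        + fock_scale (l' j) (D (p, q - r) f)" for f
      by (rule poly_mapping_eqI)
       (simp add: D_def heisenberg_U_U[OF r] heisenberg_U[OF r] fock_linear_add[OF fock_linear_heisenberg]
          fock_linear_diff[OF fock_linear_heisenberg] fock_linear_scale[OF fock_linear_heisenberg]
          fock_linear_add[OF fock_linear_U] fock_linear_scale[OF fock_linear_U] lookup_add lookup_minus algebra_simps)
    then show "\<exists>c1 i1 c2 i2. \<forall>f. heisenberg j r (D i f) =
                 D i (heisenberg j r f) + fock_scale c1 (D i1 f) + fock_scale c2 (D i2 f)" by blast
  qed
  then show ?thesis by (simp add: D_def)
qed

lemma fock_linear_heisenberg_series: "fock_linear (heisenberg_series j m)"
  unfolding heisenberg_series_def Let_def by (intro fock_linear_when fock_linear_heisenberg)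

lemma heisenberg_heisenberg_series:
  assumes "odd r"
  shows "heisenberg j r (heisenberg_series i m f) = heisenberg_series i m (heisenberg j r f) +
    (fock_scale (of_int r) f when i = j \<and> r = m + 1)"
proof (cases "even m")
  case True
  then show ?thesis using heisenberg_commutator[OF assms, of "- m - 1" j i f]
    by (auto simp: heisenberg_series_def when_def)
next
  case False
  then have "r \<noteq> m + 1" using assms by auto
  then show ?thesis using False by (simp add: heisenberg_series_def fock_linear_zero[OF fock_linear_heisenberg])
qed

text \<open>For \<open>l' = -l\<close> and \<open>l \<cdot> l = 4\<close> both two-point functions are expansions of the same function
  \<open>((1 + t) / (1 - t))\<^sup>2 = 1 + 4 t / (1 - t)\<^sup>2\<close>, whose double pole makes their difference a
  multiple of the derivative of the delta function. Its contribution is the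
  scalar term; the Heisenberg operators on the right have vacuum expectation \<open>0\<close> and are forced by
  the commutators of the left-hand side with \<open>a\<^sub>r\<close>.\<close>

lemma U_opposite_commutator:
  fixes l :: "'n::finite \<Rightarrow> complex"
  assumes "(\<Sum>j\<in>UNIV. l j * l j) = 4"
  shows "U_series l p (U_series (\<lambda>j. - l j) q f) - U_series (\<lambda>j. - l j) q (U_series l p f) =
    fock_scale 4 ((\<Sum>j\<in>UNIV. fock_scale (l j) (heisenberg_series j (p + q - 1) f)) -
      (fock_scale (of_int p) f when p + q = 0))"
proof -
  define H where "H m f = (\<Sum>j\<in>UNIV. fock_scale (l j) (heisenberg_series j m f))" for m f
  define D where "D = (\<lambda>(p, q) f. U_series l p (U_series (\<lambda>j. - l j) q f) - U_series (\<lambda>j. - l j) q (U_series l p f) -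
    fock_scale 4 (H (p + q - 1) f - (fock_scale (of_int p) f when p + q = 0)))"
  have H: "fock_linear (H m)" for m
    unfolding H_def by (intro fock_linear_sum_fun fock_linear_scale_fun fock_linear_heisenberg_series)
  have hH: "heisenberg j r (H m f) = H m (heisenberg j r f) + (fock_scale (l j * of_int r) f when r = m + 1)"
    if "odd r" for j r m f
  proof -
    have "fock_scale (l i) (fock_scale (of_int r) f when i = j \<and> r = m + 1) =
        (fock_scale (l j * of_int r) f when r = m + 1 when i = j)" for i
      by (auto simp: when_def)
    then show ?thesis
      by (simp add: H_def fock_linear_sum[OF fock_linear_heisenberg] fock_linear_scale[OF fock_linear_heisenberg]
          heisenberg_heisenberg_series[OF that] fock_scale_add sum.distrib) (simp add: when_def sum.delta)
  qed
  have "lookup (heisenberg_series j m 1) 0 = 0" for j :: 'n and m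
    using lookup_xvar_mult[of j _ 1 0]
    by (auto simp: heisenberg_series_def heisenberg_def Let_def when_def pd_one)
  then have H1: "lookup (H m 1) 0 = 0" for m
    by (simp add: H_def lookup_sum)
  have "D (p, q) f = 0"
  proof (rule heisenberg_family_eq_0[of D])
    have "fock_linear (\<lambda>f. f)" by (simp add: fock_linear_def)
    then show "fock_linear (D i)" for i
      unfolding D_def case_prod_unfold
      by (intro fock_linear_diff_fun fock_linear_U_U fock_linear_scale_fun H fock_linear_when)
    show "lookup (D i 1) 0 = 0" for i
      using two_point_minus_2[of l "\<lambda>j. - l j"] two_point_minus_2[of "\<lambda>j. - l j" l] assms
      by (auto simp: D_def case_prod_unfold lookup_minus two_point_def H1 sum_negf when_def add_eq_0_iff2)
    fix i :: "int \<times> int" and j and r :: int assume r: "odd r"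
    obtain p q where [simp]: "i = (p, q)" by (cases i)
    have "heisenberg j r (D i f) = D i (heisenberg j r f) + fock_scale (l j) (D (p - r, q) f)
        + fock_scale (- l j) (D (p, q - r) f)" for f
      using r by (intro poly_mapping_eqI)
       (auto simp add: D_def heisenberg_U_U[OF r] hH[OF r] fock_linear_add[OF fock_linear_heisenberg]
          fock_linear_diff[OF fock_linear_heisenberg] fock_linear_scale[OF fock_linear_heisenberg]
          fock_linear_zero[OF fock_linear_heisenberg] when_def
          lookup_add lookup_minus algebra_simps)
    then show "\<exists>c1 i1 c2 i2. \<forall>f. heisenberg j r (D i f) =
                 D i (heisenberg j r f) + fock_scale c1 (D i1 f) + fock_scale c2 (D i2 f)" by blast
  qed
  then show ?thesis by (simp add: D_def H_def)
qed

section \<open>Root space decomposition\<close>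

lemma lie_zero [simp]: "lie 0 (x::'a::complex_lie_algebra) = 0" "lie (x::'a) 0 = 0"
  using lie_add_left[of 0 0 x] lie_add_right[of x 0 0] by simp_all

lemma lie_minus [simp]:
  "lie (- x) (y::'a::complex_lie_algebra) = - lie x y" "lie x (- y) = - lie x y"
  using lie_cscale_left[of "-1" x y] lie_cscale_right[of x "-1" y] by simp_all

lemma lie_commute: "lie (x::'a::complex_lie_algebra) y = - lie y x"
proof -
  have "lie (x + y) (x + y) = lie x y + lie y x"
    unfolding lie_add_left lie_add_right by (simp add: lie_self)
  then show ?thesis by (simp add: lie_self eq_neg_iff_add_eq_0)
qed

lemma lie_sum_left: "lie (sum f A) (y::'a::complex_lie_algebra) = (\<Sum>i\<in>A. lie (f i) y)"
  by (induction A rule: infinite_finite_induct) (simp_all add: lie_add_left)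

lemma cscale_left_commute: "c *\<^sub>C d *\<^sub>C x = d *\<^sub>C c *\<^sub>C (x::'a::complex_lie_algebra)"
  by (simp add: mult.commute)

text \<open>Applying \<open>T - d\<close> for an eigenvalue \<open>d\<close> removes one component and rescales the others by
  nonzero factors, so induction on the number of eigenvalues applies. With an eigenspace of one
  operator as \<open>W\<close> and a commuting operator \<open>T\<close>, this is the step that diagonalizes commuting operators
  simultaneously.\<close>

lemma eigenvector_components_in_subspace:
  fixes T :: "'a::complex_lie_algebra \<Rightarrow> 'a"
  assumes W: "cvs.subspace W" "\<And>x. x \<in> W \<Longrightarrow> T x \<in> W"
    and T: "\<And>x y. T (x + y) = T x + T y" "\<And>c x. T (c *\<^sub>C x) = c *\<^sub>C T x"
    and eig: "\<And>c. T (Y c) = c *\<^sub>C Y c"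
    and "finite C" "(\<Sum>c\<in>C. Y c) \<in> W" "c \<in> C"
  shows "Y c \<in> W"
  using assms(6-8) eig
proof (induction C arbitrary: Y c rule: finite_induct)
  case (insert d C)
  have T0: "T 0 = 0" using T(1)[of 0 0] by simp
  have Tsum: "T (sum f A) = (\<Sum>i\<in>A. T (f i))" for f :: "complex \<Rightarrow> 'a" and A
    by (induction A rule: infinite_finite_induct) (simp_all add: T T0)
  let ?y = "\<Sum>c\<in>insert d C. Y c"
  have "T ?y - d *\<^sub>C ?y \<in> W"
    using W insert.prems(1) by (intro cvs.subspace_diff cvs.subspace_scale) auto
  also have "T ?y - d *\<^sub>C ?y = (\<Sum>c\<in>C. (c - d) *\<^sub>C Y c)"
    using insert.hyps insert.prems(3)
    by (simp add: T Tsum cscale_add_right cvs.scale_sum_right cvs.scale_left_diff_distrib sum_subtractf)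
  finally have sum: "(\<Sum>c\<in>C. (c - d) *\<^sub>C Y c) \<in> W" .
  have C: "Y c \<in> W" if "c \<in> C" for c
  proof -
    have Tm: "T ((c - d) *\<^sub>C Y c) = c *\<^sub>C (c - d) *\<^sub>C Y c" for c
      using insert.prems(3) by (simp add: T mult.commute)
    have "(c - d) *\<^sub>C Y c \<in> W"
      using insert.IH[OF sum that] Tm by simp
    then have "(1 / (c - d)) *\<^sub>C (c - d) *\<^sub>C Y c \<in> W" by (rule cvs.subspace_scale[OF W(1)])
    moreover have "c \<noteq> d" using that insert.hyps by auto
    ultimately show ?thesis by simp
  qed
  have "Y d = ?y - (\<Sum>c\<in>C. Y c)" using insert.hyps by simp
  also have "\<dots> \<in> W"
    by (rule cvs.subspace_diff[OF W(1) insert.prems(1) cvs.subspace_sum[OF W(1) C]])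
  finally show ?case using C insert.prems(2) by auto
qed simp

lemma eigenvector_decomposition:
  fixes T :: "'a::complex_lie_algebra \<Rightarrow> 'a"
  assumes T: "\<And>x y. T (x + y) = T x + T y" "\<And>c x. T (c *\<^sub>C x) = c *\<^sub>C T x"
    and span: "y \<in> cvs.span {x. \<exists>c. T x = c *\<^sub>C x}"
  obtains C Y where "finite C" "\<And>c. T (Y c) = c *\<^sub>C Y c" "y = (\<Sum>c\<in>C. Y c)"
proof -
  obtain t r where t: "finite t" "t \<subseteq> {x. \<exists>c. T x = c *\<^sub>C x}" "y = (\<Sum>a\<in>t. r a *\<^sub>C a)"
    using span unfolding cvs.span_explicit by blast
  define e where "e a = (SOME c. T a = c *\<^sub>C a)" for a
  have e: "T a = e a *\<^sub>C a" if "a \<in> t" for a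
  proof -
    have "\<exists>c. T a = c *\<^sub>C a" using t(2) that by auto
    then show ?thesis unfolding e_def by (rule someI_ex)
  qed
  have T0: "T 0 = 0" using T(1)[of 0 0] by simp
  have Tsum: "T (sum f A) = (\<Sum>i\<in>A. T (f i))" for f :: "'a \<Rightarrow> 'a" and A
    by (induction A rule: infinite_finite_induct) (simp_all add: T T0)
  show thesis
  proof
    show "finite (e ` t)" using t(1) by simp
    show "y = (\<Sum>c\<in>e ` t. \<Sum>a\<in>{a \<in> t. e a = c}. r a *\<^sub>C a)"
      unfolding t(3) by (rule sum.image_gen[OF t(1)])
    show "T (\<Sum>a\<in>{a \<in> t. e a = c}. r a *\<^sub>C a) = c *\<^sub>C (\<Sum>a\<in>{a \<in> t. e a = c}. r a *\<^sub>C a)" for c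
      unfolding Tsum cvs.scale_sum_right by (rule sum.cong) (auto simp: T e cscale_left_commute)
  qed
qed

text \<open>The hypotheses of the main result. Symmetry of the Cartan matrix enters through the common
  norm \<open>2\<close> of all roots.\<close>

locale simply_laced =
  fixes \<hh> :: "'a::complex_lie_algebra set"
    and B :: "'a \<Rightarrow> 'a \<Rightarrow> complex"
    and \<nu> :: "'a \<Rightarrow> 'a \<Rightarrow> complex"
    and X \<sigma> :: "'a \<Rightarrow> 'a"
    and S :: "'n::finite \<Rightarrow> 'a"
  assumes simple: "simple_fd_lie_algebra TYPE('a)"
    and cartan: "cartan_subalgebra \<hh>"
    and form: "normalized_invariant_form \<hh> B"
    and asymmetry: "asymmetry_function (root_lattice \<hh> B) B \<nu>"
    and root_vectors: "root_vectors \<hh> B \<nu> X"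
    and \<sigma>: "lie_automorphism \<sigma>"
    and \<sigma>_cartan: "\<forall>H\<in>\<hh>. \<sigma> H = - H"
    and \<sigma>_root_vector: "\<forall>\<alpha>\<in>roots \<hh> B. \<sigma> (X \<alpha>) = X (- \<alpha>)"
    and orthonormal: "orthonormal_basis \<hh> B S"
begin

abbreviation "\<Delta> \<equiv> roots \<hh> B"
abbreviation "Q \<equiv> root_lattice \<hh> B"

lemma B_commute: "B x y = B y x"
  and B_add_left [simp]: "B (x + y) z = B x z + B y z"
  and B_scale_left [simp]: "B (c *\<^sub>C x) y = c * B x y"
  and B_invariant: "B (lie x y) z = B x (lie y z)"
  using form unfolding normalized_invariant_form_def invariant_form_def by blast+

lemma B_add_right [simp]: "B z (x + y) = B z x + B z y"
  and B_scale_right [simp]: "B y (c *\<^sub>C x) = c * B y x"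
  by (metis B_commute B_add_left, metis B_commute B_scale_left)

lemma B_minus [simp]: "B (- x) y = - B x y" "B x (- y) = - B x y"
  using B_scale_left[of "-1" x y] B_scale_right[of x "-1" y] by simp_all

lemma B_zero [simp]: "B 0 y = 0" "B x 0 = 0"
  using B_scale_left[of 0 0 y] B_scale_right[of x 0 0] by simp_all

lemma B_diff [simp]: "B (x - y) z = B x z - B y z" "B z (x - y) = B z x - B z y"
  using B_add_left[of x "- y"] B_add_right[of z x "- y"] by simp_all

lemma B_sum: "B (sum f A) y = (\<Sum>i\<in>A. B (f i) y)" "B y (sum f A) = (\<Sum>i\<in>A. B y (f i))"
  by (induction A rule: infinite_finite_induct) simp_all

lemma root_norm: "\<alpha> \<in> \<Delta> \<Longrightarrow> B \<alpha> \<alpha> = 2"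
  using form by (simp add: normalized_invariant_form_def)

lemma subspace_cartan: "cvs.subspace \<hh>"
  and cartan_abelian: "H \<in> \<hh> \<Longrightarrow> H' \<in> \<hh> \<Longrightarrow> lie H H' = 0"
  and cartan_diagonalizable: "H \<in> \<hh> \<Longrightarrow> cvs.span {x. \<exists>c. lie H x = c *\<^sub>C x} = UNIV"
  and centralizer: "(\<And>H. H \<in> \<hh> \<Longrightarrow> lie H x = 0) \<Longrightarrow> x \<in> \<hh>"
  using cartan by (auto simp: cartan_subalgebra_def)

lemma root_in_cartan: "\<alpha> \<in> \<Delta> \<Longrightarrow> \<alpha> \<in> \<hh>" and root_nonzero: "\<alpha> \<in> \<Delta> \<Longrightarrow> \<alpha> \<noteq> 0"
  by (simp_all add: roots_def)

lemma S_in_cartan: "S j \<in> \<hh>" and B_S: "B (S i) (S j) = (if i = j then 1 else 0)"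
  and span_S: "cvs.span (range S) = \<hh>"
  using orthonormal cvs.span_base[of "S j" "range S"] by (auto simp: orthonormal_basis_def)

lemma cartan_expansion:
  assumes "H \<in> \<hh>"
  shows "H = (\<Sum>j\<in>UNIV. B H (S j) *\<^sub>C S j)"
proof -
  have "H \<in> cvs.span (range S)" using assms by (simp add: span_S)
  then show ?thesis
  proof (induction rule: cvs.span_induct_alt)
    case base
    show ?case by simp
  next
    case (step c x y)
    from step(1) obtain i where x: "x = S i" by auto
    have "(\<Sum>j\<in>UNIV. (c * B (S i) (S j)) *\<^sub>C S j) = c *\<^sub>C S i"
      by (simp add: B_S if_distrib[of "\<lambda>t. t *\<^sub>C _"] if_distrib[of "\<lambda>t. c * t"] sum.delta cong: if_cong)
    then show ?case
      unfolding x B_add_left B_scale_left cscale_add_left sum.distrib using step(2) by simp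
  qed
qed

text \<open>The form is nondegenerate on the Cartan subalgebra because of the orthonormal basis.\<close>

lemma cartan_eqI: "H \<in> \<hh> \<Longrightarrow> (\<And>H'. H' \<in> \<hh> \<Longrightarrow> B H H' = 0) \<Longrightarrow> H = 0"
  using cartan_expansion[of H] by (simp add: S_in_cartan)

lemma inner_expansion: "H \<in> \<hh> \<Longrightarrow> B H' H = (\<Sum>j\<in>UNIV. B H' (S j) * B H (S j))"
  by (subst cartan_expansion[of H]) (simp_all add: B_sum mult.commute)

lemma root_spaceI: "(\<And>H. H \<in> \<hh> \<Longrightarrow> lie H x = B \<mu> H *\<^sub>C x) \<Longrightarrow> x \<in> root_space \<hh> B \<mu>"
  by (simp add: root_space_def)

lemma root_spaceD: "x \<in> root_space \<hh> B \<mu> \<Longrightarrow> H \<in> \<hh> \<Longrightarrow> lie H x = B \<mu> H *\<^sub>C x"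
  by (simp add: root_space_def)

lemma root_space_0: "root_space \<hh> B 0 = \<hh>"
  by (auto simp: root_space_def cartan_abelian intro: centralizer)

lemma weight_cases: "x \<in> root_space \<hh> B \<mu> \<Longrightarrow> x \<noteq> 0 \<Longrightarrow> \<mu> \<in> \<hh> \<Longrightarrow> \<mu> = 0 \<or> \<mu> \<in> \<Delta>"
  by (auto simp: roots_def)

lemma lie_root_space:
  assumes "x \<in> root_space \<hh> B \<alpha>" "y \<in> root_space \<hh> B \<beta>"
  shows "lie x y \<in> root_space \<hh> B (\<alpha> + \<beta>)"
proof (rule root_spaceI)
  fix H assume H: "H \<in> \<hh>"
  have "lie H (lie x y) = lie (lie H x) y + lie x (lie H y)"
    using jacobi[of H x y] lie_commute[of y H] lie_commute[of y "lie H x"]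
    by (simp add: algebra_simps add_eq_0_iff2)
  then show "lie H (lie x y) = B (\<alpha> + \<beta>) H *\<^sub>C lie x y"
    using assms H by (simp add: root_spaceD lie_cscale_left lie_cscale_right cscale_add_left)
qed

lemma B_root_space:
  assumes x: "x \<in> root_space \<hh> B \<alpha>" and y: "y \<in> root_space \<hh> B \<beta>"
    and "\<alpha> \<in> \<hh>" "\<beta> \<in> \<hh>" "\<alpha> + \<beta> \<noteq> 0"
  shows "B x y = 0"
proof -
  have "\<alpha> + \<beta> \<in> \<hh>" using assms subspace_cartan by (simp add: cvs.subspace_add)
  then obtain H where H: "H \<in> \<hh>" "B (\<alpha> + \<beta>) H \<noteq> 0" using cartan_eqI \<open>\<alpha> + \<beta> \<noteq> 0\<close> by blast
  have "B \<alpha> H * B x y = B (lie H x) y" using x H by (simp add: root_spaceD)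
  also have "\<dots> = - B x (lie H y)" by (subst lie_commute) (simp add: B_invariant)
  also have "\<dots> = - B \<beta> H * B x y" using y H by (simp add: root_spaceD)
  finally have "B (\<alpha> + \<beta>) H * B x y = 0" by (simp add: algebra_simps)
  then show ?thesis using H by simp
qed

lemma root_vector_in_root_space: "\<alpha> \<in> \<Delta> \<Longrightarrow> X \<alpha> \<in> root_space \<hh> B \<alpha>"
  and root_vector_nonzero: "\<alpha> \<in> \<Delta> \<Longrightarrow> X \<alpha> \<noteq> 0"
  and lie_root_vectors_add:
    "\<alpha> \<in> \<Delta> \<Longrightarrow> \<beta> \<in> \<Delta> \<Longrightarrow> \<alpha> + \<beta> \<in> \<Delta> \<Longrightarrow> lie (X \<alpha>) (X \<beta>) = \<nu> \<alpha> \<beta> *\<^sub>C X (\<alpha> + \<beta>)"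
  and lie_root_vectors_opposite: "\<alpha> \<in> \<Delta> \<Longrightarrow> lie (X \<alpha>) (X (- \<alpha>)) = - \<alpha>"
  using root_vectors by (auto simp: root_vectors_def)

lemma lie_cartan_root_vector: "\<alpha> \<in> \<Delta> \<Longrightarrow> H \<in> \<hh> \<Longrightarrow> lie H (X \<alpha>) = B \<alpha> H *\<^sub>C X \<alpha>"
  by (rule root_spaceD[OF root_vector_in_root_space])

text \<open>\<open>\<sigma>\<close> carries the root space of \<open>\<alpha>\<close> to that of \<open>-\<alpha>\<close>.\<close>

lemma uminus_root:
  assumes "\<alpha> \<in> \<Delta>"
  shows "- \<alpha> \<in> \<Delta>"
proof -
  have hom: "\<sigma> (lie x y) = lie (\<sigma> x) (\<sigma> y)" "\<sigma> (c *\<^sub>C x) = c *\<^sub>C \<sigma> x" for x y c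
    using \<sigma> by (simp_all add: lie_automorphism_def)
  have "X (- \<alpha>) \<in> root_space \<hh> B (- \<alpha>)"
  proof (rule root_spaceI)
    fix H assume H: "H \<in> \<hh>"
    have "\<sigma> (lie H (X \<alpha>)) = - lie H (X (- \<alpha>))"
      using H assms \<sigma>_cartan \<sigma>_root_vector by (simp add: hom)
    moreover have "\<sigma> (lie H (X \<alpha>)) = B \<alpha> H *\<^sub>C X (- \<alpha>)"
      using H assms \<sigma>_root_vector by (simp add: lie_cartan_root_vector hom)
    ultimately have "- lie H (X (- \<alpha>)) = B \<alpha> H *\<^sub>C X (- \<alpha>)" by simp
    then have "lie H (X (- \<alpha>)) = - (B \<alpha> H *\<^sub>C X (- \<alpha>))" by (metis minus_minus)
    then show "lie H (X (- \<alpha>)) = B (- \<alpha>) H *\<^sub>C X (- \<alpha>)" by simp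
  qed
  moreover have "X (- \<alpha>) \<noteq> 0"
    using lie_root_vectors_opposite[OF assms] root_nonzero[OF assms] by auto
  moreover have "- \<alpha> \<in> \<hh>"
    using cvs.subspace_neg[OF subspace_cartan root_in_cartan[OF assms]] .
  ultimately show ?thesis using root_nonzero[OF assms] by (auto simp: roots_def)
qed

lemma B_root_vectors_opposite:
  assumes "\<alpha> \<in> \<Delta>"
  shows "B (X \<alpha>) (X (- \<alpha>)) = - 1"
proof -
  note \<alpha> = root_in_cartan[OF assms]
  have "- 2 = B (lie (X \<alpha>) (X (- \<alpha>))) \<alpha>"
    using assms by (simp add: lie_root_vectors_opposite root_norm)
  also have "\<dots> = B (X \<alpha>) (- lie \<alpha> (X (- \<alpha>)))"
    by (simp only: B_invariant lie_commute[of _ \<alpha>])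
  also have "\<dots> = 2 * B (X \<alpha>) (X (- \<alpha>))"
    using assms \<alpha> by (simp add: lie_cartan_root_vector uminus_root root_norm)
  finally show ?thesis by simp
qed

lemma B_root_vectors:
  "\<alpha> \<in> \<Delta> \<Longrightarrow> \<beta> \<in> \<Delta> \<Longrightarrow> B (X \<alpha>) (X \<beta>) = (if \<alpha> + \<beta> = 0 then - 1 else 0)"
  using B_root_vectors_opposite[of \<alpha>]
  by (auto simp: add_eq_0_iff intro!: B_root_space root_vector_in_root_space root_in_cartan)

lemma B_cartan_root_vector: "H \<in> \<hh> \<Longrightarrow> \<alpha> \<in> \<Delta> \<Longrightarrow> B H (X \<alpha>) = 0"
  using B_root_space[of H 0 "X \<alpha>" \<alpha>] root_vector_in_root_space cvs.subspace_0[OF subspace_cartan]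
  by (simp add: root_space_0 root_in_cartan root_nonzero)

text \<open>A nonzero bracket makes \<open>\<alpha> + \<beta>\<close> a root, hence of norm \<open>2\<close>, which fixes \<open>(\<alpha>|\<beta>)\<close>. This norm argument
  takes the place of root strings.\<close>

lemma lie_roots_nonzero:
  assumes "\<alpha> \<in> \<Delta>" "\<beta> \<in> \<Delta>" "\<alpha> + \<beta> \<noteq> 0"
    and x: "x \<in> root_space \<hh> B \<alpha>" and y: "y \<in> root_space \<hh> B \<beta>" and "lie x y \<noteq> 0"
  shows "\<alpha> + \<beta> \<in> \<Delta> \<and> B \<alpha> \<beta> = - 1"
proof -
  have "\<alpha> + \<beta> \<in> \<hh>" using assms subspace_cartan by (simp add: cvs.subspace_add root_in_cartan)
  then have "\<alpha> + \<beta> \<in> \<Delta>" using weight_cases[OF lie_root_space[OF x y]] assms by auto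
  moreover from root_norm[OF this] have "4 + 2 * B \<alpha> \<beta> = 2"
    using assms by (simp add: root_norm B_commute[of \<beta> \<alpha>])
  then have "2 * (B \<alpha> \<beta> + 1) = 0" by (simp add: algebra_simps add_eq_0_iff2)
  then have "B \<alpha> \<beta> = - 1" by (simp add: add_eq_0_iff2)
  ultimately show ?thesis ..
qed

text \<open>Subtracting from \<open>y\<close> a multiple of \<open>X\<^sub>\<alpha>\<close> leaves a vector \<open>z\<close> of weight \<open>\<alpha>\<close> that is killed by
  \<open>X\<^sub>-\<^sub>\<alpha>\<close>; it is also killed by \<open>X\<^sub>\<alpha>\<close>, because \<open>2\<alpha>\<close> has the wrong length to be a root. So \<open>z\<close> is killed
  by \<open>[X\<^sub>\<alpha>, X\<^sub>-\<^sub>\<alpha>] = -\<alpha>\<close>, which acts on it as \<open>-2\<close>.\<close>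

lemma root_space_one_dimensional:
  assumes \<alpha>: "\<alpha> \<in> \<Delta>" and y: "y \<in> root_space \<hh> B \<alpha>"
  shows "y = - B y (X (- \<alpha>)) *\<^sub>C X \<alpha>"
proof -
  note \<alpha>h = root_in_cartan[OF \<alpha>] and m\<alpha> = uminus_root[OF \<alpha>]
  define z where "z = y + B y (X (- \<alpha>)) *\<^sub>C X \<alpha>"
  have z: "z \<in> root_space \<hh> B \<alpha>"
    unfolding z_def
    by (rule root_spaceI)
      (simp add: lie_add_right lie_cscale_right root_spaceD[OF y] lie_cartan_root_vector[OF \<alpha>]
        cscale_add_right mult.commute)
  have Bz: "B z (X (- \<alpha>)) = 0" by (simp add: z_def B_root_vectors_opposite[OF \<alpha>])
  have "lie z (X (- \<alpha>)) \<in> \<hh>"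
    using lie_root_space[OF z root_vector_in_root_space[OF m\<alpha>]] by (simp add: root_space_0)
  moreover have "B (lie z (X (- \<alpha>))) H = 0" if "H \<in> \<hh>" for H
    using that Bz
    by (subst B_invariant, subst lie_commute) (simp add: lie_cartan_root_vector[OF m\<alpha>])
  ultimately have 1: "lie z (X (- \<alpha>)) = 0" by (rule cartan_eqI)
  have "\<alpha> + \<alpha> \<noteq> 0"
    using B_add_left[of \<alpha> \<alpha> \<alpha>] root_norm[OF \<alpha>] by (auto simp del: B_add_left)
  then have 2: "lie (X \<alpha>) z = 0"
    using lie_roots_nonzero[OF \<alpha> \<alpha> _ root_vector_in_root_space[OF \<alpha>] z] root_norm[OF \<alpha>] by auto
  have "lie z (- \<alpha>) = 0"
    using jacobi[of z "X \<alpha>" "X (- \<alpha>)"] 1 2 lie_commute[of "X (- \<alpha>)" z] lie_commute[of z "X \<alpha>"]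
    by (simp add: lie_root_vectors_opposite[OF \<alpha>])
  then have "2 *\<^sub>C z = 0"
    using root_spaceD[OF z \<alpha>h] lie_commute[of z \<alpha>] by (simp add: root_norm[OF \<alpha>])
  then have "z = 0" by simp
  then show ?thesis by (simp add: z_def eq_neg_iff_add_eq_0)
qed

text \<open>If neither \<open>[X\<^sub>\<alpha>, X\<^sub>\<beta>]\<close> nor \<open>[X\<^sub>-\<^sub>\<alpha>, X\<^sub>\<beta>]\<close> is nonzero, then \<open>[X\<^sub>\<alpha>, X\<^sub>-\<^sub>\<alpha>] = -\<alpha>\<close> kills \<open>X\<^sub>\<beta>\<close> by the Jacobi
  identity, that is, \<open>(\<alpha>|\<beta>) = 0\<close>.\<close>

lemma inner_roots_cases:
  assumes \<alpha>: "\<alpha> \<in> \<Delta>" and \<beta>: "\<beta> \<in> \<Delta>" and ne: "\<beta> \<noteq> \<alpha>" "\<beta> \<noteq> - \<alpha>"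
  shows "(B \<alpha> \<beta> = - 1 \<and> \<alpha> + \<beta> \<in> \<Delta>) \<or> (B \<alpha> \<beta> = 1 \<and> \<alpha> - \<beta> \<in> \<Delta>) \<or> B \<alpha> \<beta> = 0"
proof -
  note vec = root_vector_in_root_space
  have sum: "\<alpha> + \<beta> \<noteq> 0" "- \<alpha> + \<beta> \<noteq> 0" using ne by (auto simp: add_eq_0_iff)
  consider "lie (X \<alpha>) (X \<beta>) \<noteq> 0" | "lie (X (- \<alpha>)) (X \<beta>) \<noteq> 0"
    | "lie (X \<alpha>) (X \<beta>) = 0" "lie (X (- \<alpha>)) (X \<beta>) = 0" by blast
  then show ?thesis
  proof cases
    case 1
    then show ?thesis using lie_roots_nonzero[OF \<alpha> \<beta> sum(1) vec[OF \<alpha>] vec[OF \<beta>]] by simp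
  next
    case 2
    then have "- \<alpha> + \<beta> \<in> \<Delta>" "B \<alpha> \<beta> = 1"
      using lie_roots_nonzero[OF uminus_root[OF \<alpha>] \<beta> sum(2) vec[OF uminus_root[OF \<alpha>]] vec[OF \<beta>]]
      by (simp_all add: minus_equation_iff[of _ 1] eq_commute[of "- _" "- 1"])
    then show ?thesis using uminus_root[of "- \<alpha> + \<beta>"] by simp
  next
    case 3
    have "lie (X \<beta>) (- \<alpha>) = 0"
      using jacobi[of "X \<beta>" "X \<alpha>" "X (- \<alpha>)"] 3 lie_commute[of "X \<beta>" "X \<alpha>"]
      by (simp add: lie_root_vectors_opposite[OF \<alpha>])
    then have "B \<beta> \<alpha> *\<^sub>C X \<beta> = 0"
      using lie_cartan_root_vector[OF \<beta> root_in_cartan[OF \<alpha>]] lie_commute[of "X \<beta>" \<alpha>] by simp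
    then show ?thesis using root_vector_nonzero[OF \<beta>] B_commute by simp
  qed
qed

lemma add_root_if_inner_minus_1:
  assumes "\<alpha> \<in> \<Delta>" "\<beta> \<in> \<Delta>" "B \<alpha> \<beta> = - 1"
  shows "\<alpha> + \<beta> \<in> \<Delta>"
proof -
  have "\<beta> \<noteq> \<alpha>" "\<beta> \<noteq> - \<alpha>" using assms root_norm[OF assms(1)] by auto
  then show ?thesis using inner_roots_cases[OF assms(1,2)] assms(3) by auto
qed

lemma lie_root_vectors_eq_0:
  "\<alpha> \<in> \<Delta> \<Longrightarrow> \<beta> \<in> \<Delta> \<Longrightarrow> \<alpha> + \<beta> \<noteq> 0 \<Longrightarrow> B \<alpha> \<beta> \<noteq> - 1 \<Longrightarrow> lie (X \<alpha>) (X \<beta>) = 0"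
  using lie_roots_nonzero root_vector_in_root_space by blast

text \<open>Simultaneous diagonalization of the operators \<open>ad S\<^sub>j\<close>, by induction on the set of indices: the
  \<open>ad S\<^sub>i\<close>-components of a joint eigenvector of the others stay in the eigenspaces of the others,
  because these are invariant under \<open>ad S\<^sub>i\<close>.\<close>

lemma joint_eigenvectors_span:
  "cvs.span {y. \<forall>j\<in>J. \<exists>c. lie (S j) y = c *\<^sub>C y} = UNIV"
proof -
  have "finite J" by simp
  then show ?thesis
  proof (induction J rule: finite_induct)
    case (insert i J)
    let ?E = "\<lambda>J. {y. \<forall>j\<in>J. \<exists>c. lie (S j) y = c *\<^sub>C y}"
    have "y \<in> cvs.span (?E (insert i J))" if y: "y \<in> ?E J" for y
    proof -
      obtain C Y where Y: "finite C" "\<And>c. lie (S i) (Y c) = c *\<^sub>C Y c" "y = (\<Sum>c\<in>C. Y c)"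
        using eigenvector_decomposition[of "lie (S i)" y] cartan_diagonalizable[OF S_in_cartan]
        by (auto simp: lie_add_right lie_cscale_right)
      have "Y c \<in> ?E (insert i J)" if "c \<in> C" for c
      proof -
        have "\<exists>d. lie (S j) (Y c) = d *\<^sub>C Y c" if j: "j \<in> J" for j
        proof -
          obtain d where d: "lie (S j) y = d *\<^sub>C y" using y j by auto
          have comm: "lie (S j) (lie (S i) x) = lie (S i) (lie (S j) x)" for x
            using jacobi[of "S j" "S i" x] cartan_abelian[OF S_in_cartan S_in_cartan]
              lie_commute[of x "S j"] by simp
          have "Y c \<in> {x. lie (S j) x = d *\<^sub>C x}"
            by (rule eigenvector_components_in_subspace[where T = "lie (S i)" and C = C])
              (auto simp: cvs.subspace_def lie_add_right lie_cscale_right cscale_add_right Y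
                comm cscale_left_commute \<open>c \<in> C\<close> d[unfolded Y(3)] mult.commute)
          then show ?thesis by auto
        qed
        then show ?thesis using Y(2) by auto
      qed
      then show ?thesis unfolding Y(3) by (intro cvs.span_sum cvs.span_base)
    qed
    then have "cvs.span (?E J) \<subseteq> cvs.span (?E (insert i J))"
      by (intro cvs.span_minimal) auto
    then show ?case using insert.IH by auto
  qed simp
qed

text \<open>A joint eigenvector with eigenvalues \<open>c\<^sub>j\<close> has weight \<open>\<mu> = \<Sum> c\<^sub>j S\<^sub>j\<close>. If \<open>\<mu> = 0\<close>, it lies in the
  Cartan subalgebra; otherwise \<open>\<mu>\<close> is a root, with a root space spanned by \<open>X\<^sub>\<mu>\<close>.\<close>

lemma root_decomposition: "cvs.span (\<hh> \<union> X ` \<Delta>) = UNIV"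
proof -
  have "y \<in> cvs.span (\<hh> \<union> X ` \<Delta>)" if y: "\<forall>j. \<exists>c. lie (S j) y = c *\<^sub>C y" for y
  proof -
    obtain c where c: "\<And>j. lie (S j) y = c j *\<^sub>C y" using y by metis
    define \<mu> where "\<mu> = (\<Sum>j\<in>UNIV. c j *\<^sub>C S j)"
    have \<mu>h: "\<mu> \<in> \<hh>" unfolding \<mu>_def
      by (intro cvs.subspace_sum cvs.subspace_scale subspace_cartan S_in_cartan)
    have "B \<mu> (S j) = c j" for j
      by (simp add: \<mu>_def B_sum B_S if_distrib[of "\<lambda>t. _ * t"] sum.delta cong: if_cong)
    then have "lie H y = B \<mu> H *\<^sub>C y" if "H \<in> \<hh>" for H
      by (subst cartan_expansion[OF that])
        (simp add: lie_sum_left lie_cscale_left c inner_expansion[OF that] cvs.scale_sum_left mult.commute)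
    then have y: "y \<in> root_space \<hh> B \<mu>" by (rule root_spaceI)
    consider "y = 0" | "\<mu> = 0" | "\<mu> \<in> \<Delta>" using weight_cases[OF y _ \<mu>h] by blast
    then show ?thesis
    proof cases
      case 2
      then show ?thesis using y by (auto simp: root_space_0 intro: cvs.span_base)
    next
      case 3
      then show ?thesis
        by (subst root_space_one_dimensional[OF 3 y]) (intro cvs.span_scale cvs.span_base, simp)
    qed (simp add: cvs.span_zero)
  qed
  then have "cvs.span {y. \<forall>j\<in>UNIV. \<exists>c. lie (S j) y = c *\<^sub>C y} \<subseteq> cvs.span (\<hh> \<union> X ` \<Delta>)"
    by (intro cvs.span_minimal) auto
  then show ?thesis unfolding joint_eigenvectors_span by auto
qed

lemma root_decomposition_induct [case_names cartan root combination]: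
  assumes "\<And>H. H \<in> \<hh> \<Longrightarrow> P H" "\<And>\<alpha>. \<alpha> \<in> \<Delta> \<Longrightarrow> P (X \<alpha>)"
    and "\<And>c x y. P x \<Longrightarrow> P y \<Longrightarrow> P (c *\<^sub>C x + y)"
  shows "P x"
proof -
  have P0: "P 0" using assms(1) cvs.subspace_0[OF subspace_cartan] by simp
  have "P (x + y)" if "P x" "P y" for x y using assms(3)[OF that, of 1] by simp
  moreover have "P (c *\<^sub>C x)" if "P x" for c x using assms(3)[OF that P0, of c] by simp
  ultimately have "cvs.subspace {x. P x}" using P0 by (auto simp: cvs.subspace_def)
  then have "cvs.span (\<hh> \<union> X ` \<Delta>) \<subseteq> {x. P x}"
    by (intro cvs.span_minimal) (use assms(1,2) in auto)
  then show ?thesis unfolding root_decomposition by auto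
qed

text \<open>The form pairs \<open>X\<^sub>-\<^sub>\<alpha>\<close> nontrivially with \<open>X\<^sub>\<alpha>\<close>, hence with some element of a finite spanning set;
  and a fixed element has a nonzero pairing with only finitely many of these root vectors.\<close>

lemma finite_roots: "finite \<Delta>"
proof -
  let ?Z = "\<lambda>x. {\<alpha> \<in> \<Delta>. B x (X (- \<alpha>)) \<noteq> 0}"
  have fin: "finite (?Z x)" for x
  proof (induction x rule: root_decomposition_induct)
    case (cartan H)
    then have "?Z H = {}" by (auto simp: B_cartan_root_vector uminus_root)
    then show ?case by (simp only: finite.emptyI)
  next
    case (root \<beta>)
    then have "?Z (X \<beta>) \<subseteq> {\<beta>}" by (auto simp: B_root_vectors uminus_root split: if_splits)
    then show ?case by (rule finite_subset) simp
  next
    case (combination c x y)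
    have "?Z (c *\<^sub>C x + y) \<subseteq> ?Z x \<union> ?Z y" by auto
    then show ?case using combination by (auto intro: finite_subset)
  qed
  obtain A :: "'a set" where A: "finite A" "cvs.span A = UNIV"
    using simple by (auto simp: simple_fd_lie_algebra_def)
  have "\<Delta> \<subseteq> (\<Union>a\<in>A. ?Z a)"
  proof
    fix \<alpha> assume \<alpha>: "\<alpha> \<in> \<Delta>"
    show "\<alpha> \<in> (\<Union>a\<in>A. ?Z a)"
    proof (rule ccontr)
      assume "\<alpha> \<notin> (\<Union>a\<in>A. ?Z a)"
      then have "A \<subseteq> {x. B x (X (- \<alpha>)) = 0}" using \<alpha> by auto
      then have "cvs.span A \<subseteq> {x. B x (X (- \<alpha>)) = 0}"
        by (rule cvs.span_minimal) (auto simp: cvs.subspace_def)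
      moreover have "X \<alpha> \<in> cvs.span A" using A(2) by simp
      ultimately have "B (X \<alpha>) (X (- \<alpha>)) = 0" by blast
      then show False using B_root_vectors_opposite[OF \<alpha>] by simp
    qed
  qed
  then show ?thesis using A(1) fin by (auto intro: finite_subset)
qed

end

section \<open>Operators on V\<close>

lemma lookup_V_scale [simp]: "lookup (V_scale c v) x = fock_scale c (lookup v x)"
  by (simp add: V_scale_def map.rep_eq when_def)

lemma V_scale_single [simp]: "V_scale c (single x f) = single x (fock_scale c f)"
  by (rule poly_mapping_eqI) (simp add: lookup_single when_def)

lemma V_scale_add: "V_scale c (v + w) = V_scale c v + V_scale c w"
  and V_scale_add_left: "V_scale (c + d) v = V_scale c v + V_scale d v"
  and V_scale_diff: "V_scale c (v - w) = V_scale c v - V_scale c w"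
  and V_scale_minus_left: "V_scale (- c) v = - V_scale c v"
  and V_scale_V_scale [simp]: "V_scale c (V_scale d v) = V_scale (c * d) v"
  and V_scale_one [simp]: "V_scale 1 v = v"
  and V_scale_zero [simp]: "V_scale 0 v = 0" "V_scale c 0 = 0"
  and V_scale_sum: "V_scale c (sum F A) = (\<Sum>i\<in>A. V_scale c (F i))"
  by (auto intro!: poly_mapping_eqI
      simp: lookup_add lookup_minus lookup_sum sum_distrib_left algebra_simps)

lemma keys_V_scale: "keys (V_scale c v) \<subseteq> keys v"
  by (auto simp: in_keys_iff)

text \<open>Linearity on the whole type, which contains \<open>V\<close> as the subspace of elements supported on cosets
  of lattice vectors.\<close>

definition V_linear :: "(('a, 'n) vertex \<Rightarrow> ('a, 'n) vertex) \<Rightarrow> bool" where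
  "V_linear T \<longleftrightarrow> (\<forall>v w. T (v + w) = T v + T w) \<and> (\<forall>c v. T (V_scale c v) = V_scale c (T v))"

lemma V_linear_add: "V_linear T \<Longrightarrow> T (v + w) = T v + T w"
  and V_linear_scale: "V_linear T \<Longrightarrow> T (V_scale c v) = V_scale c (T v)"
  by (simp_all add: V_linear_def)

lemma V_linear_zero: "V_linear T \<Longrightarrow> T 0 = 0"
  using V_linear_add[of T 0 0] by simp

lemma V_linear_diff: "V_linear T \<Longrightarrow> T (v - w) = T v - T w"
  using V_linear_add[of T "v - w" w] by simp

lemma V_linear_compose: "V_linear T \<Longrightarrow> V_linear T' \<Longrightarrow> V_linear (\<lambda>v. T (T' v))"
  and V_linear_add_fun: "V_linear T \<Longrightarrow> V_linear T' \<Longrightarrow> V_linear (\<lambda>v. T v + T' v)"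
  and V_linear_diff_fun: "V_linear T \<Longrightarrow> V_linear T' \<Longrightarrow> V_linear (\<lambda>v. T v - T' v)"
  and V_linear_scale_fun: "V_linear T \<Longrightarrow> V_linear (\<lambda>v. V_scale c (T v))"
  and V_linear_zero_fun: "V_linear (\<lambda>v. 0)"
  and V_linear_id: "V_linear (\<lambda>v. v)"
  by (simp_all add: V_linear_def V_scale_add V_scale_diff mult.commute)

lemma V_linear_when: "V_linear T \<Longrightarrow> V_linear (\<lambda>v. T v when P)"
  by (cases P) (simp_all add: V_linear_zero_fun)

lemma V_linear_sum_fun: "(\<And>i. i \<in> A \<Longrightarrow> V_linear (F i)) \<Longrightarrow> V_linear (\<lambda>v. \<Sum>i\<in>A. F i v)"
  by (simp add: V_linear_def sum.distrib V_scale_sum)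

lemma V_linear_cosetwise:
  fixes T :: "'a set \<Rightarrow> 'n fock \<Rightarrow> 'n fock" and \<phi> :: "'a set \<Rightarrow> 'a set"
  assumes T: "\<And>c. fock_linear (T c)"
  shows "V_linear (\<lambda>v. \<Sum>c\<in>keys v. single (\<phi> c) (T c (lookup v c)))"
proof -
  have sup: "(\<Sum>c\<in>keys v. single (\<phi> c) (T c (lookup v c))) = (\<Sum>c\<in>K. single (\<phi> c) (T c (lookup v c)))"
    if "finite K" "keys v \<subseteq> K" for v K
    using that by (intro sum.mono_neutral_left) (auto simp: in_keys_iff fock_linear_zero[OF T])
  show ?thesis
    unfolding V_linear_def
  proof safe
    fix v w :: "'a set \<Rightarrow>\<^sub>0 'n fock"
    let ?K = "keys v \<union> keys w"
    show "(\<Sum>c\<in>keys (v + w). single (\<phi> c) (T c (lookup (v + w) c))) =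
        (\<Sum>c\<in>keys v. single (\<phi> c) (T c (lookup v c))) + (\<Sum>c\<in>keys w. single (\<phi> c) (T c (lookup w c)))"
    proof -
      have K: "finite ?K" by simp
      show ?thesis
        unfolding sup[OF K keys_add] sup[OF K Un_upper1] sup[OF K Un_upper2]
        by (simp add: lookup_add fock_linear_add[OF T] single_add sum.distrib)
    qed
  next
    fix a and v :: "'a set \<Rightarrow>\<^sub>0 'n fock"
    show "(\<Sum>c\<in>keys (V_scale a v). single (\<phi> c) (T c (lookup (V_scale a v) c))) =
        V_scale a (\<Sum>c\<in>keys v. single (\<phi> c) (T c (lookup v c)))"
      unfolding sup[OF finite_keys keys_V_scale] by (simp add: fock_linear_scale[OF T] V_scale_sum)
  qed
qed

lemma V_linear_on_fock: "fock_linear T \<Longrightarrow> V_linear (on_fock T)"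
  unfolding on_fock_def by (rule V_linear_cosetwise)

lemma V_linear_\<Gamma>: "V_linear (\<Gamma>_series B \<nu> S \<alpha> m)"
  unfolding \<Gamma>_series_def by (intro V_linear_cosetwise fock_linear_scale_fun fock_linear_U)

lemma on_fock_single: "fock_linear T \<Longrightarrow> on_fock T (single c f) = single c (T f)"
  by (cases "f = 0") (simp_all add: on_fock_def fock_linear_zero)

lemma V_space_zero: "0 \<in> V_space Q"
  by (simp add: V_space_def)

lemma V_space_add: "v \<in> V_space Q \<Longrightarrow> w \<in> V_space Q \<Longrightarrow> v + w \<in> V_space Q"
  using keys_add[of v w] by (auto simp: V_space_def)

lemma V_space_scale: "v \<in> V_space Q \<Longrightarrow> V_scale c v \<in> V_space Q"
  using keys_V_scale[of c v] by (auto simp: V_space_def)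

lemma V_space_minus: "v \<in> V_space Q \<Longrightarrow> - v \<in> V_space Q"
  using V_space_scale[of v Q "- 1"] by (simp add: V_scale_minus_left)

lemma V_space_diff: "v \<in> V_space Q \<Longrightarrow> w \<in> V_space Q \<Longrightarrow> v - w \<in> V_space Q"
  using V_space_add[of v Q "- w"] V_space_minus[of w Q] by simp

lemma V_space_sum: "(\<And>i. i \<in> A \<Longrightarrow> F i \<in> V_space Q) \<Longrightarrow> sum F A \<in> V_space Q"
  by (induction A rule: infinite_finite_induct) (simp_all add: V_space_zero V_space_add)

lemma V_space_single: "\<gamma> \<in> Q \<Longrightarrow> single (coset Q \<gamma>) f \<in> V_space Q"
  by (simp add: V_space_def)

lemma V_space_induct [consumes 1, case_names single add]:
  assumes "v \<in> V_space Q"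
    and single: "\<And>\<gamma> f. \<gamma> \<in> Q \<Longrightarrow> P (single (coset Q \<gamma>) f)"
    and add: "\<And>v w. P v \<Longrightarrow> P w \<Longrightarrow> P (v + w)"
    and "Q \<noteq> {}"
  shows "P v"
proof -
  from \<open>Q \<noteq> {}\<close> obtain \<gamma> where "\<gamma> \<in> Q" by auto
  from single[OF this, of 0] have "P 0" by simp
  then have "P (\<Sum>c\<in>A. single c (lookup v c))" if "A \<subseteq> keys v" for A
    using that finite_subset[OF that finite_keys]
  proof (induction A rule: infinite_finite_induct)
    case (insert c A)
    then have "c \<in> coset Q ` Q" using assms(1) by (auto simp: V_space_def)
    then show ?case using insert single add by auto
  qed simp_all
  from this[OF order.refl] show ?thesis by (simp flip: poly_mapping_sum_single)
qed

text \<open>Relations on \<open>V\<close> need only be checked on the tensors \<open>e\<^sup>\<gamma> \<otimes> f\<close>.\<close>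

lemma V_linear_eqI:
  assumes "v \<in> V_space Q" "Q \<noteq> {}" "V_linear T" "V_linear T'"
    and "\<And>\<gamma> f. \<gamma> \<in> Q \<Longrightarrow> T (single (coset Q \<gamma>) f) = T' (single (coset Q \<gamma>) f)"
  shows "T v = T' v"
  using assms(1) by (induction rule: V_space_induct) (simp_all add: assms V_linear_add)

lemma V_linear_in_V_space:
  assumes "v \<in> V_space Q" "Q \<noteq> {}" "V_linear T"
    and "\<And>\<gamma> f. \<gamma> \<in> Q \<Longrightarrow> T (single (coset Q \<gamma>) f) \<in> V_space Q"
  shows "T v \<in> V_space Q"
  using assms(1) by (induction rule: V_space_induct) (simp_all add: assms V_linear_add V_space_add)

text \<open>The operator by which the coefficient of \<open>z\<^sup>m\<close> in \<open>H(z)\<close> is to act, defined for an arbitrary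
  element in place of \<open>H\<close>: the pairings with the basis \<open>S\<close> then extract its Cartan component.\<close>

definition cartan_op ::
  "('a::complex_lie_algebra \<Rightarrow> 'a \<Rightarrow> complex) \<Rightarrow> ('n::finite \<Rightarrow> 'a) \<Rightarrow> 'a \<Rightarrow> int \<Rightarrow>
   ('a, 'n) vertex \<Rightarrow> ('a, 'n) vertex" where
  "cartan_op B S H m v = V_scale (1 / complex_of_real (sqrt 2))
     (\<Sum>j\<in>UNIV. V_scale (B H (S j)) (on_fock (heisenberg_series j m) v))"

definition cartan_fock ::
  "('a \<Rightarrow> 'a \<Rightarrow> complex) \<Rightarrow> ('n::finite \<Rightarrow> 'a) \<Rightarrow> 'a \<Rightarrow> int \<Rightarrow> 'n fock \<Rightarrow> 'n fock" where
  "cartan_fock B S H m f = fock_scale (1 / complex_of_real (sqrt 2))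
     (\<Sum>j\<in>UNIV. fock_scale (B H (S j)) (heisenberg_series j m f))"

lemma V_linear_cartan_op: "V_linear (cartan_op B S H m)"
  unfolding cartan_op_def
  by (intro V_linear_scale_fun V_linear_sum_fun V_linear_on_fock fock_linear_heisenberg_series)

lemma fock_linear_cartan: "fock_linear (cartan_fock B S H m)"
  unfolding cartan_fock_def
  by (intro fock_linear_scale_fun fock_linear_sum_fun fock_linear_heisenberg_series)

lemma single_sum: "single k (sum F A) = (\<Sum>i\<in>A. single k (F i))"
  by (induction A rule: infinite_finite_induct) (simp_all add: single_add)

lemma cartan_op_single: "cartan_op B S H m (single c f) = single c (cartan_fock B S H m f)"
  by (simp add: cartan_op_def cartan_fock_def on_fock_single[OF fock_linear_heisenberg_series]
      single_sum flip: V_scale_single)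

lemma cartan_op_odd: "odd m \<Longrightarrow> cartan_op B S H m v = 0"
  by (simp add: cartan_op_def heisenberg_series_def on_fock_def)

abbreviation sqrt2 :: complex where "sqrt2 \<equiv> complex_of_real (sqrt 2)"

lemma sqrt2_square: "sqrt2 * sqrt2 = 2"
  by (simp flip: of_real_mult)

text \<open>The factor \<open>1 / \<surd>2\<close> of \<open>H(z)\<close> cancels the factor \<open>\<surd>2\<close> of the parameter of \<open>\<Gamma>\<^sub>\<alpha>(z)\<close>, which leaves
  \<open>(H|\<alpha>) z\<^sup>r\<close>, where \<open>r = -m - 1\<close>.\<close>

lemma cartan_fock_U:
  fixes S :: "'n::finite \<Rightarrow> 'a"
  shows "cartan_fock B S H m (U_series (\<lambda>j. sqrt2 * B \<alpha> (S j)) q f) =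
     U_series (\<lambda>j. sqrt2 * B \<alpha> (S j)) q (cartan_fock B S H m f) +
     (fock_scale (\<Sum>j\<in>UNIV. B H (S j) * B \<alpha> (S j)) (U_series (\<lambda>j. sqrt2 * B \<alpha> (S j)) (q + m + 1) f) when even m)"
proof (cases "even m")
  case True
  let ?l = "\<lambda>j. sqrt2 * B \<alpha> (S j)"
  have h: "heisenberg_series j m (U_series ?l q f) =
      U_series ?l q (heisenberg_series j m f) + fock_scale (?l j) (U_series ?l (q + m + 1) f)" for j
    using True heisenberg_U[of "- m - 1" j ?l q f] by (simp add: heisenberg_series_def algebra_simps)
  have "fock_scale (\<Sum>j\<in>UNIV. B H (S j) * B \<alpha> (S j)) g =
      fock_scale (1 / sqrt2) (\<Sum>j\<in>UNIV. fock_scale (B H (S j)) (fock_scale (?l j) g))" for g :: "'n fock"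
    by (rule poly_mapping_eqI) (simp add: lookup_sum sum_distrib_left sum_distrib_right field_simps)
  then show ?thesis using True
    by (simp add: cartan_fock_def h fock_scale_add sum.distrib fock_linear_scale[OF fock_linear_U]
        fock_linear_sum[OF fock_linear_U])
qed (simp add: cartan_fock_def heisenberg_series_def fock_linear_zero[OF fock_linear_U])

lemma cartan_fock_commutator:
  assumes "even m" "even m'"
  shows "cartan_fock B S H m (cartan_fock B S H' m' f) = cartan_fock B S H' m' (cartan_fock B S H m f) +
    (fock_scale (of_int (- m - 1) / 2 * (\<Sum>j\<in>UNIV. B H (S j) * B H' (S j))) f when m + m' = - 2)"
proof -
  have h: "heisenberg_series j m (heisenberg_series i m' f) = heisenberg_series i m' (heisenberg_series j m f) +
      (fock_scale (of_int (- m - 1)) f when i = j \<and> m + m' = - 2)" for i j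
    using heisenberg_heisenberg_series[of "- m - 1" j i m' f] assms
    by (auto simp: heisenberg_series_def when_def)
  note lin = fock_linear_heisenberg_series
  let ?c = "\<lambda>i j. B H (S j) * B H' (S i) / 2"
  have "cartan_fock B S H m (cartan_fock B S H' m' f) =
      (\<Sum>j\<in>UNIV. \<Sum>i\<in>UNIV. fock_scale (?c i j) (heisenberg_series j m (heisenberg_series i m' f)))"
    by (rule poly_mapping_eqI)
      (simp add: cartan_fock_def fock_linear_scale[OF lin] fock_linear_sum[OF lin] lookup_sum
        sum_distrib_left sqrt2_square[symmetric] field_simps)
  also have "\<dots> = (\<Sum>j\<in>UNIV. \<Sum>i\<in>UNIV. fock_scale (?c i j) (heisenberg_series i m' (heisenberg_series j m f)))
     + (\<Sum>j\<in>UNIV. \<Sum>i\<in>UNIV. fock_scale (?c i j) (fock_scale (of_int (- m - 1)) f when m + m' = - 2 when i = j))"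
    unfolding h by (simp only: fock_scale_add sum.distrib when_when conj_commute)
  also have "(\<Sum>j\<in>UNIV. \<Sum>i\<in>UNIV. fock_scale (?c i j) (heisenberg_series i m' (heisenberg_series j m f))) =
      cartan_fock B S H' m' (cartan_fock B S H m f)"
    by (subst sum.swap, rule poly_mapping_eqI)
      (simp add: cartan_fock_def fock_linear_scale[OF lin] fock_linear_sum[OF lin] lookup_sum
        sum_distrib_left sqrt2_square[symmetric] field_simps)
  also have "(\<Sum>j\<in>UNIV. \<Sum>i\<in>UNIV. fock_scale (?c i j) (fock_scale (of_int (- m - 1)) f when m + m' = - 2 when i = j))
     = (\<Sum>j\<in>UNIV. fock_scale (?c j j) (fock_scale (of_int (- m - 1)) f when m + m' = - 2))"
  proof (rule sum.cong[OF refl])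
    fix j
    have "fock_scale (?c i j) (fock_scale (of_int (- m - 1)) f when m + m' = - 2 when i = j) =
      (if i = j then fock_scale (?c j j) (fock_scale (of_int (- m - 1)) f when m + m' = - 2) else 0)" for i
      by auto
    then show "(\<Sum>i\<in>UNIV. fock_scale (?c i j) (fock_scale (of_int (- m - 1)) f when m + m' = - 2 when i = j))
     = fock_scale (?c j j) (fock_scale (of_int (- m - 1)) f when m + m' = - 2)" by simp
  qed
  also have "\<dots> = (fock_scale (of_int (- m - 1) / 2 * (\<Sum>j\<in>UNIV. B H (S j) * B H' (S j))) f when m + m' = - 2)"
    by (rule poly_mapping_eqI)
      (simp add: when_def lookup_sum sum_distrib_left sum_distrib_right field_simps)
  finally show ?thesis .
qed

lemma energy_cartan_fock:
  assumes "even m"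
  shows "energy (cartan_fock B S H m f) = cartan_fock B S H m (energy f) +
    fock_scale (of_int (m + 1)) (cartan_fock B S H m f)"
proof -
  have "energy (heisenberg_series j m f) = heisenberg_series j m (energy f) +
      fock_scale (of_int (m + 1)) (heisenberg_series j m f)" for j
  proof -
    have "energy (heisenberg_series j m f) =
        heisenberg_series j m (energy f) - fock_scale (of_int (- m - 1)) (heisenberg_series j m f)"
      using energy_heisenberg[of "- m - 1" j f] assms by (simp only: heisenberg_series_def Let_def) simp
    then show ?thesis
      by (simp only:) (auto simp: lookup_add lookup_minus algebra_simps intro!: poly_mapping_eqI)
  qed
  then show ?thesis
    by (auto intro!: poly_mapping_eqI
        simp: cartan_fock_def fock_linear_scale[OF fock_linear_energy] fock_linear_sum[OF fock_linear_energy]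
          lookup_sum lookup_add sum.distrib sum_distrib_left add_divide_distrib algebra_simps)
qed

section \<open>Relations between the vertex operators\<close>

text \<open>Only the class modulo \<open>2Q\<close> matters; in particular \<open>-\<alpha> + \<gamma>\<close> and \<open>\<alpha> + \<gamma>\<close> define the same coset.\<close>

lemma coset_double:
  assumes "\<beta> \<in> root_lattice \<hh> B"
  shows "coset (root_lattice \<hh> B) (\<gamma> + (\<beta> + \<beta>)) = coset (root_lattice \<hh> B) \<gamma>"
proof -
  let ?Q = "root_lattice \<hh> B"
  have sub: "coset ?Q (\<gamma> + (\<beta> + \<beta>)) \<subseteq> coset ?Q \<gamma>" if "\<beta> \<in> ?Q" for \<beta> \<gamma>
  proof
    fix x assume "x \<in> coset ?Q (\<gamma> + (\<beta> + \<beta>))"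
    then obtain \<delta> where "x = \<gamma> + (\<beta> + \<beta>) + (\<delta> + \<delta>)" "\<delta> \<in> ?Q" unfolding coset_def by blast
    then have "x = \<gamma> + ((\<beta> + \<delta>) + (\<beta> + \<delta>))" "\<beta> + \<delta> \<in> ?Q"
      using that by (simp_all add: root_lattice_add algebra_simps)
    then show "x \<in> coset ?Q \<gamma>" unfolding coset_def by blast
  qed
  have "coset ?Q \<gamma> \<subseteq> coset ?Q (\<gamma> + (\<beta> + \<beta>))"
    using sub[OF root_lattice_minus[OF assms], of "\<gamma> + (\<beta> + \<beta>)"] by (simp add: algebra_simps)
  then show ?thesis using sub[OF assms] by blast
qed

context simply_laced
begin

lemma Q_nonempty: "Q \<noteq> {}"
  using root_lattice.zero by blast

lemma \<nu>_sign: "\<alpha> \<in> Q \<Longrightarrow> \<beta> \<in> Q \<Longrightarrow> \<nu> \<alpha> \<beta> = 1 \<or> \<nu> \<alpha> \<beta> = - 1"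
  and \<nu>_add_left: "\<alpha> \<in> Q \<Longrightarrow> \<beta> \<in> Q \<Longrightarrow> \<gamma> \<in> Q \<Longrightarrow> \<nu> (\<alpha> + \<beta>) \<gamma> = \<nu> \<alpha> \<gamma> * \<nu> \<beta> \<gamma>"
  and \<nu>_add_right: "\<alpha> \<in> Q \<Longrightarrow> \<beta> \<in> Q \<Longrightarrow> \<gamma> \<in> Q \<Longrightarrow> \<nu> \<alpha> (\<beta> + \<gamma>) = \<nu> \<alpha> \<beta> * \<nu> \<alpha> \<gamma>"
  and \<nu>_self: "\<alpha> \<in> Q \<Longrightarrow> \<nu> \<alpha> \<alpha> = (-1) powr (B \<alpha> \<alpha> / 2)"
  and \<nu>_commute: "\<alpha> \<in> Q \<Longrightarrow> \<beta> \<in> Q \<Longrightarrow> \<nu> \<alpha> \<beta> = (-1) powr (B \<alpha> \<beta>) * \<nu> \<beta> \<alpha>"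
  using asymmetry unfolding asymmetry_function_def by blast+

lemma \<nu>_square: "\<alpha> \<in> Q \<Longrightarrow> \<beta> \<in> Q \<Longrightarrow> \<nu> \<alpha> \<beta> * \<nu> \<alpha> \<beta> = 1"
  using \<nu>_sign[of \<alpha> \<beta>] by auto

lemma \<nu>_minus_left:
  assumes "\<alpha> \<in> Q" "\<beta> \<in> Q"
  shows "\<nu> (- \<alpha>) \<beta> = \<nu> \<alpha> \<beta>"
proof -
  have m: "- \<alpha> \<in> Q" using root_lattice_minus[OF assms(1)] .
  have z: "0 \<in> Q" by (rule root_lattice.zero)
  have "\<nu> 0 \<beta> = \<nu> 0 \<beta> * \<nu> 0 \<beta>" using \<nu>_add_left[OF z z assms(2)] by simp
  then have "\<nu> 0 \<beta> = 1" using \<nu>_square[OF z assms(2)] by simp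
  then have "\<nu> \<alpha> \<beta> * \<nu> (- \<alpha>) \<beta> = \<nu> \<alpha> \<beta> * \<nu> \<alpha> \<beta>"
    using \<nu>_add_left[OF assms(1) m assms(2)] \<nu>_square[OF assms] by simp
  then show ?thesis using \<nu>_square[OF assms] by (metis mult_left_cancel mult_zero_left zero_neq_one)
qed

lemma \<nu>_minus_right:
  assumes "\<alpha> \<in> Q" "\<beta> \<in> Q"
  shows "\<nu> \<alpha> (- \<beta>) = \<nu> \<alpha> \<beta>"
proof -
  have m: "- \<beta> \<in> Q" using root_lattice_minus[OF assms(2)] .
  have z: "0 \<in> Q" by (rule root_lattice.zero)
  have "\<nu> \<alpha> 0 = \<nu> \<alpha> 0 * \<nu> \<alpha> 0" using \<nu>_add_right[OF assms(1) z z] by simp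
  then have "\<nu> \<alpha> 0 = 1" using \<nu>_square[OF assms(1) z] by simp
  then have "\<nu> \<alpha> \<beta> * \<nu> \<alpha> (- \<beta>) = \<nu> \<alpha> \<beta> * \<nu> \<alpha> \<beta>"
    using \<nu>_add_right[OF assms(1,2) m] \<nu>_square[OF assms] by simp
  then show ?thesis using \<nu>_square[OF assms] by (metis mult_left_cancel mult_zero_left zero_neq_one)
qed

lemma \<nu>_root_self: "\<alpha> \<in> \<Delta> \<Longrightarrow> \<nu> \<alpha> \<alpha> = - 1"
  using \<nu>_self[OF root_in_lattice] by (simp add: root_norm)

lemma \<nu>_symmetric: "\<alpha> \<in> Q \<Longrightarrow> \<beta> \<in> Q \<Longrightarrow> B \<alpha> \<beta> = 0 \<Longrightarrow> \<nu> \<alpha> \<beta> = \<nu> \<beta> \<alpha>"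
  using \<nu>_commute[of \<alpha> \<beta>] by simp

lemma \<nu>_antisymmetric: "\<alpha> \<in> Q \<Longrightarrow> \<beta> \<in> Q \<Longrightarrow> B \<alpha> \<beta> = - 1 \<Longrightarrow> \<nu> \<alpha> \<beta> = - \<nu> \<beta> \<alpha>"
  using \<nu>_commute[of \<alpha> \<beta>] by (simp add: powr_minus)

abbreviation weight :: "'a \<Rightarrow> 'n \<Rightarrow> complex" where
  "weight \<alpha> \<equiv> (\<lambda>j. sqrt2 * B \<alpha> (S j))"

abbreviation \<Gamma> :: "'a \<Rightarrow> int \<Rightarrow> ('a, 'n) vertex \<Rightarrow> ('a, 'n) vertex" where
  "\<Gamma> \<equiv> \<Gamma>_series B \<nu> S"

abbreviation cartan :: "'a \<Rightarrow> int \<Rightarrow> ('a, 'n) vertex \<Rightarrow> ('a, 'n) vertex" where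
  "cartan \<equiv> cartan_op B S"

lemma \<Gamma>_single:
  "\<alpha> \<in> \<Delta> \<Longrightarrow> \<gamma> \<in> Q \<Longrightarrow> \<Gamma> \<alpha> m (single (coset Q \<gamma>) f) =
     single (coset Q (\<alpha> + \<gamma>)) (fock_scale (1 / 2 * \<nu> \<alpha> \<gamma>) (U_series (weight \<alpha>) m f))"
  by (rule \<Gamma>_series_single[OF asymmetry root_in_lattice])

lemma \<Gamma>_in_V_space: "\<alpha> \<in> \<Delta> \<Longrightarrow> v \<in> V_space Q \<Longrightarrow> \<Gamma> \<alpha> m v \<in> V_space Q"
  by (rule V_linear_in_V_space[OF _ Q_nonempty V_linear_\<Gamma>])
    (simp_all add: \<Gamma>_single V_space_single root_lattice_add root_in_lattice)

lemma cartan_in_V_space: "v \<in> V_space Q \<Longrightarrow> cartan H m v \<in> V_space Q"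
  by (rule V_linear_in_V_space[OF _ Q_nonempty V_linear_cartan_op])
    (simp_all add: cartan_op_single V_space_single)

lemma energy_in_V_space: "v \<in> V_space Q \<Longrightarrow> on_fock energy v \<in> V_space Q"
  by (rule V_linear_in_V_space[OF _ Q_nonempty V_linear_on_fock[OF fock_linear_energy]])
    (simp_all add: on_fock_single fock_linear_energy V_space_single)

text \<open>Bimultiplicativity of \<open>\<nu>\<close> collects the two signs \<open>\<nu>(\<alpha>, \<beta> + \<gamma>) \<nu>(\<beta>, \<gamma>)\<close> into \<open>\<nu>(\<alpha>, \<beta>) \<nu>(\<alpha> + \<beta>, \<gamma>)\<close>; exchanging the
  two operators affects only the first of these factors.\<close>

lemma \<Gamma>_\<Gamma>_single:
  assumes "\<alpha> \<in> \<Delta>" "\<beta> \<in> \<Delta>" "\<gamma> \<in> Q"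
  shows "\<Gamma> \<alpha> p (\<Gamma> \<beta> q (single (coset Q \<gamma>) f)) = single (coset Q (\<alpha> + \<beta> + \<gamma>))
    (fock_scale (1 / 4 * \<nu> \<alpha> \<beta> * \<nu> (\<alpha> + \<beta>) \<gamma>) (U_series (weight \<alpha>) p (U_series (weight \<beta>) q f)))"
  using assms
  by (simp add: \<Gamma>_single root_lattice_add root_in_lattice fock_linear_scale[OF fock_linear_U]
      \<nu>_add_left \<nu>_add_right add.assoc mult_ac)

text \<open>That is, \<open>\<Gamma>\<^sub>-\<^sub>\<alpha>(z) = \<Gamma>\<^sub>\<alpha>(-z)\<close>. It matches the symmetry of the generators under
  \<open>\<alpha> \<mapsto> -\<alpha>\<close> and reduces the case \<open>(\<alpha>|\<beta>) > 0\<close> of the commutators to the case \<open>(\<alpha>|\<beta>) < 0\<close>.\<close>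

lemma \<Gamma>_uminus:
  assumes \<alpha>: "\<alpha> \<in> \<Delta>" and v: "v \<in> V_space Q"
  shows "\<Gamma> (- \<alpha>) m v = V_scale ((-1) powi m) (\<Gamma> \<alpha> m v)"
proof (rule V_linear_eqI[OF v Q_nonempty V_linear_\<Gamma> V_linear_scale_fun[OF V_linear_\<Gamma>]])
  fix \<gamma> f assume \<gamma>: "\<gamma> \<in> Q"
  have "coset Q (- \<alpha> + \<gamma>) = coset Q (\<alpha> + \<gamma>)"
    using coset_double[of \<alpha> \<hh> B "- \<alpha> + \<gamma>"] root_in_lattice[OF \<alpha>] by (simp add: algebra_simps)
  then show "\<Gamma> (- \<alpha>) m (single (coset Q \<gamma>) f) = V_scale ((-1) powi m) (\<Gamma> \<alpha> m (single (coset Q \<gamma>) f))"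
    using U_uminus[of "weight \<alpha>" m f] \<alpha> \<gamma>
    by (simp add: \<Gamma>_single uminus_root \<nu>_minus_left root_in_lattice mult_ac)
qed

lemma weight_product:
  assumes "\<alpha> \<in> \<Delta>" "\<beta> \<in> \<Delta>"
  shows "(\<Sum>j\<in>UNIV. weight \<alpha> j * weight \<beta> j) = 2 * B \<alpha> \<beta>"
proof -
  have "weight \<alpha> j * weight \<beta> j = 2 * (B \<alpha> (S j) * B \<beta> (S j))" for j
  proof -
    have "weight \<alpha> j * weight \<beta> j = (sqrt2 * sqrt2) * (B \<alpha> (S j) * B \<beta> (S j))" by (simp only: mult_ac)
    then show ?thesis by (simp only: sqrt2_square)
  qed
  then show ?thesis
    unfolding inner_expansion[OF root_in_cartan[OF assms(2)], of \<alpha>] by (simp only: sum_distrib_left)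
qed

lemma \<Gamma>_commute:
  assumes "\<alpha> \<in> \<Delta>" "\<beta> \<in> \<Delta>" "B \<alpha> \<beta> = 0" "v \<in> V_space Q"
  shows "\<Gamma> \<alpha> p (\<Gamma> \<beta> q v) - \<Gamma> \<beta> q (\<Gamma> \<alpha> p v) = 0"
proof (rule V_linear_eqI[OF assms(4) Q_nonempty _ V_linear_zero_fun])
  show "V_linear (\<lambda>v. \<Gamma> \<alpha> p (\<Gamma> \<beta> q v) - \<Gamma> \<beta> q (\<Gamma> \<alpha> p v))"
    by (intro V_linear_diff_fun V_linear_compose[OF V_linear_\<Gamma> V_linear_\<Gamma>])
  fix \<gamma> f assume "\<gamma> \<in> Q"
  then show "\<Gamma> \<alpha> p (\<Gamma> \<beta> q (single (coset Q \<gamma>) f)) - \<Gamma> \<beta> q (\<Gamma> \<alpha> p (single (coset Q \<gamma>) f)) = 0"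
    using assms U_commute[of "weight \<alpha>" "weight \<beta>" p q f] weight_product[OF assms(1,2)]
      \<nu>_symmetric[of \<alpha> \<beta>]
    by (simp add: \<Gamma>_\<Gamma>_single root_in_lattice add.commute[of \<beta>])
qed

text \<open>Here \<open>\<nu>(\<beta>, \<alpha>) = -\<nu>(\<alpha>, \<beta>)\<close>, so the commutator of the operators \<open>\<Gamma>\<close> is governed by the
  anticommutator of the operators \<open>U\<close>.\<close>

lemma \<Gamma>_commutator_add:
  assumes "\<alpha> \<in> \<Delta>" "\<beta> \<in> \<Delta>" "B \<alpha> \<beta> = - 1" "v \<in> V_space Q"
  shows "\<Gamma> \<alpha> p (\<Gamma> \<beta> q v) - \<Gamma> \<beta> q (\<Gamma> \<alpha> p v) = V_scale (\<nu> \<alpha> \<beta>) (\<Gamma> (\<alpha> + \<beta>) (p + q) v)"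
proof (rule V_linear_eqI[OF assms(4) Q_nonempty _ V_linear_scale_fun[OF V_linear_\<Gamma>]])
  show "V_linear (\<lambda>v. \<Gamma> \<alpha> p (\<Gamma> \<beta> q v) - \<Gamma> \<beta> q (\<Gamma> \<alpha> p v))"
    by (intro V_linear_diff_fun V_linear_compose[OF V_linear_\<Gamma> V_linear_\<Gamma>])
  fix \<gamma> f assume \<gamma>: "\<gamma> \<in> Q"
  let ?c = "1 / 4 * \<nu> \<alpha> \<beta> * \<nu> (\<alpha> + \<beta>) \<gamma>" and ?\<gamma> = "coset Q (\<alpha> + \<beta> + \<gamma>)"
  have w: "(\<lambda>j. weight \<alpha> j + weight \<beta> j) = weight (\<alpha> + \<beta>)" by (simp add: distrib_left)
  have "\<Gamma> \<alpha> p (\<Gamma> \<beta> q (single (coset Q \<gamma>) f)) - \<Gamma> \<beta> q (\<Gamma> \<alpha> p (single (coset Q \<gamma>) f)) =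
      single ?\<gamma> (fock_scale ?c (U_series (weight \<alpha>) p (U_series (weight \<beta>) q f))) -
      single ?\<gamma> (fock_scale (- ?c) (U_series (weight \<beta>) q (U_series (weight \<alpha>) p f)))"
    using assms \<gamma> \<nu>_antisymmetric[of \<alpha> \<beta>] by (simp add: \<Gamma>_\<Gamma>_single root_in_lattice add.commute[of \<beta>])
  also have "\<dots> = single ?\<gamma> (fock_scale ?c (U_series (weight \<alpha>) p (U_series (weight \<beta>) q f) +
      U_series (weight \<beta>) q (U_series (weight \<alpha>) p f)))"
    unfolding single_diff[symmetric] by (rule arg_cong[where f = "single ?\<gamma>"], rule poly_mapping_eqI)
      (simp add: lookup_add lookup_minus algebra_simps)
  also have "\<dots> = V_scale (\<nu> \<alpha> \<beta>) (\<Gamma> (\<alpha> + \<beta>) (p + q) (single (coset Q \<gamma>) f))"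
    using U_anticommutator[of "weight \<alpha>" "weight \<beta>" p q f] weight_product[OF assms(1,2)] assms(3)
      add_root_if_inner_minus_1[OF assms(1-3)] \<gamma>
    unfolding w by (simp add: \<Gamma>_single)
  finally show "\<Gamma> \<alpha> p (\<Gamma> \<beta> q (single (coset Q \<gamma>) f)) - \<Gamma> \<beta> q (\<Gamma> \<alpha> p (single (coset Q \<gamma>) f)) =
      V_scale (\<nu> \<alpha> \<beta>) (\<Gamma> (\<alpha> + \<beta>) (p + q) (single (coset Q \<gamma>) f))" .
qed

text \<open>The sign is \<open>\<nu>(\<alpha>, -\<alpha>) = \<nu>(\<alpha>, \<alpha>) = -1\<close>, and \<open>e\<^sup>\<alpha> e\<^sup>-\<^sup>\<alpha> = 1\<close>.\<close>

lemma \<Gamma>_commutator_opposite: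
  assumes \<alpha>: "\<alpha> \<in> \<Delta>" and v: "v \<in> V_space Q"
  shows "\<Gamma> \<alpha> p (\<Gamma> (- \<alpha>) q v) - \<Gamma> (- \<alpha>) q (\<Gamma> \<alpha> p v) =
    V_scale (- 2) (cartan \<alpha> (p + q - 1) v) + (V_scale (of_int p) v when p + q = 0)"
proof (rule V_linear_eqI[OF v Q_nonempty])
  show "V_linear (\<lambda>v. \<Gamma> \<alpha> p (\<Gamma> (- \<alpha>) q v) - \<Gamma> (- \<alpha>) q (\<Gamma> \<alpha> p v))"
    by (intro V_linear_diff_fun V_linear_compose[OF V_linear_\<Gamma> V_linear_\<Gamma>])
  show "V_linear (\<lambda>v. V_scale (- 2) (cartan \<alpha> (p + q - 1) v) + (V_scale (of_int p) v when p + q = 0))"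
    by (intro V_linear_add_fun V_linear_scale_fun V_linear_cartan_op V_linear_when V_linear_id)
  fix \<gamma> f assume \<gamma>: "\<gamma> \<in> Q"
  note Q = root_in_lattice[OF \<alpha>] root_in_lattice[OF uminus_root[OF \<alpha>]]
  have \<nu>1: "\<nu> 0 \<gamma> = 1"
    using \<nu>_add_left[OF Q \<gamma>] \<nu>_minus_left[OF Q(1) \<gamma>] \<nu>_square[OF Q(1) \<gamma>] by simp
  have \<nu>2: "\<nu> \<alpha> (- \<alpha>) = - 1" "\<nu> (- \<alpha>) \<alpha> = - 1"
    using \<nu>_minus_right[OF Q(1) Q(1)] \<nu>_minus_left[OF Q(1) Q(1)] \<nu>_root_self[OF \<alpha>] by simp_all
  have "\<Gamma> \<alpha> p (\<Gamma> (- \<alpha>) q (single (coset Q \<gamma>) f)) - \<Gamma> (- \<alpha>) q (\<Gamma> \<alpha> p (single (coset Q \<gamma>) f)) =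
      single (coset Q \<gamma>) (fock_scale (- 1 / 4) (U_series (weight \<alpha>) p (U_series (\<lambda>j. - weight \<alpha> j) q f) -
        U_series (\<lambda>j. - weight \<alpha> j) q (U_series (weight \<alpha>) p f)))"
    using \<alpha> \<gamma> uminus_root[OF \<alpha>] by (simp add: \<Gamma>_\<Gamma>_single \<nu>1 \<nu>2 fock_scale_diff single_diff)
  also have "\<dots> = single (coset Q \<gamma>) (fock_scale (- 1)
      ((\<Sum>j\<in>UNIV. fock_scale (weight \<alpha> j) (heisenberg_series j (p + q - 1) f)) -
      (fock_scale (of_int p) f when p + q = 0)))"
    using weight_product[OF \<alpha> \<alpha>] by (subst U_opposite_commutator) (simp_all add: root_norm[OF \<alpha>])
  also have "(\<Sum>j\<in>UNIV. fock_scale (weight \<alpha> j) (heisenberg_series j (p + q - 1) f)) =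
      fock_scale 2 (cartan_fock B S \<alpha> (p + q - 1) f)"
    by (rule poly_mapping_eqI)
      (simp add: cartan_fock_def lookup_sum sum_distrib_left sqrt2_square[symmetric] field_simps)
  also have "fock_scale (- 1) (fock_scale 2 (cartan_fock B S \<alpha> (p + q - 1) f) - (fock_scale (of_int p) f when p + q = 0)) =
      fock_scale (- 2) (cartan_fock B S \<alpha> (p + q - 1) f) + (fock_scale (of_int p) f when p + q = 0)"
    by (rule poly_mapping_eqI) (simp add: lookup_add lookup_minus)
  finally show "\<Gamma> \<alpha> p (\<Gamma> (- \<alpha>) q (single (coset Q \<gamma>) f)) - \<Gamma> (- \<alpha>) q (\<Gamma> \<alpha> p (single (coset Q \<gamma>) f)) =
      V_scale (- 2) (cartan \<alpha> (p + q - 1) (single (coset Q \<gamma>) f)) +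
      (V_scale (of_int p) (single (coset Q \<gamma>) f) when p + q = 0)"
    by (simp add: cartan_op_single when_def single_add)
qed

lemma cartan_\<Gamma>_commutator:
  assumes \<alpha>: "\<alpha> \<in> \<Delta>" and v: "v \<in> V_space Q"
  shows "cartan H m (\<Gamma> \<alpha> q v) - \<Gamma> \<alpha> q (cartan H m v) =
    (V_scale (B H \<alpha>) (\<Gamma> \<alpha> (q + m + 1) v) when even m)"
proof (rule V_linear_eqI[OF v Q_nonempty])
  show "V_linear (\<lambda>v. cartan H m (\<Gamma> \<alpha> q v) - \<Gamma> \<alpha> q (cartan H m v))"
    by (intro V_linear_diff_fun V_linear_compose[OF V_linear_\<Gamma> V_linear_cartan_op]
        V_linear_compose[OF V_linear_cartan_op V_linear_\<Gamma>])
  show "V_linear (\<lambda>v. V_scale (B H \<alpha>) (\<Gamma> \<alpha> (q + m + 1) v) when even m)"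
    by (intro V_linear_when V_linear_scale_fun V_linear_\<Gamma>)
  fix \<gamma> f assume \<gamma>: "\<gamma> \<in> Q"
  show "cartan H m (\<Gamma> \<alpha> q (single (coset Q \<gamma>) f)) - \<Gamma> \<alpha> q (cartan H m (single (coset Q \<gamma>) f)) =
      (V_scale (B H \<alpha>) (\<Gamma> \<alpha> (q + m + 1) (single (coset Q \<gamma>) f)) when even m)"
    unfolding \<Gamma>_single[OF \<alpha> \<gamma>] cartan_op_single fock_linear_scale[OF fock_linear_cartan]
      cartan_fock_U inner_expansion[OF root_in_cartan[OF \<alpha>], symmetric] V_scale_single single_diff[symmetric]
    by (cases "even m") (simp_all add: fock_scale_add mult.commute)
qed

lemma cartan_cartan_commutator:
  assumes "H' \<in> \<hh>" and v: "v \<in> V_space Q" and "even m" "even m'"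
  shows "cartan H m (cartan H' m' v) - cartan H' m' (cartan H m v) =
    (V_scale (of_int (- m - 1) / 2 * B H H') v when m + m' = - 2)"
proof (rule V_linear_eqI[OF v Q_nonempty])
  show "V_linear (\<lambda>v. cartan H m (cartan H' m' v) - cartan H' m' (cartan H m v))"
    by (intro V_linear_diff_fun V_linear_compose[OF V_linear_cartan_op V_linear_cartan_op])
  show "V_linear (\<lambda>v. V_scale (of_int (- m - 1) / 2 * B H H') v when m + m' = - 2)"
    by (intro V_linear_when V_linear_scale_fun V_linear_id)
  show "cartan H m (cartan H' m' (single (coset Q \<gamma>) f)) - cartan H' m' (cartan H m (single (coset Q \<gamma>) f)) =
      (V_scale (of_int (- m - 1) / 2 * B H H') (single (coset Q \<gamma>) f) when m + m' = - 2)" for \<gamma> f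
    using cartan_fock_commutator[OF assms(3,4), of B S H H' f] inner_expansion[OF assms(1), of H]
    by (simp add: cartan_op_single when_def flip: single_diff)
qed

lemma energy_\<Gamma>_commutator:
  assumes \<alpha>: "\<alpha> \<in> \<Delta>" and v: "v \<in> V_space Q"
  shows "on_fock energy (\<Gamma> \<alpha> m v) - \<Gamma> \<alpha> m (on_fock energy v) = V_scale (of_int m) (\<Gamma> \<alpha> m v)"
proof (rule V_linear_eqI[OF v Q_nonempty _ V_linear_scale_fun[OF V_linear_\<Gamma>]])
  note E = V_linear_on_fock[OF fock_linear_energy]
  show "V_linear (\<lambda>v. on_fock energy (\<Gamma> \<alpha> m v) - \<Gamma> \<alpha> m (on_fock energy v))"
    by (intro V_linear_diff_fun V_linear_compose[OF V_linear_\<Gamma> E] V_linear_compose[OF E V_linear_\<Gamma>])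
  fix \<gamma> f assume \<gamma>: "\<gamma> \<in> Q"
  show "on_fock energy (\<Gamma> \<alpha> m (single (coset Q \<gamma>) f)) - \<Gamma> \<alpha> m (on_fock energy (single (coset Q \<gamma>) f)) =
      V_scale (of_int m) (\<Gamma> \<alpha> m (single (coset Q \<gamma>) f))"
    unfolding \<Gamma>_single[OF \<alpha> \<gamma>] on_fock_single[OF fock_linear_energy] fock_linear_scale[OF fock_linear_energy]
      energy_U V_scale_single single_diff[symmetric]
    by (simp add: fock_scale_add mult.commute)
qed

lemma energy_cartan_commutator:
  assumes v: "v \<in> V_space Q" and "even m"
  shows "on_fock energy (cartan H m v) - cartan H m (on_fock energy v) = V_scale (of_int (m + 1)) (cartan H m v)"
proof (rule V_linear_eqI[OF v Q_nonempty _ V_linear_scale_fun[OF V_linear_cartan_op]])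
  note E = V_linear_on_fock[OF fock_linear_energy]
  show "V_linear (\<lambda>v. on_fock energy (cartan H m v) - cartan H m (on_fock energy v))"
    by (intro V_linear_diff_fun V_linear_compose[OF V_linear_cartan_op E] V_linear_compose[OF E V_linear_cartan_op])
  show "on_fock energy (cartan H m (single (coset Q \<gamma>) f)) - cartan H m (on_fock energy (single (coset Q \<gamma>) f)) =
      V_scale (of_int (m + 1)) (cartan H m (single (coset Q \<gamma>) f))" for \<gamma> f
    by (simp add: cartan_op_single on_fock_single fock_linear_energy energy_cartan_fock[OF assms(2)] flip: single_diff)
qed

end

section \<open>Generators of the twisted affine Lie algebra\<close>

lemma lookup_map_cscale [simp]: "lookup (Poly_Mapping.map (cscale c) u) j = c *\<^sub>C lookup u j"
  by (simp add: map.rep_eq when_def)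

lemma affine_scale_Pair [simp]: "affine_scale c (u, a, b) = (Poly_Mapping.map (cscale c) u, c * a, c * b)"
  by (simp add: affine_scale_def)

lemma affine_scale_one [simp]: "affine_scale 1 x = x"
  and affine_scale_0 [simp]: "affine_scale c 0 = 0"
  and affine_scale_zero [simp]: "affine_scale 0 x = 0"
  and affine_scale_minus_one: "affine_scale (- 1) x = - x"
  and affine_scale_affine_scale [simp]: "affine_scale c (affine_scale d x) = affine_scale (c * d) x"
  by (cases x; auto simp: zero_prod_def intro!: poly_mapping_eqI)+

lemma mode_combination: "mode (c *\<^sub>C x + y) j = affine_scale c (mode x j) + mode y j"
  by (auto simp: mode_def lookup_single lookup_add when_def intro!: poly_mapping_eqI)

lemma mode_zero [simp]: "mode 0 j = 0"
  by (simp add: mode_def zero_prod_def)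

lemma mode_scale: "mode (c *\<^sub>C x) j = affine_scale c (mode x j)"
  using mode_combination[of c x 0 j] by simp

context simply_laced
begin

abbreviation "L \<equiv> twisted_affine \<sigma>"
abbreviation "bracket \<equiv> affine_bracket B"
abbreviation "V \<equiv> V_space Q :: ('a, 'n) vertex set"

text \<open>Summing over common finite index sets makes bilinearity a termwise statement.\<close>

lemma bracket_superset:
  assumes J: "finite J" "keys u \<subseteq> J" and K: "finite K" "keys v \<subseteq> K"
  shows "bracket (u, a, b) (v, a', b') =
     ((\<Sum>j\<in>J. \<Sum>k\<in>K. single (j + k) (lie (lookup u j) (lookup v k)))
        + (\<Sum>k\<in>K. single k ((b * of_int k) *\<^sub>C lookup v k))
        - (\<Sum>j\<in>J. single j ((b' * of_int j) *\<^sub>C lookup u j)),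
      (\<Sum>j\<in>J. \<Sum>k\<in>K. (of_int j / 2 * B (lookup u j) (lookup v k) when j + k = 0)),
      0)"
proof -
  have 1: "(\<Sum>j\<in>keys u. \<Sum>k\<in>keys v. f j k) = (\<Sum>j\<in>J. \<Sum>k\<in>K. f j k)"
    if "\<And>j k. lookup u j = 0 \<or> lookup v k = 0 \<Longrightarrow> f j k = 0" for f :: "int \<Rightarrow> int \<Rightarrow> 'z::comm_monoid_add"
  proof -
    have "(\<Sum>j\<in>keys u. \<Sum>k\<in>keys v. f j k) = (\<Sum>j\<in>keys u. \<Sum>k\<in>K. f j k)"
      using K that by (intro sum.cong refl sum.mono_neutral_left) (auto simp: in_keys_iff)
    also have "\<dots> = (\<Sum>j\<in>J. \<Sum>k\<in>K. f j k)"
      using J that by (intro sum.mono_neutral_left) (auto simp: in_keys_iff)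
    finally show ?thesis .
  qed
  have 2: "(\<Sum>k\<in>keys v. single k (c k *\<^sub>C lookup v k)) = (\<Sum>k\<in>K. single k (c k *\<^sub>C lookup v k))"
    and 3: "(\<Sum>j\<in>keys u. single j (c j *\<^sub>C lookup u j)) = (\<Sum>j\<in>J. single j (c j *\<^sub>C lookup u j))" for c
    using J K by (auto intro!: sum.mono_neutral_left simp: in_keys_iff)
  have 4: "(\<Sum>j\<in>keys u. \<Sum>k\<in>keys v. single (j + k) (lie (lookup u j) (lookup v k))) =
      (\<Sum>j\<in>J. \<Sum>k\<in>K. single (j + k) (lie (lookup u j) (lookup v k)))"
    by (rule 1) auto
  have 5: "(\<Sum>j\<in>keys u. \<Sum>k\<in>keys v. (of_int j / 2 * B (lookup u j) (lookup v k) when j + k = 0)) =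
      (\<Sum>j\<in>J. \<Sum>k\<in>K. (of_int j / 2 * B (lookup u j) (lookup v k) when j + k = 0))"
    by (rule 1) auto
  show ?thesis
    unfolding affine_bracket_def case_prod_conv 2 3 4 5 ..
qed

lemma cscale_when: "(c *\<^sub>C x when P) = c *\<^sub>C (x when P)"
  by (cases P) simp_all

lemma bracket_combination_left:
  "bracket (affine_scale c x + x') y = affine_scale c (bracket x y) + bracket x' y"
proof -
  obtain u a b u' a' b' v d e where x: "x = (u, a, b)" "x' = (u', a', b')" "y = (v, d, e)"
    by (metis prod_cases3)
  let ?J = "keys u \<union> keys u'" and ?u = "Poly_Mapping.map (cscale c) u + u'"
  have "keys ?u \<subseteq> ?J" by (auto simp: in_keys_iff lookup_add)
  then have "bracket (?u, c * a + a', c * b + b') (v, d, e) =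
      affine_scale c (bracket (u, a, b) (v, d, e)) + bracket (u', a', b') (v, d, e)"
    by (auto simp: bracket_superset[of ?J _ "keys v"] lookup_add lookup_minus lookup_sum lookup_single
        lie_add_left lie_cscale_left cscale_add_right cscale_add_left sum.distrib cvs.scale_sum_right
        cvs.scale_right_diff_distrib cscale_when when_add_distrib sum_distrib_left mult_when algebra_simps
        intro!: poly_mapping_eqI)
  then show ?thesis unfolding x by simp
qed

lemma bracket_commute: "bracket y x = - bracket x y"
proof -
  obtain u a b v d e where x: "x = (u, a, b)" "y = (v, d, e)" by (metis prod_cases3)
  have 1: "(\<Sum>k\<in>keys v. \<Sum>j\<in>keys u. single (k + j) (lie (lookup v k) (lookup u j))) =
     - (\<Sum>j\<in>keys u. \<Sum>k\<in>keys v. single (j + k) (lie (lookup u j) (lookup v k)))"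
    by (subst sum.swap) (simp add: add.commute lie_commute[of "lookup v _"] single_uminus sum_negf)
  have 2: "(\<Sum>k\<in>keys v. \<Sum>j\<in>keys u. (of_int k / 2 * B (lookup v k) (lookup u j) when k + j = 0)) =
      - (\<Sum>j\<in>keys u. \<Sum>k\<in>keys v. (of_int j / 2 * B (lookup u j) (lookup v k) when j + k = 0))"
  proof -
    have "(of_int k / 2 * B (lookup v k) (lookup u j) when k + j = 0) =
        - (of_int j / 2 * B (lookup u j) (lookup v k) when j + k = 0)" for j k
      by (auto simp: when_def B_commute[of "lookup v _"] add_eq_0_iff2)
    then show ?thesis by (subst sum.swap) (simp only: sum_negf)
  qed
  show ?thesis unfolding x affine_bracket_def case_prod_conv 1 2 by simp
qed

lemma bracket_zero [simp]: "bracket 0 y = 0" "bracket y 0 = 0"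
  using bracket_combination_left[of "- 1" 0 0 y] bracket_commute[of y 0]
  by (simp_all add: affine_scale_minus_one)

lemma bracket_mode_mode:
  "bracket (mode x j) (mode y k) =
     mode (lie x y) (j + k) + affine_scale (of_int j / 2 * B x y when j + k = 0) central_K"
  unfolding mode_def central_K_def
  by (subst bracket_superset[of "{j}" _ "{k}"]) (auto simp: when_def intro!: poly_mapping_eqI)

lemma bracket_central: "bracket central_K y = 0"
  by (cases y) (simp add: central_K_def affine_bracket_def zero_prod_def)

lemma bracket_derivation_mode: "bracket derivation_d (mode x j) = affine_scale (of_int j) (mode x j)"
  unfolding mode_def derivation_d_def
  by (subst bracket_superset[of "{}" _ "{j}"])
    (auto simp: lookup_single when_def intro!: poly_mapping_eqI)

lemma bracket_derivation_derivation: "bracket derivation_d derivation_d = 0"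
  by (simp add: derivation_d_def affine_bracket_def zero_prod_def)

text \<open>The coefficient of \<open>z\<^sup>m\<close> in the series of \<open>\<alpha>\<close> is \<open>X_coeff \<alpha> m \<otimes> t\<^sup>-\<^sup>m\<close>; the sign is the same for \<open>m\<close> and
  \<open>-m\<close>.\<close>

definition X_coeff :: "'a \<Rightarrow> int \<Rightarrow> 'a" where
  "X_coeff \<alpha> m = X \<alpha> + ((-1) powi m) *\<^sub>C X (- \<alpha>)"

lemma X_tilde_eq: "X_tilde X \<alpha> m = mode (X_coeff \<alpha> m) (- m)"
  by (simp add: X_tilde_def X_coeff_def power_int_minus_one_minus)

lemma H_series_eq: "H_series H m = (if even m then mode H (- m - 1) else 0)"
  by (simp add: H_series_def)

lemma sign_eq: "(-1) powi m = (if even m then 1 else - 1 :: complex)"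
  by (simp add: power_int_minus_left)

lemma sign_square: "((-1) powi m) * ((-1) powi m) = (1::complex)"
  by (simp add: sign_eq)

lemma sign_add: "(-1) powi (p + q) = ((-1) powi p) * ((-1) powi q :: complex)"
  by (simp add: power_int_add)

lemma X_tilde_uminus: "X_tilde X (- \<alpha>) m = affine_scale ((-1) powi m) (X_tilde X \<alpha> m)"
proof -
  have "X_coeff (- \<alpha>) m = ((-1) powi m) *\<^sub>C X_coeff \<alpha> m"
    by (simp add: X_coeff_def cscale_add_right sign_square add.commute)
  then show ?thesis by (simp add: X_tilde_eq mode_scale)
qed

lemma lie_X_coeff: "lie (X_coeff \<alpha> p) (X_coeff \<beta> q) = lie (X \<alpha>) (X \<beta>) + ((-1) powi q) *\<^sub>C lie (X \<alpha>) (X (- \<beta>)) +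
    ((-1) powi p) *\<^sub>C lie (X (- \<alpha>)) (X \<beta>) + ((-1) powi (p + q)) *\<^sub>C lie (X (- \<alpha>)) (X (- \<beta>))"
  by (simp add: X_coeff_def lie_add_left lie_add_right lie_cscale_left lie_cscale_right cscale_add_right
      sign_add algebra_simps)

lemma B_X_coeff: "B (X_coeff \<alpha> p) (X_coeff \<beta> q) = B (X \<alpha>) (X \<beta>) + ((-1) powi q) * B (X \<alpha>) (X (- \<beta>)) +
    ((-1) powi p) * B (X (- \<alpha>)) (X \<beta>) + ((-1) powi (p + q)) * B (X (- \<alpha>)) (X (- \<beta>))"
  by (simp add: X_coeff_def sign_add algebra_simps)

lemma bracket_X_X_orthogonal:
  assumes "\<alpha> \<in> \<Delta>" "\<beta> \<in> \<Delta>" "B \<alpha> \<beta> = 0"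
  shows "bracket (X_tilde X \<alpha> p) (X_tilde X \<beta> q) = 0"
proof -
  have "\<alpha> + \<beta> \<noteq> 0" "\<alpha> - \<beta> \<noteq> 0" using assms root_norm[OF assms(1)] by (auto simp: add_eq_0_iff)
  then have "\<alpha> + \<beta> \<noteq> 0" "\<alpha> - \<beta> \<noteq> 0" "- \<alpha> + \<beta> \<noteq> 0" "- \<alpha> - \<beta> \<noteq> 0"
    by (auto simp: add_eq_0_iff)
  then have "lie (X_coeff \<alpha> p) (X_coeff \<beta> q) = 0" "B (X_coeff \<alpha> p) (X_coeff \<beta> q) = 0"
    unfolding lie_X_coeff B_X_coeff using assms
    by (simp_all add: lie_root_vectors_eq_0 B_root_vectors uminus_root)
  then show ?thesis by (simp add: X_tilde_eq bracket_mode_mode)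
qed

text \<open>Of the four brackets, only those of \<open>X\<^sub>\<alpha>\<close> with \<open>X\<^sub>\<beta>\<close> and of \<open>X\<^sub>-\<^sub>\<alpha>\<close> with \<open>X\<^sub>-\<^sub>\<beta>\<close> are nonzero; they carry the same
  structure constant, because \<open>\<nu>(-\<alpha>, -\<beta>) = \<nu>(\<alpha>, \<beta>)\<close>.\<close>

lemma bracket_X_X_add:
  assumes "\<alpha> \<in> \<Delta>" "\<beta> \<in> \<Delta>" "B \<alpha> \<beta> = - 1"
  shows "bracket (X_tilde X \<alpha> p) (X_tilde X \<beta> q) = affine_scale (\<nu> \<alpha> \<beta>) (X_tilde X (\<alpha> + \<beta>) (p + q))"
proof -
  have "\<alpha> + \<beta> \<noteq> 0" "\<alpha> - \<beta> \<noteq> 0" using assms root_norm[OF assms(1)] by (auto simp: add_eq_0_iff)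
  then have ne: "\<alpha> + \<beta> \<noteq> 0" "\<alpha> - \<beta> \<noteq> 0" "- \<alpha> + \<beta> \<noteq> 0" "- \<alpha> - \<beta> \<noteq> 0"
    by (auto simp: add_eq_0_iff)
  note sum = add_root_if_inner_minus_1[OF assms]
  have "- \<alpha> + - \<beta> \<in> \<Delta>" using uminus_root[OF sum] by simp
  then have "lie (X (- \<alpha>)) (X (- \<beta>)) = \<nu> \<alpha> \<beta> *\<^sub>C X (- (\<alpha> + \<beta>))"
    using lie_root_vectors_add[OF uminus_root[OF assms(1)] uminus_root[OF assms(2)]] assms
    by (simp add: \<nu>_minus_left \<nu>_minus_right root_in_lattice root_lattice_minus)
  then have "lie (X_coeff \<alpha> p) (X_coeff \<beta> q) = \<nu> \<alpha> \<beta> *\<^sub>C X_coeff (\<alpha> + \<beta>) (p + q)" "B (X_coeff \<alpha> p) (X_coeff \<beta> q) = 0"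
    unfolding lie_X_coeff B_X_coeff using assms ne sum
    by (simp_all add: lie_root_vectors_eq_0 lie_root_vectors_add B_root_vectors uminus_root X_coeff_def
        cscale_add_right mult.commute)
  then show ?thesis by (simp add: X_tilde_eq bracket_mode_mode mode_scale)
qed

lemma bracket_X_X_opposite:
  assumes \<alpha>: "\<alpha> \<in> \<Delta>"
  shows "bracket (X_tilde X \<alpha> p) (X_tilde X (- \<alpha>) q) =
    affine_scale (- 2) (H_series \<alpha> (p + q - 1)) + affine_scale (of_int p when p + q = 0) central_K"
proof -
  have ne: "\<alpha> + \<alpha> \<noteq> 0"
    using B_add_left[of \<alpha> \<alpha> \<alpha>] root_norm[OF \<alpha>] by (auto simp del: B_add_left)
  have l: "lie (X_coeff \<alpha> p) (X_coeff (- \<alpha>) q) = ((-1) powi (p + q) - 1) *\<^sub>C \<alpha>"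
    unfolding lie_X_coeff using lie_root_vectors_opposite[OF \<alpha>] lie_root_vectors_opposite[OF uminus_root[OF \<alpha>]]
    by (simp add: lie_self cvs.scale_left_diff_distrib)
  have "- \<alpha> - \<alpha> \<noteq> 0" using ne by (metis add.inverse_inverse minus_add_distrib neg_0_equal_iff_equal uminus_add_conv_diff)
  then have b: "B (X_coeff \<alpha> p) (X_coeff (- \<alpha>) q) = - 1 - (-1) powi (p + q)"
    unfolding B_X_coeff using \<alpha> ne by (simp add: B_root_vectors uminus_root)
  have "mode (((-1) powi (p + q) - 1) *\<^sub>C \<alpha>) (- p - q) = affine_scale (- 2) (H_series \<alpha> (p + q - 1))"
    unfolding mode_scale sign_eq by (auto simp: H_series_eq)
  then show ?thesis
    unfolding X_tilde_eq bracket_mode_mode l b by (auto simp: when_def)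
qed

lemma bracket_H_X:
  assumes "\<alpha> \<in> \<Delta>" "H \<in> \<hh>" "even m"
  shows "bracket (H_series H m) (X_tilde X \<alpha> q) = affine_scale (B H \<alpha>) (X_tilde X \<alpha> (q + m + 1))"
proof -
  have "(-1) powi (q + m + 1) = - ((-1) powi q :: complex)"
    using assms(3) by (simp add: sign_add)
  then have "lie H (X_coeff \<alpha> q) = B H \<alpha> *\<^sub>C X_coeff \<alpha> (q + m + 1)"
    using assms
    by (simp add: X_coeff_def lie_add_right lie_cscale_right lie_cartan_root_vector uminus_root B_commute[of H]
        cscale_add_right cvs.scale_right_diff_distrib mult.commute)
  moreover have "B H (X_coeff \<alpha> q) = 0"
    using assms by (simp add: X_coeff_def B_cartan_root_vector uminus_root)
  moreover have "- m - 1 - q = - q - m - 1" by simp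
  ultimately show ?thesis
    using assms(3) by (simp add: X_tilde_eq H_series_eq bracket_mode_mode mode_scale \<open>- m - 1 - q = - q - m - 1\<close>)
qed

lemma bracket_H_H:
  assumes "H \<in> \<hh>" "H' \<in> \<hh>" "even m" "even m'"
  shows "bracket (H_series H m) (H_series H' m') =
    affine_scale (of_int (- m - 1) / 2 * B H H' when m + m' = - 2) central_K"
proof -
  have "- m - 1 + (- m' - 1) = 0 \<longleftrightarrow> m + m' = - 2" by linarith
  then show ?thesis using assms by (simp add: H_series_eq bracket_mode_mode cartan_abelian)
qed

lemma \<sigma>_linear: "\<sigma> (x + y) = \<sigma> x + \<sigma> y" "\<sigma> (c *\<^sub>C x) = c *\<^sub>C \<sigma> x"
  using \<sigma> by (simp_all add: lie_automorphism_def)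

lemma \<sigma>_involution: "\<sigma> (\<sigma> x) = x"
proof (induction x rule: root_decomposition_induct)
  case (cartan H)
  then show ?case using \<sigma>_cartan \<sigma>_linear(2)[of "- 1" H] by simp
next
  case (root \<alpha>)
  then show ?case using \<sigma>_root_vector uminus_root[OF root] by simp
qed (simp add: \<sigma>_linear)

lemma cscale_half: "(1 / 2) *\<^sub>C (x + x) = (x :: 'a)"
  by (simp add: cscale_add_right flip: cscale_add_left)

lemma eigenspace_parity_iff: "x \<in> eigenspace_parity \<sigma> j \<longleftrightarrow> \<sigma> x = ((-1) powi j) *\<^sub>C x"
  by (simp add: eigenspace_parity_def sign_eq)

lemma affine_add: "x \<in> L \<Longrightarrow> y \<in> L \<Longrightarrow> x + y \<in> L"
  and affine_scale_closed: "x \<in> L \<Longrightarrow> affine_scale c x \<in> L"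
  by (auto simp: twisted_affine_def eigenspace_parity_iff lookup_add \<sigma>_linear cscale_add_right mult.commute)

lemma affine_zero: "0 \<in> L"
  using \<sigma>_linear(2)[of 0 0] by (simp add: twisted_affine_def zero_prod_def eigenspace_parity_iff)

lemma bracket_in_affine: "x \<in> L \<Longrightarrow> y \<in> L \<Longrightarrow> bracket x y \<in> L"
  by (rule affine_bracket_closed[OF \<sigma>])

lemma mode_in_affine: "\<sigma> x = ((-1) powi j) *\<^sub>C x \<Longrightarrow> mode x j \<in> L"
  using affine_zero
  by (auto simp: mode_def twisted_affine_def eigenspace_parity_iff lookup_single when_def zero_prod_def)

lemma X_tilde_in_affine: "\<alpha> \<in> \<Delta> \<Longrightarrow> X_tilde X \<alpha> m \<in> L"
  unfolding X_tilde_eq using \<sigma>_root_vector uminus_root[of \<alpha>]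
  by (intro mode_in_affine)
    (simp add: X_coeff_def \<sigma>_linear power_int_minus_one_minus cscale_add_right sign_square add.commute)

lemma H_series_in_affine: "H \<in> \<hh> \<Longrightarrow> H_series H m \<in> L"
  using \<sigma>_cartan by (auto simp: H_series_eq affine_zero sign_eq intro!: mode_in_affine)

lemma central_in_affine: "central_K \<in> L" and derivation_in_affine: "derivation_d \<in> L"
  using affine_zero by (auto simp: twisted_affine_def central_K_def derivation_d_def zero_prod_def)

text \<open>The modes of the series \<open>X\<^sub>\<alpha>(z)\<close> and \<open>H(z)\<close> together with \<open>K\<close> and \<open>d\<close> span the twisted affine
  algebra. The map \<open>proj j\<close> is the projection of the Lie algebra onto an eigenspace of \<open>\<sigma>\<close>; it sends the
  spanning elements \<open>H\<close> and \<open>X\<^sub>\<alpha>\<close> to multiples of the coefficients of these series.\<close>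

lemma affine_induct [consumes 1, case_names X H K d combination]:
  assumes x: "x \<in> L"
    and X: "\<And>\<alpha> m. \<alpha> \<in> \<Delta> \<Longrightarrow> P (X_tilde X \<alpha> m)"
    and H: "\<And>H m. H \<in> \<hh> \<Longrightarrow> P (H_series H m)"
    and K: "P central_K" and d: "P derivation_d"
    and comb: "\<And>c x y. x \<in> L \<Longrightarrow> y \<in> L \<Longrightarrow> P x \<Longrightarrow> P y \<Longrightarrow> P (affine_scale c x + y)"
  shows "P x"
proof -
  have P0: "P 0"
    using comb[OF central_in_affine central_in_affine K K, of "- 1"] by (simp add: affine_scale_minus_one)
  have scale: "P (affine_scale c x)" if "x \<in> L" "P x" for c x
    using comb[OF that(1) affine_zero that(2) P0, of c] by simp
  have add: "P (x + y)" if "x \<in> L" "y \<in> L" "P x" "P y" for x y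
    using comb[of x y 1] that by simp
  define proj where "proj j x = (1 / 2) *\<^sub>C (x + ((-1) powi j) *\<^sub>C \<sigma> x)" for j x
  have proj_in: "mode (proj j x) j \<in> L" for j x
  proof (rule mode_in_affine)
    show "\<sigma> (proj j x) = ((-1) powi j) *\<^sub>C proj j x"
      by (simp add: proj_def \<sigma>_linear \<sigma>_involution cscale_add_right cscale_left_commute sign_square add.commute)
  qed
  have mode: "P (mode (proj j x) j)" for j x
  proof (induction x rule: root_decomposition_induct)
    case (cartan H)
    have "mode (proj j H) j = H_series H (- j - 1)"
      using cartan \<sigma>_cartan
      by (auto simp: proj_def H_series_eq sign_eq cscale_half)
    then show ?case using cartan H by simp
  next
    case (root \<alpha>)
    have "mode (proj j (X \<alpha>)) j = affine_scale (1 / 2) (X_tilde X \<alpha> (- j))"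
      using root \<sigma>_root_vector by (simp add: proj_def X_tilde_eq X_coeff_def mode_scale power_int_minus_one_minus)
    then show ?case using root X scale X_tilde_in_affine by simp
  next
    case (combination c x y)
    have "proj j (c *\<^sub>C x + y) = c *\<^sub>C proj j x + proj j y"
      by (simp add: proj_def \<sigma>_linear cscale_add_right algebra_simps)
    then show ?case using comb[OF proj_in proj_in combination] by (simp add: mode_combination)
  qed
  obtain u a b where xu: "x = (u, a, b)" by (cases x) auto
  have u: "lookup u j \<in> eigenspace_parity \<sigma> j" for j using x by (simp add: xu twisted_affine_def)
  have proj: "proj j (lookup u j) = lookup u j" for j
    using u[of j] by (simp add: eigenspace_parity_iff proj_def sign_square cscale_half)
  have "P (\<Sum>j\<in>A. mode (lookup u j) j) \<and> (\<Sum>j\<in>A. mode (lookup u j) j) \<in> L" if "finite A" for A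
    using that
  proof (induction A rule: finite_induct)
    case (insert j A)
    have "P (mode (lookup u j) j)" "mode (lookup u j) j \<in> L"
      using mode[of j "lookup u j"] proj_in[of j "lookup u j"] by (simp_all add: proj)
    then show ?case using insert by (simp add: add affine_add)
  qed (simp add: P0 affine_zero)
  from this[of "keys u"] have 1: "P (\<Sum>j\<in>keys u. mode (lookup u j) j)" "(\<Sum>j\<in>keys u. mode (lookup u j) j) \<in> L"
    by simp_all
  have "(\<Sum>j\<in>A. mode (lookup u j) j) = ((\<Sum>j\<in>A. single j (lookup u j)), 0, 0)" if "finite A" for A
    using that by (induction A rule: finite_induct) (simp_all add: mode_def zero_prod_def)
  from this[of "keys u"] have sum: "(\<Sum>j\<in>keys u. mode (lookup u j) j) = (u, 0, 0)"
    by (simp flip: poly_mapping_sum_single)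
  have "x = affine_scale a central_K + (affine_scale b derivation_d + (\<Sum>j\<in>keys u. mode (lookup u j) j))"
    unfolding sum by (auto simp: xu central_K_def derivation_d_def intro!: poly_mapping_eqI simp: lookup_add)
  then show ?thesis
    using 1 comb[OF central_in_affine _ K] comb[OF derivation_in_affine 1(2) d 1(1)]
    by (simp add: affine_add affine_scale_closed derivation_in_affine)
qed

section \<open>The representation\<close>

lemma cartan_combination: "cartan (c *\<^sub>C x + y) m v = V_scale c (cartan x m v) + cartan y m v"
  by (simp add: cartan_op_def V_scale_add V_scale_add_left V_scale_sum sum.distrib mult_ac)

text \<open>The action of \<open>x \<otimes> t\<^sup>j\<close>. The coordinate of \<open>x\<close> at \<open>X\<^sub>\<alpha>\<close> is \<open>-(x|X\<^sub>-\<^sub>\<alpha>)\<close>, and the factor \<open>1 / 2\<close> accounts for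
  \<open>\<alpha>\<close> and \<open>-\<alpha>\<close> contributing equally when \<open>x\<close> lies in the appropriate eigenspace of \<open>\<sigma>\<close>. A
  formula in terms of coordinates is well defined and linear without any choice among the
  linearly dependent generators.\<close>

definition mode_op :: "'a \<Rightarrow> int \<Rightarrow> ('a, 'n) vertex \<Rightarrow> ('a, 'n) vertex" where
  "mode_op x j v = cartan x (- j - 1) v -
     V_scale (1 / 2) (\<Sum>\<alpha>\<in>\<Delta>. V_scale (B x (X (- \<alpha>))) (\<Gamma> \<alpha> (- j) v))"

lemma mode_op_combination: "mode_op (c *\<^sub>C x + y) j v = V_scale c (mode_op x j v) + mode_op y j v"
  by (simp add: mode_op_def cartan_combination V_scale_add V_scale_add_left V_scale_diff V_scale_sum
      sum.distrib mult_ac)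

lemma mode_op_zero [simp]: "mode_op 0 j v = 0"
  using mode_op_combination[of "- 1" 0 0 j v] by (simp add: V_scale_minus_left)

lemma V_linear_mode_op: "V_linear (mode_op x j)"
  unfolding mode_op_def
  by (intro V_linear_diff_fun V_linear_cartan_op V_linear_scale_fun V_linear_sum_fun V_linear_\<Gamma>)

lemma mode_op_in_V: "v \<in> V \<Longrightarrow> mode_op x j v \<in> V"
  unfolding mode_op_def
  by (intro V_space_diff V_space_scale V_space_sum cartan_in_V_space \<Gamma>_in_V_space)

definition affine_op :: "'a affine \<Rightarrow> ('a, 'n) vertex \<Rightarrow> ('a, 'n) vertex" where
  "affine_op = (\<lambda>(u, a, b) v. (\<Sum>j\<in>keys u. mode_op (lookup u j) j v) + V_scale a v -
     V_scale b (on_fock energy v))"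

lemma affine_op_combination: "affine_op (affine_scale c x + y) v = V_scale c (affine_op x v) + affine_op y v"
proof -
  obtain u a b u' a' b' where x: "x = (u, a, b)" "y = (u', a', b')" by (metis prod_cases3)
  let ?K = "keys u \<union> keys u'" and ?u = "Poly_Mapping.map (cscale c) u + u'"
  have sup: "(\<Sum>j\<in>keys w. mode_op (lookup w j) j v) = (\<Sum>j\<in>?K. mode_op (lookup w j) j v)"
    if "keys w \<subseteq> ?K" for w
    using that by (intro sum.mono_neutral_left) (auto simp: in_keys_iff)
  have K: "keys ?u \<subseteq> ?K" by (auto simp: in_keys_iff lookup_add)
  have sum: "(\<Sum>j\<in>?K. mode_op (lookup ?u j) j v) =
      V_scale c (\<Sum>j\<in>?K. mode_op (lookup u j) j v) + (\<Sum>j\<in>?K. mode_op (lookup u' j) j v)"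
    by (simp add: lookup_add mode_op_combination sum.distrib V_scale_sum)
  have "affine_op (?u, c * a + a', c * b + b') v =
     V_scale c (affine_op (u, a, b) v) + affine_op (u', a', b') v"
    unfolding affine_op_def case_prod_conv sup[OF K] sup[OF Un_upper1] sup[OF Un_upper2] sum
    by (simp add: V_scale_add V_scale_add_left V_scale_diff algebra_simps)
  then show ?thesis unfolding x by simp
qed

lemma V_linear_affine_op: "V_linear (affine_op x)"
  unfolding affine_op_def case_prod_unfold
  by (intro V_linear_diff_fun V_linear_add_fun V_linear_scale_fun V_linear_sum_fun V_linear_mode_op
      V_linear_id V_linear_on_fock fock_linear_energy)

lemma affine_op_in_V: "v \<in> V \<Longrightarrow> affine_op x v \<in> V"
  unfolding affine_op_def case_prod_unfold
  by (intro V_space_diff V_space_add V_space_scale V_space_sum mode_op_in_V energy_in_V_space)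

lemma affine_op_mode: "affine_op (mode x j) v = mode_op x j v"
  by (cases "x = 0") (simp_all add: affine_op_def mode_def)

lemma affine_op_zero: "affine_op 0 v = 0"
  by (simp add: affine_op_def zero_prod_def)

text \<open>Only \<open>\<beta>\<close> and \<open>-\<beta>\<close> contribute, and their contributions agree by \<open>\<Gamma>\<^sub>-\<^sub>\<beta>(z) = \<Gamma>\<^sub>\<beta>(-z)\<close>.\<close>

lemma affine_op_X_tilde:
  assumes \<beta>: "\<beta> \<in> \<Delta>" and v: "v \<in> V"
  shows "affine_op (X_tilde X \<beta> m) v = \<Gamma> \<beta> m v"
proof -
  let ?s = "(-1) powi m :: complex"
  have ne: "\<beta> \<noteq> - \<beta>"
    using root_norm[OF \<beta>] B_minus(1)[of \<beta> \<beta>] by (metis equation_minus_iff one_neq_neg_one zero_neq_numeral neg_equal_iff_equal B_minus(1) neg_numeral_neq_numeral)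
  have "cartan (X_coeff \<beta> m) k v = 0" for k
  proof -
    have "B (X_coeff \<beta> m) (S j) = 0" for j
      using S_in_cartan \<beta> by (subst B_commute) (simp add: X_coeff_def B_cartan_root_vector uminus_root)
    then show ?thesis by (simp add: cartan_op_def)
  qed
  moreover have "(\<Sum>\<alpha>\<in>\<Delta>. V_scale (B (X_coeff \<beta> m) (X (- \<alpha>))) (\<Gamma> \<alpha> m v)) = V_scale (- 2) (\<Gamma> \<beta> m v)"
  proof -
    have "(\<Sum>\<alpha>\<in>\<Delta>. V_scale (B (X_coeff \<beta> m) (X (- \<alpha>))) (\<Gamma> \<alpha> m v)) =
        (\<Sum>\<alpha>\<in>{\<beta>, - \<beta>}. V_scale (B (X_coeff \<beta> m) (X (- \<alpha>))) (\<Gamma> \<alpha> m v))"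
      using \<beta> by (intro sum.mono_neutral_right)
        (auto simp: finite_roots uminus_root X_coeff_def B_root_vectors add_eq_0_iff)
    also have "\<dots> = V_scale (- 1) (\<Gamma> \<beta> m v) + V_scale (- ?s) (\<Gamma> (- \<beta>) m v)"
      using \<beta> ne by (auto simp: uminus_root X_coeff_def B_root_vectors add_eq_0_iff)
    also have "\<dots> = V_scale (- 2) (\<Gamma> \<beta> m v)"
      using \<Gamma>_uminus[OF \<beta> v, of m] by (simp add: sign_square flip: V_scale_add_left)
    finally show ?thesis .
  qed
  ultimately show ?thesis by (simp add: X_tilde_eq affine_op_mode mode_op_def flip: V_scale_minus_left)
qed

lemma affine_op_H_series:
  assumes "H \<in> \<hh>"
  shows "affine_op (H_series H m) v = cartan H m v"
proof (cases "even m")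
  case True
  then show ?thesis
    using assms by (simp add: H_series_eq affine_op_mode mode_op_def B_cartan_root_vector uminus_root)
next
  case False
  then show ?thesis by (simp add: H_series_eq affine_op_zero cartan_op_odd)
qed

definition vertex_rep :: "'a affine \<Rightarrow> ('a, 'n) vertex \<Rightarrow> ('a, 'n) vertex" where
  "vertex_rep = (\<lambda>x\<in>L. \<lambda>v\<in>V. affine_op x v)"

lemma vertex_map_iff:
  "vertex_map \<hh> B \<nu> X \<sigma> S \<pi> \<longleftrightarrow> linear_to_End L affine_scale V V_scale \<pi> \<and>
     (\<forall>v\<in>V. (\<forall>\<alpha>\<in>\<Delta>. \<forall>m. \<pi> (X_tilde X \<alpha> m) v = \<Gamma> \<alpha> m v) \<and>
        (\<forall>H\<in>\<hh>. \<forall>m. \<pi> (H_series H m) v = cartan H m v) \<and>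
        \<pi> central_K v = v \<and> \<pi> derivation_d v = - on_fock energy v)"
  by (simp add: vertex_map_def cartan_op_def)

lemma vertex_map_vertex_rep: "vertex_map \<hh> B \<nu> X \<sigma> S vertex_rep"
  unfolding vertex_map_iff
proof (intro conjI ballI allI)
  have "vertex_rep \<in> L \<rightarrow>\<^sub>E endomorphisms V V_scale"
    by (auto simp: vertex_rep_def endomorphisms_def affine_op_in_V V_space_add V_space_scale
        V_linear_add[OF V_linear_affine_op] V_linear_scale[OF V_linear_affine_op])
  then show "linear_to_End L affine_scale V V_scale vertex_rep"
    using affine_op_combination[of 1] affine_op_combination[of _ _ 0]
    by (auto simp: linear_to_End_def vertex_rep_def affine_add affine_scale_closed affine_op_zero)
  fix v assume v: "v \<in> V"
  show "vertex_rep (X_tilde X \<alpha> m) v = \<Gamma> \<alpha> m v" if "\<alpha> \<in> \<Delta>" for \<alpha> m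
    using that v by (simp add: vertex_rep_def X_tilde_in_affine affine_op_X_tilde)
  show "vertex_rep (H_series H m) v = cartan H m v" if "H \<in> \<hh>" for H m
    using that v by (simp add: vertex_rep_def H_series_in_affine affine_op_H_series)
  have "affine_op central_K v = v" "affine_op derivation_d v = - on_fock energy v"
    by (simp_all add: affine_op_def central_K_def derivation_d_def)
  then show "vertex_rep central_K v = v" "vertex_rep derivation_d v = - on_fock energy v"
    using v by (simp_all add: vertex_rep_def central_in_affine derivation_in_affine)
qed

lemma vertex_map_combination:
  assumes "vertex_map \<hh> B \<nu> X \<sigma> S \<pi>" "x \<in> L" "y \<in> L" "v \<in> V"
  shows "\<pi> (affine_scale c x + y) v = V_scale c (\<pi> x v) + \<pi> y v"
  using assms by (simp add: vertex_map_iff linear_to_End_def affine_scale_closed)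

lemma vertex_map_endomorphism:
  assumes "vertex_map \<hh> B \<nu> X \<sigma> S \<pi>" "x \<in> L"
  shows "v \<in> V \<Longrightarrow> \<pi> x v \<in> V"
    and "v \<in> V \<Longrightarrow> w \<in> V \<Longrightarrow> \<pi> x (V_scale c v + w) = V_scale c (\<pi> x v) + \<pi> x w"
proof -
  have "\<pi> x \<in> endomorphisms V V_scale"
    using assms by (auto simp: vertex_map_iff linear_to_End_def)
  then show "v \<in> V \<Longrightarrow> \<pi> x v \<in> V"
    and "v \<in> V \<Longrightarrow> w \<in> V \<Longrightarrow> \<pi> x (V_scale c v + w) = V_scale c (\<pi> x v) + \<pi> x w"
    by (auto simp: endomorphisms_def V_space_scale)
qed

lemma vertex_map_unique:
  assumes \<pi>: "vertex_map \<hh> B \<nu> X \<sigma> S \<pi>" and \<pi>': "vertex_map \<hh> B \<nu> X \<sigma> S \<pi>'"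
  shows "\<pi> = \<pi>'"
proof -
  have eq: "\<pi> x v = \<pi>' x v" if "x \<in> L" "v \<in> V" for x v
    using that(1)
  proof (induction rule: affine_induct)
    case (combination c x y)
    then show ?case by (simp add: vertex_map_combination[OF \<pi>] vertex_map_combination[OF \<pi>'] that(2))
  qed (use \<pi> \<pi>' that(2) in \<open>simp_all add: vertex_map_iff\<close>)
  have E: "\<pi> \<in> L \<rightarrow>\<^sub>E endomorphisms V V_scale" "\<pi>' \<in> L \<rightarrow>\<^sub>E endomorphisms V V_scale"
    using \<pi> \<pi>' by (simp_all add: vertex_map_iff linear_to_End_def)
  show ?thesis
  proof (rule PiE_ext[OF E])
    fix x assume x: "x \<in> L"
    have "\<pi> x \<in> V \<rightarrow>\<^sub>E V" "\<pi>' x \<in> V \<rightarrow>\<^sub>E V"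
      using PiE_mem[OF E(1) x] PiE_mem[OF E(2) x] by (simp_all add: endomorphisms_def)
    then show "\<pi> x = \<pi>' x" by (rule PiE_ext) (simp add: eq x)
  qed
qed

context
  fixes \<pi> :: "'a affine \<Rightarrow> ('a, 'n) vertex \<Rightarrow> ('a, 'n) vertex"
  assumes \<pi>: "vertex_map \<hh> B \<nu> X \<sigma> S \<pi>"
begin

lemma vertex_map_add: "x \<in> L \<Longrightarrow> y \<in> L \<Longrightarrow> v \<in> V \<Longrightarrow> \<pi> (x + y) v = \<pi> x v + \<pi> y v"
  using vertex_map_combination[OF \<pi>, of x y v 1] by simp

lemma vertex_map_scale: "x \<in> L \<Longrightarrow> v \<in> V \<Longrightarrow> \<pi> (affine_scale c x) v = V_scale c (\<pi> x v)"
  using \<pi> by (simp add: vertex_map_iff linear_to_End_def)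

lemma vertex_map_zero: "v \<in> V \<Longrightarrow> \<pi> 0 v = 0"
  using vertex_map_scale[OF affine_zero, of v 0] by simp

lemma vertex_map_minus: "x \<in> L \<Longrightarrow> v \<in> V \<Longrightarrow> \<pi> (- x) v = - \<pi> x v"
  using vertex_map_scale[of x v "- 1"] by (simp add: affine_scale_minus_one V_scale_minus_left)

lemma vertex_map_X: "\<alpha> \<in> \<Delta> \<Longrightarrow> v \<in> V \<Longrightarrow> \<pi> (X_tilde X \<alpha> m) v = \<Gamma> \<alpha> m v"
  and vertex_map_H: "H \<in> \<hh> \<Longrightarrow> v \<in> V \<Longrightarrow> \<pi> (H_series H m) v = cartan H m v"
  and vertex_map_K: "v \<in> V \<Longrightarrow> \<pi> central_K v = v"
  and vertex_map_d: "v \<in> V \<Longrightarrow> \<pi> derivation_d v = - on_fock energy v"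
  using \<pi> by (simp_all add: vertex_map_iff)

definition represents :: "'a affine \<Rightarrow> 'a affine \<Rightarrow> bool" where
  "represents x y \<longleftrightarrow> (\<forall>v\<in>V. \<pi> (bracket x y) v = \<pi> x (\<pi> y v) - \<pi> y (\<pi> x v))"

lemma represents_commute:
  assumes "x \<in> L" "y \<in> L" "represents x y"
  shows "represents y x"
  using assms unfolding represents_def bracket_commute[of y x]
  by (simp add: vertex_map_minus bracket_in_affine)

lemma represents_combination:
  assumes "x \<in> L" "x' \<in> L" "y \<in> L" "represents x y" "represents x' y"
  shows "represents (affine_scale c x + x') y"
  unfolding represents_def
proof
  fix v assume v: "v \<in> V"
  note V = vertex_map_endomorphism[OF \<pi>]
  have "\<pi> (bracket (affine_scale c x + x') y) v = V_scale c (\<pi> (bracket x y) v) + \<pi> (bracket x' y) v"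
    unfolding bracket_combination_left
    by (rule vertex_map_combination[OF \<pi>]) (simp_all add: bracket_in_affine assms v)
  then show "\<pi> (bracket (affine_scale c x + x') y) v =
      \<pi> (affine_scale c x + x') (\<pi> y v) - \<pi> y (\<pi> (affine_scale c x + x') v)"
    using assms v by (simp add: represents_def vertex_map_combination[OF \<pi>] V V_scale_diff)
qed

lemma represents_combination_right:
  assumes "x \<in> L" "x' \<in> L" "y \<in> L" "represents y x" "represents y x'"
  shows "represents y (affine_scale c x + x')"
proof -
  have "represents (affine_scale c x + x') y"
    by (rule represents_combination) (use assms represents_commute in blast)+
  then show ?thesis
    by (rule represents_commute[rotated -1]) (simp_all add: assms affine_add affine_scale_closed)
qed

lemma represents_zero:
  assumes "y \<in> L"
  shows "represents 0 y"
proof -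
  have "(0 :: ('a, 'n) vertex) \<in> V" by (rule V_space_zero)
  then have "\<pi> y 0 = 0"
    using vertex_map_endomorphism(2)[OF \<pi> assms, of 0 0 1] by simp
  then show ?thesis
    using vertex_map_endomorphism(1)[OF \<pi> assms] by (simp add: represents_def vertex_map_zero)
qed

lemma represents_scale_right:
  assumes "x \<in> L" "y \<in> L" "represents y x"
  shows "represents y (affine_scale c x)"
  using represents_combination_right[OF assms(1) affine_zero assms(2,3), of c]
    represents_commute[OF affine_zero assms(2) represents_zero[OF assms(2)]] by simp

text \<open>The commutators of the operators \<open>\<Gamma>\<close> match the brackets for \<open>(\<alpha>|\<beta>) \<in> {0, -1}\<close> and for
  \<open>\<beta> = -\<alpha>\<close>. In the other cases \<open>-\<beta>\<close> satisfies one of these conditions, and the generator of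
  \<open>\<beta>\<close> is up to sign that of \<open>-\<beta>\<close>.\<close>

lemma represents_X_X:
  assumes \<alpha>: "\<alpha> \<in> \<Delta>" and \<beta>: "\<beta> \<in> \<Delta>"
  shows "represents (X_tilde X \<alpha> p) (X_tilde X \<beta> q)"
proof -
  have nonpos: "represents (X_tilde X \<alpha> p) (X_tilde X \<beta> q)"
    if "\<beta> \<in> \<Delta>" "B \<alpha> \<beta> = 0 \<or> B \<alpha> \<beta> = - 1 \<or> \<beta> = - \<alpha>" for \<beta>
    using that(2)
  proof (elim disjE)
    assume "B \<alpha> \<beta> = 0"
    then have "\<Gamma> \<alpha> p (\<Gamma> \<beta> q v) - \<Gamma> \<beta> q (\<Gamma> \<alpha> p v) = 0" if "v \<in> V" for v
      using \<Gamma>_commute[OF \<alpha> \<open>\<beta> \<in> \<Delta>\<close>] that by blast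
    then show ?thesis
      using \<alpha> that(1) \<open>B \<alpha> \<beta> = 0\<close>
      by (simp add: represents_def vertex_map_X \<Gamma>_in_V_space bracket_X_X_orthogonal vertex_map_zero)
  next
    assume *: "B \<alpha> \<beta> = - 1"
    then show ?thesis
      using \<alpha> that(1) \<Gamma>_commutator_add add_root_if_inner_minus_1[OF \<alpha> that(1) *]
      by (simp add: represents_def vertex_map_X \<Gamma>_in_V_space bracket_X_X_add vertex_map_scale X_tilde_in_affine)
  next
    assume "\<beta> = - \<alpha>"
    then show ?thesis
      using \<alpha> that(1) root_in_cartan[OF \<alpha>] \<Gamma>_commutator_opposite[OF \<alpha>]
      by (auto simp: represents_def vertex_map_X vertex_map_H vertex_map_K \<Gamma>_in_V_space bracket_X_X_opposite vertex_map_add vertex_map_scale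
          H_series_in_affine central_in_affine affine_scale_closed when_def)
  qed
  show ?thesis
  proof (cases "B \<alpha> \<beta> = 0 \<or> B \<alpha> \<beta> = - 1 \<or> \<beta> = - \<alpha>")
    case True
    then show ?thesis by (rule nonpos[OF \<beta>])
  next
    case False
    then have "B \<alpha> (- \<beta>) = 0 \<or> B \<alpha> (- \<beta>) = - 1 \<or> - \<beta> = - \<alpha>"
      using inner_roots_cases[OF \<alpha> \<beta>] by auto
    then have "represents (X_tilde X \<alpha> p) (affine_scale ((-1) powi q) (X_tilde X (- \<beta>) q))"
      using nonpos[of "- \<beta>"] uminus_root[OF \<beta>] \<alpha> by (intro represents_scale_right X_tilde_in_affine) auto
    then show ?thesis by (simp add: X_tilde_uminus sign_square)
  qed
qed

lemma represents_H_X: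
  assumes "\<alpha> \<in> \<Delta>" "H \<in> \<hh>"
  shows "represents (H_series H m) (X_tilde X \<alpha> q)"
proof (cases "even m")
  case True
  then show ?thesis
    using assms cartan_\<Gamma>_commutator[of \<alpha> _ H m q]
    by (simp add: represents_def vertex_map_X vertex_map_H \<Gamma>_in_V_space cartan_in_V_space bracket_H_X vertex_map_scale X_tilde_in_affine)
next
  case False
  then show ?thesis using represents_zero[OF X_tilde_in_affine[OF assms(1)]] by (simp add: H_series_eq)
qed

lemma represents_H_H:
  assumes "H \<in> \<hh>" "H' \<in> \<hh>"
  shows "represents (H_series H m) (H_series H' m')"
proof (cases "even m \<and> even m'")
  case True
  then show ?thesis
    using assms cartan_cartan_commutator[of H' _ m m' H]
    by (simp add: represents_def vertex_map_H vertex_map_K cartan_in_V_space bracket_H_H vertex_map_scale central_in_affine when_def)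
next
  case False
  have "represents x 0" if "x \<in> L" for x
    using represents_commute[OF affine_zero that represents_zero[OF that]] .
  then show ?thesis
    using False represents_zero H_series_in_affine[OF assms(1), of m] H_series_in_affine[OF assms(2), of m']
    by (auto simp: H_series_eq split: if_splits)
qed

lemma represents_K: "y \<in> L \<Longrightarrow> represents central_K y"
  by (simp add: represents_def bracket_central vertex_map_zero vertex_map_K vertex_map_endomorphism[OF \<pi>])

lemma represents_d_X:
  assumes \<alpha>: "\<alpha> \<in> \<Delta>"
  shows "represents derivation_d (X_tilde X \<alpha> m)"
  unfolding represents_def
proof
  fix v assume v: "v \<in> V"
  have "\<pi> (bracket derivation_d (X_tilde X \<alpha> m)) v = V_scale (of_int (- m)) (\<Gamma> \<alpha> m v)"
    using \<alpha> v vertex_map_scale[OF X_tilde_in_affine[OF \<alpha>] v] unfolding X_tilde_eq bracket_derivation_mode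
    by (simp add: vertex_map_X flip: X_tilde_eq)
  moreover have "on_fock energy (\<Gamma> \<alpha> m v) = \<Gamma> \<alpha> m (on_fock energy v) + V_scale (of_int m) (\<Gamma> \<alpha> m v)"
    using energy_\<Gamma>_commutator[OF \<alpha> v, of m] by (simp add: algebra_simps)
  ultimately show "\<pi> (bracket derivation_d (X_tilde X \<alpha> m)) v =
      \<pi> derivation_d (\<pi> (X_tilde X \<alpha> m) v) - \<pi> (X_tilde X \<alpha> m) (\<pi> derivation_d v)"
    using \<alpha> v V_linear_diff[OF V_linear_\<Gamma>, of B \<nu> S \<alpha> m 0] V_linear_zero[OF V_linear_\<Gamma>, of B \<nu> S \<alpha> m]
    by (simp add: vertex_map_X vertex_map_d \<Gamma>_in_V_space V_space_minus energy_in_V_space V_scale_minus_left)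
qed

lemma represents_d_H:
  assumes H: "H \<in> \<hh>"
  shows "represents derivation_d (H_series H m)"
proof (cases "even m")
  case True
  show ?thesis
    unfolding represents_def
  proof
    fix v assume v: "v \<in> V"
    have "bracket derivation_d (H_series H m) = affine_scale (of_int (- m - 1)) (H_series H m)"
      using True by (simp add: H_series_eq bracket_derivation_mode)
    then have "\<pi> (bracket derivation_d (H_series H m)) v = V_scale (of_int (- m - 1)) (cartan H m v)"
      using H v by (simp only: vertex_map_scale[OF H_series_in_affine] vertex_map_H)
    also have "of_int (- m - 1) = - (of_int (m + 1) :: complex)" by simp
    finally have "\<pi> (bracket derivation_d (H_series H m)) v = - V_scale (of_int (m + 1)) (cartan H m v)"
      by (simp only: V_scale_minus_left)
    moreover have "on_fock energy (cartan H m v) = cartan H m (on_fock energy v) + V_scale (of_int (m + 1)) (cartan H m v)"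
      using energy_cartan_commutator[OF v True, of H] by (simp only: diff_eq_eq add.commute)
    ultimately show "\<pi> (bracket derivation_d (H_series H m)) v =
        \<pi> derivation_d (\<pi> (H_series H m) v) - \<pi> (H_series H m) (\<pi> derivation_d v)"
      using H v V_linear_diff[OF V_linear_cartan_op, of B S H m 0] V_linear_zero[OF V_linear_cartan_op, of B S H m]
      by (simp add: vertex_map_H vertex_map_d cartan_in_V_space V_space_minus energy_in_V_space del: of_int_add)
  qed
next
  case False
  then show ?thesis
    using represents_commute[OF affine_zero derivation_in_affine represents_zero[OF derivation_in_affine]]
    by (simp add: H_series_eq)
qed

lemma represents_d_d: "represents derivation_d derivation_d"
  by (simp add: represents_def bracket_derivation_derivation vertex_map_zero)

text \<open>Compatibility with the bracket is bilinear and symmetric in its two arguments, so pairs of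
  generators suffice.\<close>

lemma represents_all:
  assumes "x \<in> L" "y \<in> L"
  shows "represents x y"
proof -
  note mem = X_tilde_in_affine H_series_in_affine central_in_affine derivation_in_affine
  have gen: "represents g y" if g: "g \<in> L"
    and X: "\<And>\<alpha> m. \<alpha> \<in> \<Delta> \<Longrightarrow> represents g (X_tilde X \<alpha> m)"
    and H: "\<And>H m. H \<in> \<hh> \<Longrightarrow> represents g (H_series H m)"
    and d: "represents g derivation_d" for g
    using \<open>y \<in> L\<close>
  proof (induction rule: affine_induct)
    case K
    show ?case using represents_commute[OF central_in_affine g represents_K[OF g]] .
  next
    case (combination c x y)
    then show ?case using represents_combination_right g by blast
  qed (use X H d in blast)+
  show ?thesis
    using \<open>x \<in> L\<close>
  proof (induction rule: affine_induct)
    case (X \<alpha> m)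
    then show ?case
      by (intro gen mem represents_X_X) (auto intro: represents_commute represents_H_X represents_d_X mem)
  next
    case (H H m)
    then show ?case
      by (intro gen mem represents_H_H represents_H_X) (auto intro: represents_commute represents_d_H mem)
  next
    case K
    then show ?case using \<open>y \<in> L\<close> by (rule represents_K)
  next
    case d
    then show ?case by (intro gen mem represents_d_X represents_d_H represents_d_d)
  next
    case (combination c x x')
    then show ?case using represents_combination \<open>y \<in> L\<close> by blast
  qed
qed

lemma lie_representation_vertex_map: "lie_representation L affine_scale bracket V V_scale \<pi>"
  using \<pi> represents_all by (simp add: lie_representation_def vertex_map_iff represents_def)

end

end

theorem theorem3p1:
  fixes \<hh> :: "'a::complex_lie_algebra set"
    and B :: "'a \<Rightarrow> 'a \<Rightarrow> complex"
    and \<nu> :: "'a \<Rightarrow> 'a \<Rightarrow> complex"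
    and X \<sigma> :: "'a \<Rightarrow> 'a"
    and S :: "'n::finite \<Rightarrow> 'a"
  assumes "simple_fd_lie_algebra TYPE('a)"
    and "cartan_subalgebra \<hh>"
    and "normalized_invariant_form \<hh> B"
    and "asymmetry_function (root_lattice \<hh> B) B \<nu>"
    and "root_vectors \<hh> B \<nu> X"
    and "lie_automorphism \<sigma>"
    and "\<forall>H\<in>\<hh>. \<sigma> H = - H"
    and "\<forall>\<alpha>\<in>roots \<hh> B. \<sigma> (X \<alpha>) = X (- \<alpha>)"
    and "orthonormal_basis \<hh> B S"
  shows "(\<exists>!\<pi>. vertex_map \<hh> B \<nu> X \<sigma> S \<pi>) \<and>
         (\<forall>\<pi>. vertex_map \<hh> B \<nu> X \<sigma> S \<pi> \<longrightarrow>
            lie_representation (twisted_affine \<sigma>) affine_scale (affine_bracket B)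
              (V_space (root_lattice \<hh> B)) V_scale \<pi>)"
proof -
  interpret simply_laced \<hh> B \<nu> X \<sigma> S
    using assms by (rule simply_laced.intro)
  show ?thesis
    using vertex_map_vertex_rep vertex_map_unique lie_representation_vertex_map by blast
qed

end
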